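(* Let $R$, $\mathfrak{m}$, $\tilde T$, $\pi$ and $\underline{\lambda}$ be as in the context. Let $M\in M_\infty(R)$ be a $\underline{\lambda}$-Hodge bounded matrix (with respect to $\tilde T$) and let $\bar M\in M_\infty(\mathbb{F}_p[[T]])$ be its reduction by $\mathfrak{m}$ (the matrix obtained by applying $\pi$ to all entries). Suppose that $\Omega=\{s_1<s_2<\cdots\}$ is an infinite set of touching vertices of $\bar M$ such that $N(\bar M,s)=\sum_{i=1}^s\lambda_i$ for all $s\in\Omega$. Then there exists a matrix $Q\in\mathrm{GL}_\infty(R)$ such that: 1. $Q$ is $\underline{\lambda}$-stable, and in particular $QMQ^{-1}$ is $\underline{\lambda}$-Hodge bounded; and 2. $QMQ^{-1}$ is block upper triangular, $$QMQ^{-1}=\begin{pmatrix}M_{11}&M_{12}\\0&M_{22}\end{pmatrix},$$ where $M_{11}$ is an $s_1\times s_1$ matrix.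
   Context: $p$ is a prime and $v_T$ is the $T$-adic valuation on $\mathbb{F}_p[[T]]$. $R$ is a ring with unit, not necessarily commutative, $\mathfrak{m}\subset R$ is a two-sided ideal and $\tilde T\in R$ is a central element which is not a zero divisor, such that: (i) $R$ is complete for the $(\mathfrak{m},\tilde T)$-adic topology, i.e. $R\cong\varprojlim_nR/(\mathfrak{m},\tilde T)^n$; (ii) there is a surjective ring homomorphism $\pi:R\to\mathbb{F}_p[[T]]$ with $\ker\pi=\mathfrak{m}$ and $\pi(\tilde T)=T$; (iii) with $v_{\tilde T}(x)=\sup\{n\mid x\in\tilde T^nR\}$ for $x\ne0$ and $v_{\tilde T}(0)=\infty$, every $\bar x\in\mathbb{F}_p[[T]]$ has a lift $x\in R$ with $\pi(x)=\bar x$ and $v_{\tilde T}(x)=v_T(\bar x)$. $\underline{\lambda}=(\lambda_1\le\lambda_2\le\cdots)$ is a sequence of nonnegative integers with $\lambda_n\to\infty$. $M_\infty(\cdot)$ denotes matrices indexed by $\{1,2,\dots\}\times\{1,2,\dots\}$; products of infinite matrices are given by entrywise convergent series, and $\mathrm{GL}_\infty(\cdot)$ denotes those with a two-sided inverse. $D_R(\underline{\lambda})=\mathrm{Diag}(\tilde T^{\lambda_1},\tilde T^{\lambda_2},\dots)$. A matrix $M\in M_\infty(R)$ is $\underline{\lambda}$-Hodge bounded if $M=D_R(\underline{\lambda})M'$ for some $M'\in M_\infty(R)$. A matrix $A\in M_\infty(R)$ is $\underline{\lambda}$-stable if $AB$ is $\underline{\lambda}$-Hodge bounded for every $\underline{\lambda}$-Hodge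 bounded $B\in M_\infty(R)$. The same definitions apply over $\mathbb{F}_p[[T]]$ with $T$ in place of $\tilde T$. For a $\underline{\lambda}$-Hodge bounded $\bar M\in M_\infty(\mathbb{F}_p[[T]])$ and $k\ge1$: $N(\bar M,k)=v_T\big(\sum\det(N)\big)$, the sum over all principal $k\times k$ submatrices $N$; $H(\bar M,k)=\min\{v_T(\det N)\}$ over all $k\times k$ submatrices $N$; and $N(\bar M,0)=H(\bar M,0)=0$. The Newton polygon of $\bar M$ is the lower convex hull of the points $(k,N(\bar M,k))$, $k\geq 0$. An integer $k$ is a touching vertex of $\bar M$ if $(k,N(\bar M,k))$ is a vertex of the Newton polygon of $\bar M$ and $N(\bar M,k)=H(\bar M,k)$. *)

theory Defs
  imports
    "HOL-Analysis.Analysis"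
    "HOL-Computational_Algebra.Formal_Power_Series"
    "Jordan_Normal_Form.Determinant"
    "Berlekamp_Zassenhaus.Finite_Field"
begin

section \<open>Ideals and the adic topology of a noncommutative ring\<close>

definition two_sided_ideal :: "'a::ring_1 set \<Rightarrow> bool" where
  "two_sided_ideal J \<longleftrightarrow>
     0 \<in> J \<and> (\<forall>x\<in>J. \<forall>y\<in>J. x + y \<in> J) \<and> (\<forall>x\<in>J. \<forall>r. r * x \<in> J \<and> x * r \<in> J)"

primrec ideal_power :: "'a::ring_1 set \<Rightarrow> nat \<Rightarrow> 'a set" where
  "ideal_power J 0 = UNIV"
| "ideal_power J (Suc n) = two_sided_ideal hull {x * y | x y. x \<in> J \<and> y \<in> ideal_power J n}"

definition residue_class :: "'a::ring_1 set \<Rightarrow> 'a \<Rightarrow> 'a set" where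
  "residue_class J x = {y. y - x \<in> J}"

text \<open>The inverse limit of the quotients by the powers of \<open>J\<close>. The transition map sends a class
  modulo \<open>ideal_power J (Suc n)\<close> to the class modulo \<open>ideal_power J n\<close> that contains it.\<close>

definition adic_limit :: "'a::ring_1 set \<Rightarrow> (nat \<Rightarrow> 'a set) set" where
  "adic_limit J =
     {c. (\<forall>n. c n \<in> range (residue_class (ideal_power J n))) \<and> (\<forall>n. c (Suc n) \<subseteq> c n)}"

definition adic_complete :: "'a::ring_1 set \<Rightarrow> bool" where
  "adic_complete J \<longleftrightarrow>
     bij_betw (\<lambda>x n. residue_class (ideal_power J n) x) UNIV (adic_limit J)"

definition adic_sums :: "'a::ring_1 set \<Rightarrow> (nat \<Rightarrow> 'a) \<Rightarrow> 'a \<Rightarrow> bool" where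
  "adic_sums J f s \<longleftrightarrow> (\<forall>n. \<forall>\<^sub>F K in sequentially. (\<Sum>k<K. f k) - s \<in> ideal_power J n)"


section \<open>Valuations\<close>

definition elt_val :: "'a::ring_1 \<Rightarrow> 'a \<Rightarrow> enat" where
  "elt_val t x = (if x = 0 then \<infinity> else (SUP n\<in>{n. \<exists>y. x = t ^ n * y}. enat n))"

definition fps_val :: "'a::zero fps \<Rightarrow> enat" where
  "fps_val f = (if f = 0 then \<infinity> else enat (subdegree f))"


section \<open>Infinite matrices\<close>

text \<open>Rows and columns are indexed from 0, so the sequence \<open>\<lambda>\<^sub>1 \<le> \<lambda>\<^sub>2 \<le> \<dots>\<close> is represented by
  \<open>l :: nat \<Rightarrow> nat\<close> with \<open>l i = \<lambda>\<^bsub>i+1\<^esub>\<close>.\<close>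

type_synonym 'a inf_mat = "nat \<Rightarrow> nat \<Rightarrow> 'a"

text \<open>A product of infinite matrices need not exist, so it is a relation: \<open>C\<close> is the product of
  \<open>A\<close> and \<open>B\<close>, with all the series for the entries converging \<open>J\<close>-adically.\<close>

definition inf_mat_prod :: "'a::ring_1 set \<Rightarrow> 'a inf_mat \<Rightarrow> 'a inf_mat \<Rightarrow> 'a inf_mat \<Rightarrow> bool" where
  "inf_mat_prod J A B C \<longleftrightarrow> (\<forall>i j. adic_sums J (\<lambda>k. A i k * B k j) (C i j))"

definition inf_mat_one :: "'a::ring_1 inf_mat" where
  "inf_mat_one i j = (if i = j then 1 else 0)"

definition inf_mat_inverse :: "'a::ring_1 set \<Rightarrow> 'a inf_mat \<Rightarrow> 'a inf_mat \<Rightarrow> bool" where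
  "inf_mat_inverse J Q Q' \<longleftrightarrow>
     inf_mat_prod J Q Q' inf_mat_one \<and> inf_mat_prod J Q' Q inf_mat_one"

text \<open>The triple product: multiplication of infinite matrices is not associative in general, so both
  bracketings are required to exist and to give \<open>D\<close>.\<close>

definition inf_mat_prod3 ::
    "'a::ring_1 set \<Rightarrow> 'a inf_mat \<Rightarrow> 'a inf_mat \<Rightarrow> 'a inf_mat \<Rightarrow> 'a inf_mat \<Rightarrow> bool" where
  "inf_mat_prod3 J A B C D \<longleftrightarrow>
     (\<exists>P. inf_mat_prod J A B P \<and> inf_mat_prod J P C D) \<and>
     (\<exists>P. inf_mat_prod J B C P \<and> inf_mat_prod J A P D)"

definition hodge_diag :: "'a::ring_1 \<Rightarrow> (nat \<Rightarrow> nat) \<Rightarrow> 'a inf_mat" where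
  "hodge_diag t l i j = (if i = j then t ^ l i else 0)"

definition hodge_bounded :: "'a::ring_1 set \<Rightarrow> 'a \<Rightarrow> (nat \<Rightarrow> nat) \<Rightarrow> 'a inf_mat \<Rightarrow> bool" where
  "hodge_bounded J t l M \<longleftrightarrow> (\<exists>M'. inf_mat_prod J (hodge_diag t l) M' M)"

definition hodge_stable :: "'a::ring_1 set \<Rightarrow> 'a \<Rightarrow> (nat \<Rightarrow> nat) \<Rightarrow> 'a inf_mat \<Rightarrow> bool" where
  "hodge_stable J t l A \<longleftrightarrow>
     (\<forall>B. hodge_bounded J t l B \<longrightarrow> (\<exists>C. inf_mat_prod J A B C \<and> hodge_bounded J t l C))"


section \<open>Newton and Hodge functions, touching vertices\<close>

definition minor :: "'a::comm_ring_1 inf_mat \<Rightarrow> nat set \<Rightarrow> nat set \<Rightarrow> 'a" where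
  "minor M I J =
     Determinant.det (Matrix.mat (card I) (card J)
       (\<lambda>(i, j). M (sorted_list_of_set I ! i) (sorted_list_of_set J ! j)))"

definition index_sets :: "nat \<Rightarrow> nat set set" where
  "index_sets k = {I. finite I \<and> card I = k}"

text \<open>The infinite sum is taken in the \<open>T\<close>-adic metric of formal power series. It converges for
  Hodge bounded matrices with \<open>\<lambda>\<^sub>n \<rightarrow> \<infinity>\<close>.\<close>

definition newton_fun :: "'a::field fps inf_mat \<Rightarrow> nat \<Rightarrow> enat" where
  "newton_fun M k = fps_val (\<Sum>\<^sub>\<infinity>I\<in>index_sets k. minor M I I)"

definition hodge_fun :: "'a::field fps inf_mat \<Rightarrow> nat \<Rightarrow> enat" where
  "hodge_fun M k = (INF (I, J)\<in>index_sets k \<times> index_sets k. fps_val (minor M I J))"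

text \<open>The Newton polygon is represented by the region on and above it; points with infinite
  ordinate are omitted. Its vertices are the extreme points of this region.\<close>

definition newton_region :: "'a::field fps inf_mat \<Rightarrow> (real \<times> real) set" where
  "newton_region M =
     convex hull {(real k, y) | k y. \<exists>n. newton_fun M k = enat n \<and> real n \<le> y}"

definition touching_vertex :: "'a::field fps inf_mat \<Rightarrow> nat \<Rightarrow> bool" where
  "touching_vertex M k \<longleftrightarrow>
     (\<exists>n. newton_fun M k = enat n \<and> (real k, real n) extreme_point_of newton_region M) \<and>
     newton_fun M k = hodge_fun M k"

end

theory Submission
  imports Defs
begin

text \<open>Write \<open>M = D A\<close> with \<open>D\<close> the Hodge diagonal, and let \<open>b\<close> be the reduction of \<open>A\<close> modulo \<open>J\<close>,
  a matrix over the residue field. A conjugating matrix \<open>Q = 1 + X\<close> with \<open>X\<close> in the lower left block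
  is stable when \<open>X = D\<^sub>2 Y D\<^sub>1\<inverse>\<close>, and \<open>Q M Q\<inverse>\<close> is block upper triangular iff \<open>Y\<close> solves a Riccati
  equation. Only the indices with \<open>l i = l (s - 1)\<close> survive in its linearization modulo \<open>J\<close>; if the
  top left block of \<open>b\<close> is invertible and the surviving part is nilpotent, Newton iteration solves
  the equation in the complete ring.

  To reach this situation, let \<open>E\<close> be the projection to these indices and consider the pencil
  \<open>\<alpha> E + \<beta> b\<close>. The coefficients of its determinant are sums of principal minors of \<open>b\<close>, and
  they are nonzero exactly where the Newton function meets the Hodge polygon. Since that polygon
  is a line segment over this range, a vertex at \<open>s\<close> excludes contact on one of the two sides of
  \<open>s\<close>, so that the pencil has the root \<open>0\<close> with multiplicity \<open>n - s\<close> or the root \<open>\<infinity>\<close> with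
  multiplicity \<open>s\<close>. In both cases the eigenvectors for this root are split off one at a time by
  swaps and transvections, which lift to \<open>R\<close>.\<close>

section \<open>Powers of two-sided ideals\<close>

text \<open>If \<open>l (s - 1) < l s\<close>, the twist puts a factor \<open>t\<close> on every
  entry of \<open>X\<close>, and the Riccati equation is contracting modulo \<open>J\<close>. The
  obstacle is \<open>l (s - 1) = l s\<close>: there \<open>X\<close> need not be small, and the
  splitting has to be visible already over the residue field. Conjugating \<open>M = D A\<close> by
  \<open>e\<close> with inverse \<open>e'\<close> and \<open>e D = D G\<close> replaces
  \<open>A\<close> by \<open>G A e'\<close>. The reductions of \<open>G\<close> and \<open>e\<close>
  differ in general, so \<open>b\<close> is not conjugated and its characteristic polynomial is not
  an invariant. What survives reduction is \<open>G E = E e\<close> on the first \<open>n\<close>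
  indices, hence \<open>G (\<alpha> E + \<beta> b) e' = \<alpha> E + \<beta> G b e'\<close>, and the
  determinant of the pencil changes only by a nonzero constant. The residue field need not contain
  the roots of this determinant, but the roots 0 and infinity are always rational, so their
  eigenvectors exist without extending the field. Determinants occur only over commutative rings
  built from the residue field; the noncommutative ring sees lifts of elementary matrices and
  successive approximation.\<close>

lemma two_sided_ideal_Inter:
  assumes "\<And>I. I \<in> F \<Longrightarrow> two_sided_ideal I"
  shows "two_sided_ideal (\<Inter>F)"
  using assms unfolding two_sided_ideal_def by blast

lemma two_sided_ideal_hull: "two_sided_ideal (two_sided_ideal hull S)"
  by (rule hull_in) (auto intro: two_sided_ideal_Inter)

lemma two_sided_ideal_UNIV: "two_sided_ideal UNIV"
  by (simp add: two_sided_ideal_def)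

lemma two_sided_ideal_ideal_power: "two_sided_ideal (ideal_power J n)"
  by (cases n) (simp_all add: two_sided_ideal_UNIV two_sided_ideal_hull)

lemma two_sided_ideal_uminus: "two_sided_ideal I \<Longrightarrow> x \<in> I \<Longrightarrow> - x \<in> I"
  unfolding two_sided_ideal_def by (metis mult_minus1)

lemma ideal_power_0 [simp]: "0 \<in> ideal_power J n"
  and ideal_power_add: "x \<in> ideal_power J n \<Longrightarrow> y \<in> ideal_power J n \<Longrightarrow> x + y \<in> ideal_power J n"
  and ideal_power_lmult: "x \<in> ideal_power J n \<Longrightarrow> r * x \<in> ideal_power J n"
  and ideal_power_rmult: "x \<in> ideal_power J n \<Longrightarrow> x * r \<in> ideal_power J n"
  using two_sided_ideal_ideal_power[of J n] by (auto simp: two_sided_ideal_def)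

lemma ideal_power_uminus: "x \<in> ideal_power J n \<Longrightarrow> - x \<in> ideal_power J n"
  by (rule two_sided_ideal_uminus[OF two_sided_ideal_ideal_power])

lemma ideal_power_diff:
  "x \<in> ideal_power J n \<Longrightarrow> y \<in> ideal_power J n \<Longrightarrow> x - y \<in> ideal_power J n"
  using ideal_power_add[of x J n "- y"] ideal_power_uminus by auto

lemma ideal_power_sum:
  "(\<And>i. i \<in> A \<Longrightarrow> f i \<in> ideal_power J n) \<Longrightarrow> sum f A \<in> ideal_power J n"
  by (induction A rule: infinite_finite_induct) (auto intro: ideal_power_add)

lemma ideal_power_Suc_lmult:
  "x \<in> J \<Longrightarrow> y \<in> ideal_power J n \<Longrightarrow> x * y \<in> ideal_power J (Suc n)"
  by (auto intro!: hull_inc)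

text \<open>\<open>ideal_power\<close> adds its new factor on the left, so the right-hand version
  needs an induction: the set \<open>?S\<close> of admissible left factors is itself a two-sided
  ideal and contains the generators of the power.\<close>

lemma ideal_power_Suc_rmult:
  assumes J: "two_sided_ideal J" and "x \<in> ideal_power J n" "y \<in> J"
  shows "x * y \<in> ideal_power J (Suc n)"
  using assms(2,3)
proof (induction n arbitrary: x y)
  case 0
  have "y * 1 \<in> ideal_power J (Suc 0)"
    using 0 by (intro ideal_power_Suc_lmult) auto
  then show ?case by (metis ideal_power_lmult mult_1_right)
next
  case (Suc n)
  let ?S = "{x. \<forall>y\<in>J. x * y \<in> ideal_power J (Suc (Suc n))}"
  have S: "two_sided_ideal ?S"
    unfolding two_sided_ideal_def
  proof (intro conjI ballI allI)
    fix a b assume "a \<in> ?S" "b \<in> ?S"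
    then show "a + b \<in> ?S"
      by (auto simp: distrib_right simp del: ideal_power.simps intro: ideal_power_add)
  next
    fix a r assume a: "a \<in> ?S"
    then show "r * a \<in> ?S"
      by (auto simp: mult.assoc simp del: ideal_power.simps intro: ideal_power_lmult)
    have "r * y \<in> J" if "y \<in> J" for y using J that by (auto simp: two_sided_ideal_def)
    then show "a * r \<in> ?S" using a by (auto simp: mult.assoc simp del: ideal_power.simps)
  qed (auto simp del: ideal_power.simps)
  have "{a * b | a b. a \<in> J \<and> b \<in> ideal_power J n} \<subseteq> ?S"
  proof clarify
    fix a b y assume "a \<in> J" "b \<in> ideal_power J n" "y \<in> J"
    then show "a * b * y \<in> ideal_power J (Suc (Suc n))"
      using ideal_power_Suc_lmult Suc.IH by (metis mult.assoc)
  qed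
  then have "ideal_power J (Suc n) \<subseteq> ?S"
    unfolding ideal_power.simps by (rule hull_minimal) (rule S[unfolded ideal_power.simps])
  then show ?case using Suc.prems by blast
qed

lemma ideal_power_Suc_subset: "ideal_power J (Suc n) \<subseteq> ideal_power J n"
proof -
  have "{x * y |x y. x \<in> J \<and> y \<in> ideal_power J n} \<subseteq> ideal_power J n"
    by (auto intro: ideal_power_lmult)
  then show ?thesis
    unfolding ideal_power.simps by (rule hull_minimal) (rule two_sided_ideal_ideal_power)
qed

lemma ideal_power_antimono: "m \<le> n \<Longrightarrow> ideal_power J n \<subseteq> ideal_power J m"
  by (rule lift_Suc_antimono_le[of "ideal_power J"]) (rule ideal_power_Suc_subset)

lemma ideal_power_1:
  assumes "two_sided_ideal J" shows "ideal_power J (Suc 0) = J"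
proof
  show "ideal_power J (Suc 0) \<subseteq> J"
    unfolding ideal_power.simps using assms
    by (intro hull_minimal) (auto simp: two_sided_ideal_def)
  show "J \<subseteq> ideal_power J (Suc 0)"
    using ideal_power_Suc_lmult[of _ J 1 0] by (auto simp del: ideal_power.simps(2))
qed

lemma power_in_ideal_power: "x \<in> J \<Longrightarrow> x ^ n \<in> ideal_power J n"
  by (induction n) (auto simp del: ideal_power.simps(2) intro: ideal_power_Suc_lmult)

lemma adic_complete_separated:
  assumes "adic_complete J" and "\<And>n. x - y \<in> ideal_power J n"
  shows "x = y"
proof -
  have "residue_class (ideal_power J n) x = residue_class (ideal_power J n) y" for n
  proof -
    have "z - y \<in> ideal_power J n \<longleftrightarrow> z - x \<in> ideal_power J n" for z
      using ideal_power_diff[OF _ assms(2)[of n], of "z - y"]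
        ideal_power_add[OF _ assms(2)[of n], of "z - x"] by auto
    then show ?thesis unfolding residue_class_def by auto
  qed
  moreover have "inj (\<lambda>x n. residue_class (ideal_power J n) x)"
    using assms(1) unfolding adic_complete_def bij_betw_def by simp
  ultimately show ?thesis by (auto dest!: injD[of _ x y])
qed

lemma adic_complete_Cauchy:
  fixes f :: "nat \<Rightarrow> 'a::ring_1"
  assumes "adic_complete J" and "\<And>n. f (Suc n) - f n \<in> ideal_power J n"
  obtains x where "\<And>n. f n - x \<in> ideal_power J n"
proof -
  let ?c = "\<lambda>n. residue_class (ideal_power J n) (f n)"
  have "?c (Suc n) \<subseteq> ?c n" for n
  proof
    fix y assume "y \<in> ?c (Suc n)"
    then have "y - f (Suc n) \<in> ideal_power J n"
      using ideal_power_Suc_subset unfolding residue_class_def by blast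
    from ideal_power_add[OF this assms(2)[of n]] show "y \<in> ?c n"
      by (simp add: residue_class_def)
  qed
  then have "?c \<in> adic_limit J" unfolding adic_limit_def by auto
  then obtain x where x: "?c = (\<lambda>n. residue_class (ideal_power J n) x)"
    using assms(1) unfolding adic_complete_def bij_betw_def by (auto simp: image_iff)
  have "f n - x \<in> ideal_power J n" for n
  proof -
    have "f n \<in> ?c n" by (simp add: residue_class_def)
    then show ?thesis unfolding fun_cong[OF x] by (simp add: residue_class_def)
  qed
  then show thesis by (rule that)
qed

section \<open>Convergent series\<close>

lemma adic_sums_unique:
  assumes "adic_complete J" "adic_sums J f a" "adic_sums J f b"
  shows "a = b"
proof (rule adic_complete_separated[OF assms(1)])
  fix n
  have "\<forall>\<^sub>F K in sequentially. sum f {..<K} - a \<in> ideal_power J n \<and> sum f {..<K} - b \<in> ideal_power J n"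
    using assms(2,3) unfolding adic_sums_def by (simp add: eventually_conj)
  then obtain K where "sum f {..<K} - a \<in> ideal_power J n" "sum f {..<K} - b \<in> ideal_power J n"
    by (auto dest: eventually_happens'[OF sequentially_bot])
  from ideal_power_diff[OF this(2,1)] show "a - b \<in> ideal_power J n" by simp
qed

lemma adic_sums_cong_eventually:
  assumes "\<forall>\<^sub>F K in sequentially. sum f {..<K} = sum g {..<K}"
  shows "adic_sums J f a \<longleftrightarrow> adic_sums J g a"
  unfolding adic_sums_def
  by (intro iff_allI eventually_subst) (use assms in eventually_elim, simp)

lemma adic_sums_finite:
  assumes "\<And>k. k \<ge> N \<Longrightarrow> f k = 0"
  shows "adic_sums J f (\<Sum>k<N. f k)"
  unfolding adic_sums_def
proof
  fix n
  show "\<forall>\<^sub>F K in sequentially. sum f {..<K} - sum f {..<N} \<in> ideal_power J n"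
    using eventually_ge_at_top[of N]
  proof eventually_elim
    case (elim K)
    then have "sum f {..<K} = sum f {..<N}"
      by (intro sum.mono_neutral_right) (auto intro: assms)
    then show ?case by simp
  qed
qed

lemma adic_sums_add:
  assumes "adic_sums J f a" "adic_sums J g b"
  shows "adic_sums J (\<lambda>k. f k + g k) (a + b)"
  unfolding adic_sums_def
proof
  fix n
  have "\<forall>\<^sub>F K in sequentially. sum f {..<K} - a \<in> ideal_power J n"
    "\<forall>\<^sub>F K in sequentially. sum g {..<K} - b \<in> ideal_power J n"
    using assms unfolding adic_sums_def by auto
  then show "\<forall>\<^sub>F K in sequentially. (\<Sum>k<K. f k + g k) - (a + b) \<in> ideal_power J n"
  proof eventually_elim
    case (elim K)
    from ideal_power_add[OF this] show ?case by (simp add: sum.distrib algebra_simps)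
  qed
qed

lemma adic_sums_lmult:
  assumes "adic_sums J f a"
  shows "adic_sums J (\<lambda>k. r * f k) (r * a)"
  unfolding adic_sums_def
proof
  fix n
  have "\<forall>\<^sub>F K in sequentially. sum f {..<K} - a \<in> ideal_power J n"
    using assms unfolding adic_sums_def by auto
  then show "\<forall>\<^sub>F K in sequentially. (\<Sum>k<K. r * f k) - r * a \<in> ideal_power J n"
  proof eventually_elim
    case (elim K)
    from ideal_power_lmult[OF this, of r] show ?case
      by (simp add: sum_distrib_left right_diff_distrib)
  qed
qed

lemma adic_sums_rmult:
  assumes "adic_sums J f a"
  shows "adic_sums J (\<lambda>k. f k * r) (a * r)"
  unfolding adic_sums_def
proof
  fix n
  have "\<forall>\<^sub>F K in sequentially. sum f {..<K} - a \<in> ideal_power J n"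
    using assms unfolding adic_sums_def by auto
  then show "\<forall>\<^sub>F K in sequentially. (\<Sum>k<K. f k * r) - a * r \<in> ideal_power J n"
  proof eventually_elim
    case (elim K)
    from ideal_power_rmult[OF this, of r] show ?case
      by (simp add: sum_distrib_right left_diff_distrib)
  qed
qed

lemma adic_sums_uminus: "adic_sums J f a \<Longrightarrow> adic_sums J (\<lambda>k. - f k) (- a)"
  using adic_sums_lmult[of J f a "- 1"] by simp

lemma adic_sums_diff:
  "adic_sums J f a \<Longrightarrow> adic_sums J g b \<Longrightarrow> adic_sums J (\<lambda>k. f k - g k) (a - b)"
  using adic_sums_add[OF _ adic_sums_uminus, of J f a g b] by simp

lemma adic_sums_sum:
  "(\<And>i. i \<in> A \<Longrightarrow> adic_sums J (f i) (a i)) \<Longrightarrow> adic_sums J (\<lambda>k. \<Sum>i\<in>A. f i k) (\<Sum>i\<in>A. a i)"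
proof (induction A rule: infinite_finite_induct)
  case (insert i A)
  then show ?case using adic_sums_add[of J "f i" "a i" "\<lambda>k. \<Sum>i\<in>A. f i k"] by simp
qed (use adic_sums_finite[of 0 "\<lambda>_. 0" J] in auto)

lemma adic_sums_mem:
  assumes "adic_sums J f a" "\<And>k. f k \<in> ideal_power J n"
  shows "a \<in> ideal_power J n"
proof -
  obtain K where "sum f {..<K} - a \<in> ideal_power J n"
    using assms(1) unfolding adic_sums_def
    by (auto dest: eventually_happens'[OF sequentially_bot])
  moreover have "sum f {..<K} \<in> ideal_power J n" by (rule ideal_power_sum) (rule assms(2))
  ultimately show ?thesis using ideal_power_diff by fastforce
qed

lemma adic_sums_exists:
  fixes f :: "nat \<Rightarrow> 'a::ring_1"
  assumes "adic_complete J" and "\<And>n. \<forall>\<^sub>F k in sequentially. f k \<in> ideal_power J n"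
  shows "\<exists>a. adic_sums J f a"
proof -
  have "\<exists>N. \<forall>k\<ge>N. f k \<in> ideal_power J n" for n
    using assms(2) by (simp add: eventually_sequentially)
  then obtain N where N: "\<And>n k. N n \<le> k \<Longrightarrow> f k \<in> ideal_power J n" by metis
  \<comment> \<open>Partial sums make the thresholds increase with \<open>n\<close>, as the
    comparison of consecutive ones requires.\<close>
  define N' where "N' n = (\<Sum>i\<le>n. N i)" for n
  have N': "N n \<le> N' n" for n unfolding N'_def by (rule member_le_sum) auto
  have tail: "sum f {..<K} - sum f {..<N' n} \<in> ideal_power J n" if "K \<ge> N' n" for K n
  proof -
    have "sum f {..<K} = sum f {..<N' n} + sum f {N' n..<K}"
      using sum.atLeastLessThan_concat[of 0 "N' n" K f] that by (simp add: atLeast0LessThan)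
    moreover have "sum f {N' n..<K} \<in> ideal_power J n"
      by (rule ideal_power_sum) (use N N' in \<open>auto intro: N order_trans[OF N']\<close>)
    ultimately show ?thesis by simp
  qed
  have "N' n \<le> N' (Suc n)" for n by (simp add: N'_def)
  from tail[OF this] obtain a where a: "\<And>n. sum f {..<N' n} - a \<in> ideal_power J n"
    using adic_complete_Cauchy[OF assms(1), of "\<lambda>n. sum f {..<N' n}"] by blast
  have "adic_sums J f a"
    unfolding adic_sums_def
  proof
    fix n
    show "\<forall>\<^sub>F K in sequentially. sum f {..<K} - a \<in> ideal_power J n"
      using eventually_ge_at_top[of "N' n"]
    proof eventually_elim
      case (elim K)
      from ideal_power_add[OF tail[OF this] a] show ?case by simp
    qed
  qed
  then show ?thesis ..
qed

section \<open>Hodge bounded matrices over an adically complete ring\<close>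

text \<open>To be used with \<open>J\<close> generated by the kernel of \<open>\<pi>\<close> and
  \<open>t\<close>, and with \<open>\<rho>\<close> the constant coefficient of \<open>\<pi>\<close>.
  Power series enter only through the Newton function.\<close>

locale adic_lift =
  fixes J :: "'r::ring_1 set" and t :: 'r and l :: "nat \<Rightarrow> nat" and \<rho> :: "'r \<Rightarrow> 'k::field"
  assumes ideal_J: "two_sided_ideal J"
    and complete_J: "adic_complete J"
    and t_in_J: "t \<in> J"
    and t_central: "\<And>x. t * x = x * t"
    and t_nonzerodivisor: "\<And>x. t * x = 0 \<Longrightarrow> x = 0"
    and hom_add: "\<And>x y. \<rho> (x + y) = \<rho> x + \<rho> y"
    and hom_mult: "\<And>x y. \<rho> (x * y) = \<rho> x * \<rho> y"
    and hom_1 [simp]: "\<rho> 1 = 1"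
    and hom_surj: "\<And>y. \<exists>x. \<rho> x = y"
    and hom_kernel: "\<And>x. \<rho> x = 0 \<longleftrightarrow> x \<in> J"
    and mono_l: "mono l"
    and l_at_top: "filterlim l at_top sequentially"
begin

abbreviation pow :: "nat \<Rightarrow> 'r set" where "pow \<equiv> ideal_power J"

lemma pow_1: "x \<in> pow (Suc 0) \<longleftrightarrow> x \<in> J"
  using ideal_power_1[OF ideal_J] by blast

lemma pow_mono: "x \<in> pow n \<Longrightarrow> m \<le> n \<Longrightarrow> x \<in> pow m"
  using ideal_power_antimono by blast

lemma pow_Suc_lmult: "x \<in> J \<Longrightarrow> y \<in> pow n \<Longrightarrow> x * y \<in> pow (Suc n)"
  by (rule ideal_power_Suc_lmult)

lemma pow_Suc_rmult: "x \<in> pow n \<Longrightarrow> y \<in> J \<Longrightarrow> x * y \<in> pow (Suc n)"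
  by (rule ideal_power_Suc_rmult[OF ideal_J])

lemma J_0 [simp]: "0 \<in> J"
  and J_add: "x \<in> J \<Longrightarrow> y \<in> J \<Longrightarrow> x + y \<in> J"
  and J_lmult: "x \<in> J \<Longrightarrow> r * x \<in> J"
  and J_rmult: "x \<in> J \<Longrightarrow> x * r \<in> J"
  using ideal_J by (auto simp: two_sided_ideal_def)

lemma J_sum: "(\<And>i. i \<in> A \<Longrightarrow> f i \<in> J) \<Longrightarrow> sum f A \<in> J"
  using ideal_power_sum[of A f J "Suc 0"] by (simp only: pow_1)

lemma hom_0 [simp]: "\<rho> 0 = 0"
  by (simp add: hom_kernel)

lemma hom_uminus: "\<rho> (- x) = - \<rho> x"
  using hom_add[of x "- x"] by (simp add: eq_neg_iff_add_eq_0 add.commute)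

lemma hom_diff: "\<rho> (x - y) = \<rho> x - \<rho> y"
  using hom_add[of x "- y"] by (simp add: hom_uminus)

lemma hom_sum: "\<rho> (sum f A) = (\<Sum>i\<in>A. \<rho> (f i))"
  by (induction A rule: infinite_finite_induct) (auto simp: hom_add)

lemma t_pow_central: "t ^ n * x = x * t ^ n"
proof (induction n)
  case (Suc n)
  then show ?case by (metis mult.assoc power_Suc t_central)
qed simp

lemma t_pow_cancel: "t ^ n * x = t ^ n * y \<Longrightarrow> x = y"
proof (induction n)
  case (Suc n)
  have "t * (t ^ n * x - t ^ n * y) = 0"
    using Suc.prems by (simp add: right_diff_distrib mult.assoc)
  then show ?case using Suc.IH t_nonzerodivisor by fastforce
qed simp

lemma t_pow_in: "t ^ n \<in> pow n"
  by (rule power_in_ideal_power[OF t_in_J])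

lemma t_pow_in_J: "0 < n \<Longrightarrow> t ^ n \<in> J"
  using t_in_J by (cases n) (auto intro: J_rmult)

lemma l_mono: "i \<le> j \<Longrightarrow> l i \<le> l j"
  by (rule monoD[OF mono_l])

definition hodge_mat :: "'r inf_mat \<Rightarrow> 'r inf_mat" where
  "hodge_mat A i j = t ^ l i * A i j"

lemma inf_mat_prod_hodge_diag: "inf_mat_prod J (hodge_diag t l) A (hodge_mat A)"
  unfolding inf_mat_prod_def
proof (intro allI)
  fix i j
  have "adic_sums J (\<lambda>k. hodge_diag t l i k * A k j) (\<Sum>k<Suc i. hodge_diag t l i k * A k j)"
    by (rule adic_sums_finite) (simp add: hodge_diag_def)
  moreover have "(\<Sum>k<Suc i. hodge_diag t l i k * A k j) = hodge_mat A i j"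
    by (simp add: hodge_diag_def hodge_mat_def)
  ultimately show "adic_sums J (\<lambda>k. hodge_diag t l i k * A k j) (hodge_mat A i j)" by simp
qed

lemma inf_mat_prod_unique:
  "inf_mat_prod J A B C \<Longrightarrow> inf_mat_prod J A B C' \<Longrightarrow> C = C'"
  unfolding inf_mat_prod_def using adic_sums_unique[OF complete_J] by blast

lemma hodge_bounded_iff: "hodge_bounded J t l B \<longleftrightarrow> (\<exists>A. B = hodge_mat A)"
  unfolding hodge_bounded_def
  using inf_mat_prod_hodge_diag inf_mat_prod_unique by metis

text \<open>The conclusion of the theorem for \<open>hodge_mat A\<close>, phrased as a property of
  \<open>A\<close> because all reductions act on \<open>A\<close>.\<close>

definition reducible :: "nat \<Rightarrow> 'r inf_mat \<Rightarrow> bool" where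
  "reducible s A \<longleftrightarrow> (\<exists>Q Q' C. inf_mat_inverse J Q Q' \<and> hodge_stable J t l Q \<and>
     inf_mat_prod3 J Q (hodge_mat A) Q' C \<and> hodge_bounded J t l C \<and>
     (\<forall>i j. s \<le> i \<and> j < s \<longrightarrow> C i j = 0))"

end

section \<open>The Riccati equation\<close>

text \<open>The splitting point \<open>s\<close> may lie strictly inside the range from \<open>r\<close> to \<open>n\<close> on which \<open>l\<close> is
  constant. This is the case in which the Riccati equation is not contracting modulo \<open>J\<close>.\<close>

locale adic_level = adic_lift +
  fixes r s n a :: nat
  assumes r_less: "r < s" and s_le: "s \<le> n"
    and l_less: "\<And>i. i < r \<Longrightarrow> l i < a"
    and l_eq: "\<And>i. r \<le> i \<Longrightarrow> i < n \<Longrightarrow> l i = a"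
    and l_greater: "\<And>i. n \<le> i \<Longrightarrow> a < l i"

section \<open>Twisted tail sums and the linearized residual\<close>

context adic_level
begin

text \<open>Conjugation by the Hodge diagonal. The subtraction of naturals is exact for
  \<open>i < s \<le> k\<close>, the block in which \<open>X\<close> lives, because \<open>l\<close>
  is monotone.\<close>

definition twist :: "'a inf_mat \<Rightarrow> 'a inf_mat" where
  "twist Y k i = t ^ (l k - l i) * Y k i"

text \<open>The description is always proper: the powers of \<open>t\<close> in \<open>twist\<close>
  tend to zero, so the series converges for all \<open>A\<close> and \<open>Y\<close>.\<close>

definition tail_prod :: "'a inf_mat \<Rightarrow> 'a inf_mat \<Rightarrow> 'a inf_mat" where
  "tail_prod A Y i j = (THE x. adic_sums J (\<lambda>k. if s \<le> k then A i k * twist Y k j else 0) x)"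

lemma eventually_twist: "\<forall>\<^sub>F k in sequentially. twist Y k j \<in> pow m"
proof -
  have "\<forall>\<^sub>F k in sequentially. m + l j \<le> l k"
    using l_at_top by (simp add: filterlim_at_top)
  then show ?thesis
  proof eventually_elim
    case (elim k)
    then show ?case unfolding twist_def
      by (intro ideal_power_rmult pow_mono[OF t_pow_in]) simp
  qed
qed

lemma tail_prod_sums:
  "adic_sums J (\<lambda>k. if s \<le> k then A i k * twist Y k j else 0) (tail_prod A Y i j)"
proof -
  let ?f = "\<lambda>k. if s \<le> k then A i k * twist Y k j else 0"
  have "\<exists>x. adic_sums J ?f x"
  proof (rule adic_sums_exists[OF complete_J])
    fix m
    show "\<forall>\<^sub>F k in sequentially. ?f k \<in> pow m"
      using eventually_twist by eventually_elim (auto intro: ideal_power_lmult)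
  qed
  then have "\<exists>!x. adic_sums J ?f x"
    using adic_sums_unique[OF complete_J] by blast
  from theI'[OF this] show ?thesis unfolding tail_prod_def .
qed

lemma tail_prod_eqI:
  "adic_sums J (\<lambda>k. if s \<le> k then A i k * twist Y k j else 0) x \<Longrightarrow> tail_prod A Y i j = x"
  by (rule adic_sums_unique[OF complete_J tail_prod_sums])

lemma tail_prod_add:
  "tail_prod A (\<lambda>k j. Y k j + D k j) i j = tail_prod A Y i j + tail_prod A D i j"
proof (rule tail_prod_eqI)
  have *: "(\<lambda>k. if s \<le> k then A i k * twist (\<lambda>k j. Y k j + D k j) k j else 0) =
    (\<lambda>k. (if s \<le> k then A i k * twist Y k j else 0) + (if s \<le> k then A i k * twist D k j else 0))"
    by (auto simp: twist_def algebra_simps)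
  show "adic_sums J (\<lambda>k. if s \<le> k then A i k * twist (\<lambda>k j. Y k j + D k j) k j else 0)
     (tail_prod A Y i j + tail_prod A D i j)"
    unfolding * by (intro adic_sums_add tail_prod_sums)
qed

lemma tail_prod_mem:
  assumes "\<And>k. s \<le> k \<Longrightarrow> D k j \<in> pow m"
  shows "tail_prod A D i j \<in> pow m"
  by (rule adic_sums_mem[OF tail_prod_sums])
    (auto simp: twist_def intro!: ideal_power_lmult assms)

text \<open>Modulo the next power of \<open>J\<close> only the indices \<open>k\<close> with \<open>l k = l j\<close> contribute.\<close>

lemma twist_mem:
  assumes "D k j \<in> pow m" "s \<le> k" "j < s" "\<not> (r \<le> j \<and> k < n)"
  shows "twist D k j \<in> pow (Suc m)"
proof -
  have "l j < l k"
  proof (cases "k < n")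
    case True
    then show ?thesis using assms l_less[of j] l_eq[of k] r_less by simp
  next
    case False
    then show ?thesis using assms l_less[of j] l_eq[of j] l_greater[of k] s_le by (cases "j < r") auto
  qed
  then show ?thesis unfolding twist_def by (intro pow_Suc_lmult t_pow_in_J assms) simp
qed

lemma twist_level: "r \<le> j \<Longrightarrow> j < s \<Longrightarrow> s \<le> k \<Longrightarrow> k < n \<Longrightarrow> twist D k j = D k j"
  using l_eq[of j] l_eq[of k] s_le r_less by (simp add: twist_def)

lemma tail_prod_approx:
  assumes D: "\<And>k. s \<le> k \<Longrightarrow> D k j \<in> pow m" and j: "j < s"
  shows "tail_prod A D i j - (if r \<le> j then \<Sum>k=s..<n. A i k * D k j else 0) \<in> pow (Suc m)"
proof -
  define g where "g k = (if r \<le> j \<and> s \<le> k \<and> k < n then A i k * D k j else 0)" for k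
  have "adic_sums J g (\<Sum>k<n. g k)"
    by (rule adic_sums_finite) (simp add: g_def)
  moreover have "(\<Sum>k<n. g k) = (if r \<le> j then \<Sum>k=s..<n. A i k * D k j else 0)"
  proof -
    have "(\<Sum>k<n. g k) = (\<Sum>k=s..<n. g k)"
      by (rule sum.mono_neutral_right) (auto simp: g_def)
    also have "\<dots> = (if r \<le> j then \<Sum>k=s..<n. A i k * D k j else 0)"
      by (auto simp: g_def intro: sum.cong)
    finally show ?thesis .
  qed
  ultimately have "adic_sums J
    (\<lambda>k. (if s \<le> k then A i k * twist D k j else 0) - g k)
    (tail_prod A D i j - (if r \<le> j then \<Sum>k=s..<n. A i k * D k j else 0))"
    using adic_sums_diff[OF tail_prod_sums, of g] by simp
  then show ?thesis
  proof (rule adic_sums_mem)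
    fix k
    show "(if s \<le> k then A i k * twist D k j else 0) - g k \<in> pow (Suc m)"
    proof (cases "s \<le> k")
      case True
      then have "twist D k j \<in> pow (Suc m)" if "\<not> (r \<le> j \<and> k < n)"
        using twist_mem[of D k j m] D j that by blast
      then show ?thesis using True twist_level[of j k D] j
        by (cases "r \<le> j \<and> k < n") (auto simp: g_def simp del: ideal_power.simps intro: ideal_power_lmult)
    next
      case False
      then show ?thesis by (simp add: g_def del: ideal_power.simps)
    qed
  qed
qed

text \<open>With \<open>Q' = 1 - X\<close>, the columns \<open>j < s\<close> of \<open>M Q'\<close>
  are \<open>t ^ l i * corner A Y i j\<close>. Multiplying by \<open>Q\<close> from the left turns
  the lower left block into \<open>t ^ l i * residual A Y i j\<close>, so
  \<open>residual = 0\<close> is the Riccati equation.\<close>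

definition corner :: "'a inf_mat \<Rightarrow> 'a inf_mat \<Rightarrow> 'a inf_mat" where
  "corner A Y i j = A i j - tail_prod A Y i j"

definition residual :: "'a inf_mat \<Rightarrow> 'a inf_mat \<Rightarrow> 'a inf_mat" where
  "residual A Y i j = corner A Y i j + (\<Sum>q<s. Y i q * corner A Y q j)"

text \<open>Off the level the twist supplies a factor \<open>t\<close>; on the level membership is
  the hypothesis.\<close>

lemma tail_prod_in_J:
  assumes "\<And>k. s \<le> k \<Longrightarrow> k < n \<Longrightarrow> r \<le> j \<Longrightarrow> Y k j \<in> J" and j: "j < s"
  shows "tail_prod A Y i j \<in> J"
proof -
  have "(if s \<le> k then A i k * twist Y k j else 0) \<in> pow (Suc 0)" for k
  proof (cases "s \<le> k")
    case True
    have "twist Y k j \<in> pow (Suc 0)"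
    proof (cases "r \<le> j \<and> k < n")
      case True
      then show ?thesis using twist_level[of j k Y] assms(1)[of k] \<open>s \<le> k\<close> j pow_1 by simp
    next
      case False
      then show ?thesis using twist_mem[of Y k j 0] True j by simp
    qed
    then show ?thesis using True by (auto simp del: ideal_power.simps intro: ideal_power_lmult)
  qed (simp del: ideal_power.simps)
  then have "tail_prod A Y i j \<in> pow (Suc 0)" by (rule adic_sums_mem[OF tail_prod_sums])
  then show ?thesis using pow_1 by blast
qed

text \<open>First order expansion of a quadratic map, with the derivative taken at a fixed base
  point \<open>Y0\<close>. Replacing \<open>Y\<close> by \<open>Y0\<close> costs a factor from
  \<open>J\<close>. The terms \<open>D i q * tail_prod A (Y + D) q j\<close>, linear and quadratic
  at once, gain a power because \<open>Y0\<close> lies in \<open>J\<close> on the level, which puts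
  the tail products into \<open>J\<close>.\<close>

lemma residual_add:
  assumes Y: "\<And>k j. s \<le> k \<Longrightarrow> j < s \<Longrightarrow> Y k j - Y0 k j \<in> J"
    and Y0: "\<And>k j. s \<le> k \<Longrightarrow> k < n \<Longrightarrow> r \<le> j \<Longrightarrow> j < s \<Longrightarrow> Y0 k j \<in> J"
    and D: "\<And>k j. s \<le> k \<Longrightarrow> j < s \<Longrightarrow> D k j \<in> pow m" and m: "0 < m"
    and i: "s \<le> i" and j: "j < s"
  shows "residual A (\<lambda>k j. Y k j + D k j) i j -
      (residual A Y i j + (\<Sum>q<s. D i q * A q j) -
        (if r \<le> j then \<Sum>k=s..<n. (A i k + (\<Sum>q<s. Y0 i q * A q k)) * D k j else 0)) \<in> pow (Suc m)"
proof -
  let ?Z = "\<lambda>k j. Y k j + D k j"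
  define f where "f i = (if r \<le> j then \<Sum>k=s..<n. A i k * D k j else 0)" for i
  have DJ: "D k q \<in> J" if "s \<le> k" "q < s" for k q
    using pow_mono[OF D[OF that], of "Suc 0"] m pow_1 by simp
  have ZJ: "?Z k q \<in> J" if "s \<le> k" "k < n" "r \<le> q" "q < s" for k q
    using J_add[OF J_add[OF Y Y0] DJ, of k q k q k q] that by simp
  have f: "tail_prod A D u j - f u \<in> pow (Suc m)" for u
    unfolding f_def using tail_prod_approx D j by blast
  have T: "tail_prod A D u j \<in> pow m" for u
    using tail_prod_mem D j by blast
  have fT: "(if r \<le> j then \<Sum>k=s..<n. (A i k + (\<Sum>q<s. Y0 i q * A q k)) * D k j else 0) =
     f i + (\<Sum>q<s. Y0 i q * f q)"
  proof (cases "r \<le> j")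
    case True
    have "(\<Sum>k=s..<n. (\<Sum>q<s. Y0 i q * A q k) * D k j) = (\<Sum>q<s. Y0 i q * (\<Sum>k=s..<n. A q k * D k j))"
      unfolding sum_distrib_left sum_distrib_right by (subst sum.swap) (simp add: mult.assoc)
    then show ?thesis using True by (simp add: f_def distrib_right sum.distrib)
  qed (simp add: f_def)
  have exact: "residual A ?Z i j - (residual A Y i j + (\<Sum>q<s. D i q * A q j) - (f i + (\<Sum>q<s. Y0 i q * f q)))
     = - (tail_prod A D i j - f i)
       + (- (\<Sum>q<s. D i q * tail_prod A ?Z q j)
       + (- (\<Sum>q<s. Y0 i q * (tail_prod A D q j - f q))
       + - (\<Sum>q<s. (Y i q - Y0 i q) * tail_prod A D q j)))"
    unfolding residual_def corner_def tail_prod_add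
    by (simp add: algebra_simps sum.distrib sum_subtractf)
  show ?thesis
    unfolding fT exact
  proof (rule ideal_power_add[OF ideal_power_uminus[OF f]],
      intro ideal_power_add ideal_power_uminus ideal_power_sum)
    fix q assume "q \<in> {..<s}"
    then have q: "q < s" by simp
    show "D i q * tail_prod A ?Z q j \<in> pow (Suc m)"
      by (rule pow_Suc_rmult[OF D[OF i q]], rule tail_prod_in_J) (use ZJ j in auto)
    show "Y0 i q * (tail_prod A D q j - f q) \<in> pow (Suc m)"
      by (rule ideal_power_lmult[OF f])
    show "(Y i q - Y0 i q) * tail_prod A D q j \<in> pow (Suc m)"
      by (rule pow_Suc_lmult[OF Y[OF i q] T])
  qed
qed

end

text \<open>\<open>c\<close> inverts the leading block of \<open>A\<close> modulo \<open>J\<close>,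
  and \<open>small\<close> makes the first approximation vanish modulo \<open>J\<close> on the
  level. The alternatives in \<open>triangular\<close> belong to the two kinds of root: the root
  infinity makes the level columns of \<open>c\<close> strictly triangular, the root 0 does this for
  the level part of the Schur complement.\<close>

locale adic_split = adic_level J t l \<rho> r s n a
  for J :: "'r::ring_1 set" and t l and \<rho> :: "'r \<Rightarrow> 'k::field" and r s n a +
  fixes A c :: "'r inf_mat"
  assumes inverse: "\<And>i j. i < s \<Longrightarrow> j < s \<Longrightarrow> (\<Sum>q<s. c i q * A q j) - (if i = j then 1 else 0) \<in> J"
    and small: "\<And>k j. s \<le> k \<Longrightarrow> k < n \<Longrightarrow> r \<le> j \<Longrightarrow> j < s \<Longrightarrow> (\<Sum>q<s. A k q * c q j) \<in> J"
    and triangular: "(\<forall>j q. r \<le> j \<longrightarrow> j \<le> q \<longrightarrow> q < s \<longrightarrow> c q j \<in> J) \<or>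
      (\<forall>i k. s \<le> k \<longrightarrow> k \<le> i \<longrightarrow> i < n \<longrightarrow>
        A i k - (\<Sum>q<s. (\<Sum>u<s. A i u * c u q) * A q k) \<in> J)"
begin

definition start :: "'r inf_mat" where
  "start i j = - (\<Sum>q<s. A i q * c q j)"

text \<open>The Schur complement of the leading block of \<open>A\<close>, with \<open>c\<close> in
  place of the inverse of that block.\<close>

definition coupling :: "'r inf_mat" where
  "coupling i k = A i k + (\<Sum>q<s. start i q * A q k)"

text \<open>The derivative of the residual at \<open>start\<close> is, modulo \<open>J\<close>, the identity minus this operator,
  up to multiplication on the right by the invertible matrix \<open>c\<close>.\<close>

definition transfer :: "'r inf_mat \<Rightarrow> 'r inf_mat" where
  "transfer D i j = (if r \<le> j then \<Sum>k=s..<n. coupling i k * (\<Sum>q<s. D k q * c q j) else 0)"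

lemma transfer_sum: "transfer (\<lambda>i j. \<Sum>p\<in>P. f p i j) i j = (\<Sum>p\<in>P. transfer (f p) i j)"
proof (cases "r \<le> j")
  case True
  have "(\<Sum>k=s..<n. coupling i k * (\<Sum>q<s. (\<Sum>p\<in>P. f p k q) * c q j))
      = (\<Sum>k=s..<n. \<Sum>p\<in>P. coupling i k * (\<Sum>q<s. f p k q * c q j))"
    unfolding sum_distrib_right by (subst sum.swap) (simp add: sum_distrib_left)
  also have "\<dots> = (\<Sum>p\<in>P. \<Sum>k=s..<n. coupling i k * (\<Sum>q<s. f p k q * c q j))"
    by (rule sum.swap)
  finally show ?thesis using True by (simp add: transfer_def)
qed (simp add: transfer_def)

lemma transfer_memI:
  assumes "\<And>k. r \<le> j \<Longrightarrow> s \<le> k \<Longrightarrow> k < n \<Longrightarrow> coupling i k * (\<Sum>q<s. D k q * c q j) \<in> pow m"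
  shows "transfer D i j \<in> pow m"
proof -
  have "r \<le> j \<longrightarrow> (\<Sum>k=s..<n. coupling i k * (\<Sum>q<s. D k q * c q j)) \<in> pow m"
    by (intro impI ideal_power_sum) (use assms in auto)
  then show ?thesis by (simp add: transfer_def)
qed

lemma transfer_mem:
  assumes "\<And>k q. s \<le> k \<Longrightarrow> q < s \<Longrightarrow> D k q \<in> pow m"
  shows "transfer D i j \<in> pow m"
proof -
  have "(\<Sum>q<s. D k q * c q j) \<in> pow m" if "s \<le> k" for k
    by (intro ideal_power_sum ideal_power_rmult assms that) simp
  then show ?thesis by (intro transfer_memI ideal_power_lmult)
qed

lemma transfer_power_mem:
  assumes "\<And>k q. s \<le> k \<Longrightarrow> q < s \<Longrightarrow> D k q \<in> pow m" "s \<le> i" "j < s"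
  shows "(transfer ^^ p) D i j \<in> pow m"
  using assms(2,3)
proof (induction p arbitrary: i j)
  case (Suc p)
  then show ?case by (auto intro: transfer_mem)
qed (use assms in auto)

text \<open>Strict triangularity, on one side or the other. In the first case column
  \<open>j\<close> of the image depends, modulo the next power, only on columns
  \<open>q < j\<close>, and columns before \<open>r\<close> vanish at once. In the second, row
  \<open>i < n\<close> depends only on level rows \<open>k > i\<close>.\<close>

lemma transfer_nilpotent:
  obtains K where "\<And>m D i j. (\<And>k q. s \<le> k \<Longrightarrow> q < s \<Longrightarrow> D k q \<in> pow m) \<Longrightarrow>
    s \<le> i \<Longrightarrow> j < s \<Longrightarrow> (transfer ^^ K) D i j \<in> pow (Suc m)"
  using triangular
proof
  assume c: "\<forall>j q. r \<le> j \<longrightarrow> j \<le> q \<longrightarrow> q < s \<longrightarrow> c q j \<in> J"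
  have *: "j < r + p \<longrightarrow> (transfer ^^ Suc p) D i j \<in> pow (Suc m)"
    if D: "\<And>k q. s \<le> k \<Longrightarrow> q < s \<Longrightarrow> D k q \<in> pow m" and "s \<le> i" "j < s" for m D i j p
    using that(2,3)
  proof (induction p arbitrary: i j)
    case 0
    then show ?case by (simp add: transfer_def del: ideal_power.simps)
  next
    case (Suc p)
    have "(transfer ^^ Suc p) D k q * c q j \<in> pow (Suc m)"
      if "s \<le> k" "q < s" "r \<le> j" "j < r + Suc p" for k q
    proof (cases "j \<le> q")
      case True
      then have "c q j \<in> J" using c that by blast
      moreover have "(transfer ^^ Suc p) D k q \<in> pow m"
        by (rule transfer_power_mem) (use D that in auto)
      ultimately show ?thesis by (intro pow_Suc_rmult)
    next
      case False
      then show ?thesis using Suc.IH[OF that(1,2)] that by (intro ideal_power_rmult) simp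
    qed
    then have "(\<Sum>q<s. (transfer ^^ Suc p) D k q * c q j) \<in> pow (Suc m)"
      if "s \<le> k" "r \<le> j" "j < r + Suc p" for k
      using that by (intro ideal_power_sum) auto
    then have "transfer ((transfer ^^ Suc p) D) i j \<in> pow (Suc m)" if "j < r + Suc p"
      using that by (intro transfer_memI ideal_power_lmult)
    then show ?case by (simp del: ideal_power.simps)
  qed
  show thesis by (rule that[of "Suc s"]) (use * in force)
next
  assume A: "\<forall>i k. s \<le> k \<longrightarrow> k \<le> i \<longrightarrow> i < n \<longrightarrow>
        A i k - (\<Sum>q<s. (\<Sum>u<s. A i u * c u q) * A q k) \<in> J"
  have cpl: "coupling i k \<in> J" if "s \<le> k" "k \<le> i" "i < n" for i k
    using A that unfolding coupling_def start_def by (simp add: sum_negf)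
  have *: "n \<le> i + p \<longrightarrow> i < n \<longrightarrow> (transfer ^^ p) D i j \<in> pow (Suc m)"
    if D: "\<And>k q. s \<le> k \<Longrightarrow> q < s \<Longrightarrow> D k q \<in> pow m" and "s \<le> i" "j < s" for m D i j p
    using that(2,3)
  proof (induction p arbitrary: i j)
    case (Suc p)
    have "coupling i k * ((transfer ^^ p) D k q * c q j) \<in> pow (Suc m)"
      if "s \<le> k" "k < n" "q < s" "n \<le> i + Suc p" "i < n" for k q
    proof (cases "k \<le> i")
      case True
      then have "coupling i k \<in> J" using cpl that by blast
      moreover have "(transfer ^^ p) D k q \<in> pow m"
        by (rule transfer_power_mem) (use D that in auto)
      ultimately show ?thesis by (intro pow_Suc_lmult ideal_power_rmult)
    next
      case False
      then show ?thesis using Suc.IH[OF \<open>s \<le> k\<close> \<open>q < s\<close>] that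
        by (intro ideal_power_lmult ideal_power_rmult) simp
    qed
    then have "coupling i k * (\<Sum>q<s. (transfer ^^ p) D k q * c q j) \<in> pow (Suc m)"
      if "s \<le> k" "k < n" "n \<le> i + Suc p" "i < n" for k
      unfolding sum_distrib_left using that by (intro ideal_power_sum) auto
    then have "transfer ((transfer ^^ p) D) i j \<in> pow (Suc m)" if "n \<le> i + Suc p" "i < n"
      using that by (intro transfer_memI)
    then show ?case by (simp del: ideal_power.simps)
  qed simp
  \<comment> \<open>After \<open>n\<close> applications all level rows have gained a power. One more
    covers the rows \<open>i \<ge> n\<close>, since \<open>transfer\<close> reads only the level
    rows of its argument.\<close>
  have "(transfer ^^ Suc n) D i j \<in> pow (Suc m)"
    if D: "\<And>k q. s \<le> k \<Longrightarrow> q < s \<Longrightarrow> D k q \<in> pow m" and "s \<le> i" "j < s" for m D i j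
  proof -
    have "(transfer ^^ n) D k q \<in> pow (Suc m)" if "s \<le> k" "k < n" "q < s" for k q
      using *[of D m k q n] D that by simp
    then have "(\<Sum>q<s. (transfer ^^ n) D k q * c q j) \<in> pow (Suc m)" if "s \<le> k" "k < n" for k
      using that by (intro ideal_power_sum ideal_power_rmult) auto
    then have "transfer ((transfer ^^ n) D) i j \<in> pow (Suc m)"
      by (intro transfer_memI ideal_power_lmult)
    then show ?thesis by (simp del: ideal_power.simps)
  qed
  then show thesis by (rule that)
qed

lemma start_in_J: "s \<le> k \<Longrightarrow> k < n \<Longrightarrow> r \<le> j \<Longrightarrow> j < s \<Longrightarrow> start k j \<in> J"
  using small[of k j] J_lmult[of _ "- 1"] by (simp add: start_def)

lemma mult_inverse_approx:
  assumes "\<And>q. q < s \<Longrightarrow> x q \<in> pow m" "j < s"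
  shows "(\<Sum>q<s. (\<Sum>u<s. x u * c u q) * A q j) - x j \<in> pow (Suc m)"
proof -
  have "(\<Sum>q<s. (\<Sum>u<s. x u * c u q) * A q j) = (\<Sum>u<s. x u * (\<Sum>q<s. c u q * A q j))"
    unfolding sum_distrib_left sum_distrib_right by (subst sum.swap) (simp add: mult.assoc)
  moreover have "x j = (\<Sum>u<s. x u * (if u = j then 1 else 0))"
    using assms(2) by (simp add: if_distrib[of "\<lambda>y. _ * y"] cong: if_cong)
  ultimately have "(\<Sum>q<s. (\<Sum>u<s. x u * c u q) * A q j) - x j =
    (\<Sum>u<s. x u * ((\<Sum>q<s. c u q * A q j) - (if u = j then 1 else 0)))"
    by (simp only: right_diff_distrib sum_subtractf)
  also have "\<dots> \<in> pow (Suc m)"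
    by (intro ideal_power_sum pow_Suc_rmult assms inverse) auto
  finally show ?thesis .
qed

text \<open>\<open>start\<close> cancels the part \<open>A i j + (\<Sum>q<s. Y i q * A q j)\<close>
  modulo \<open>J\<close>; what remains are tail products of \<open>start\<close>, which is small on
  the level.\<close>

lemma residual_start:
  assumes "s \<le> i" "j < s"
  shows "residual A start i j \<in> J"
proof -
  have T: "tail_prod A start u j \<in> J" for u
    by (rule tail_prod_in_J) (use start_in_J assms in auto)
  have "(\<Sum>q<s. (\<Sum>u<s. A i u * c u q) * A q j) - A i j \<in> pow (Suc 0)"
    by (rule mult_inverse_approx) (use assms in auto)
  then have "- ((\<Sum>q<s. (\<Sum>u<s. A i u * c u q) * A q j) - A i j) +
    - (tail_prod A start i j + (\<Sum>q<s. start i q * tail_prod A start q j)) \<in> pow (Suc 0)"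
    using J_add[OF T J_sum[OF J_lmult[OF T]]]
    by (intro ideal_power_add[OF ideal_power_uminus ideal_power_uminus]) (simp_all only: pow_1)
  moreover have "- ((\<Sum>q<s. (\<Sum>u<s. A i u * c u q) * A q j) - A i j) +
    - (tail_prod A start i j + (\<Sum>q<s. start i q * tail_prod A start q j)) = residual A start i j"
    unfolding residual_def corner_def
    by (simp add: start_def algebra_simps sum_subtractf sum_negf)
  ultimately show ?thesis by (simp only: pow_1)
qed

text \<open>Minus the inverse derivative applied to \<open>E\<close>: a truncated Neumann series for
  the identity minus \<open>transfer\<close>, followed by \<open>c\<close> to undo the
  multiplication by the leading block.\<close>

definition correction :: "nat \<Rightarrow> 'r inf_mat \<Rightarrow> 'r inf_mat" where
  "correction K E i q = - (\<Sum>u<s. (\<Sum>p<K. (transfer ^^ p) E i u) * c u q)"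

lemma correction_mem:
  assumes "\<And>k q. s \<le> k \<Longrightarrow> q < s \<Longrightarrow> E k q \<in> pow m" "s \<le> i"
  shows "correction K E i j \<in> pow m"
  unfolding correction_def
  by (auto intro!: ideal_power_uminus ideal_power_sum ideal_power_rmult transfer_power_mem assms)

text \<open>The derivative stays frozen at \<open>start\<close>, so a step gains one power of
  \<open>J\<close> and no more. With \<open>D = - G c\<close> the linearized error telescopes to
  \<open>(transfer ^^ K) E\<close>, up to terms one power deeper.\<close>

lemma newton_step:
  assumes K: "\<And>m D i j. (\<And>k q. s \<le> k \<Longrightarrow> q < s \<Longrightarrow> D k q \<in> pow m) \<Longrightarrow>
      s \<le> i \<Longrightarrow> j < s \<Longrightarrow> (transfer ^^ K) D i j \<in> pow (Suc m)"
    and Y: "\<And>k j. s \<le> k \<Longrightarrow> j < s \<Longrightarrow> Y k j - start k j \<in> J"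
    and R: "\<And>k j. s \<le> k \<Longrightarrow> j < s \<Longrightarrow> residual A Y k j \<in> pow m" and m: "0 < m"
    and i: "s \<le> i" and j: "j < s"
  shows "residual A (\<lambda>k j. Y k j + correction K (residual A Y) k j) i j \<in> pow (Suc m)"
proof -
  define E where "E = residual A Y"
  define D where "D = correction K E"
  define G where "G i j = (\<Sum>p<K. (transfer ^^ p) E i j)" for i j
  have E: "E k q \<in> pow m" if "s \<le> k" "q < s" for k q using R[OF that] by (simp add: E_def)
  have D: "D k q \<in> pow m" if "s \<le> k" "q < s" for k q
    unfolding D_def using E that(1) by (rule correction_mem)
  have G: "G i q \<in> pow m" if "q < s" for q
    unfolding G_def by (intro ideal_power_sum transfer_power_mem E i that)
  have DG: "D k q = - (\<Sum>u<s. G k u * c u q)" for k q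
    by (simp add: D_def correction_def G_def)
  have "(if r \<le> j then \<Sum>k=s..<n. (A i k + (\<Sum>q<s. start i q * A q k)) * D k j else 0)
      = - transfer G i j"
    by (simp add: DG transfer_def coupling_def sum_negf)
  moreover have "transfer G i j = (\<Sum>p<K. (transfer ^^ Suc p) E i j)"
    unfolding G_def transfer_sum by simp
  moreover have "E i j - G i j + (\<Sum>p<K. (transfer ^^ Suc p) E i j) = (transfer ^^ K) E i j"
    unfolding G_def using sum_lessThan_telescope[of "\<lambda>p. (transfer ^^ p) E i j" K]
    by (simp add: sum_subtractf algebra_simps)
  ultimately have *: "E i j + (\<Sum>q<s. D i q * A q j) -
      (if r \<le> j then \<Sum>k=s..<n. (A i k + (\<Sum>q<s. start i q * A q k)) * D k j else 0)
     = (transfer ^^ K) E i j + - ((\<Sum>q<s. (\<Sum>u<s. G i u * c u q) * A q j) - G i j)"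
    by (simp add: DG sum_negf algebra_simps)
  have "\<dots> \<in> pow (Suc m)"
    by (intro ideal_power_add ideal_power_uminus K[OF E] mult_inverse_approx G i j) auto
  then have "residual A Y i j + (\<Sum>q<s. D i q * A q j) -
      (if r \<le> j then \<Sum>k=s..<n. (A i k + (\<Sum>q<s. start i q * A q k)) * D k j else 0) \<in> pow (Suc m)"
    using * by (simp only: E_def)
  moreover have "residual A (\<lambda>k j. Y k j + D k j) i j - (residual A Y i j + (\<Sum>q<s. D i q * A q j) -
      (if r \<le> j then \<Sum>k=s..<n. (A i k + (\<Sum>q<s. start i q * A q k)) * D k j else 0)) \<in> pow (Suc m)"
    by (rule residual_add[OF Y start_in_J D m i j])
  ultimately have "residual A (\<lambda>k j. Y k j + D k j) i j \<in> pow (Suc m)"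
    using ideal_power_add by fastforce
  then show ?thesis by (simp only: D_def E_def)
qed

lemma residual_solution:
  obtains Y where "\<And>i j. s \<le> i \<Longrightarrow> j < s \<Longrightarrow> residual A Y i j = 0"
proof -
  obtain K where K: "\<And>m D i j. (\<And>k q. s \<le> k \<Longrightarrow> q < s \<Longrightarrow> D k q \<in> pow m) \<Longrightarrow>
    s \<le> i \<Longrightarrow> j < s \<Longrightarrow> (transfer ^^ K) D i j \<in> pow (Suc m)"
    using transfer_nilpotent by blast
  define Y where "Y = rec_nat start (\<lambda>_ Y k j. Y k j + correction K (residual A Y) k j)"
  have Y0: "Y 0 = start"
    and YSuc: "Y (Suc m) = (\<lambda>k j. Y m k j + correction K (residual A (Y m)) k j)" for m
    by (simp_all add: Y_def)
  have inv: "(\<forall>k j. s \<le> k \<longrightarrow> j < s \<longrightarrow> Y m k j - start k j \<in> J) \<and>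
    (\<forall>k j. s \<le> k \<longrightarrow> j < s \<longrightarrow> residual A (Y m) k j \<in> pow (Suc m))" for m
  proof (induction m)
    case 0
    show ?case using residual_start by (auto simp: Y0 pow_1 simp del: ideal_power.simps)
  next
    case (Suc m)
    have "residual A (Y (Suc m)) k j \<in> pow (Suc (Suc m))" if "s \<le> k" "j < s" for k j
      unfolding YSuc by (rule newton_step[OF K]) (use Suc.IH that in auto)
    moreover have "Y (Suc m) k j - start k j \<in> J" if "s \<le> k" "j < s" for k j
    proof -
      have "correction K (residual A (Y m)) k j \<in> pow (Suc m)"
        by (rule correction_mem) (use Suc.IH that in auto)
      then have "correction K (residual A (Y m)) k j \<in> J"
        using pow_mono[of _ "Suc m" "Suc 0"] pow_1 by blast
      then show ?thesis using J_add[of "Y m k j - start k j"] Suc.IH that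
        by (simp add: YSuc add_diff_eq diff_add_eq del: ideal_power.simps)
    qed
    ultimately show ?case by blast
  qed
  have step: "Y (Suc m) k j - Y m k j \<in> pow (Suc m)" if "s \<le> k" for m k j
    using correction_mem[of "residual A (Y m)" "Suc m" k K j] inv[of m] that
    by (simp add: YSuc del: ideal_power.simps)
  have "\<exists>y. s \<le> k \<longrightarrow> (\<forall>m. Y m k j - y \<in> pow m)" for k j
  proof (cases "s \<le> k")
    case True
    then obtain y where "\<And>m. Y m k j - y \<in> pow m"
      using adic_complete_Cauchy[OF complete_J, of "\<lambda>m. Y m k j"]
        pow_mono[OF step le_SucI[OF order_refl]] by blast
    then show ?thesis by blast
  qed blast
  then obtain Z where Z: "\<And>k j m. s \<le> k \<Longrightarrow> Y m k j - Z k j \<in> pow m" by metis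
  have "residual A Z i j = 0" if i: "s \<le> i" and j: "j < s" for i j
  proof (rule adic_complete_separated[OF complete_J])
    fix m
    \<comment> \<open>The limit is compared with a late iterate through the same expansion;
      \<open>Suc m\<close> keeps the exponent positive, as \<open>residual_add\<close>
      demands.\<close>
    define D where "D k j = Z k j - Y (Suc m) k j" for k j
    have D: "D k j \<in> pow (Suc m)" if "s \<le> k" for k j
      using ideal_power_uminus[OF Z[OF that, of "Suc m" j]] by (simp add: D_def del: ideal_power.simps)
    let ?X = "residual A (Y (Suc m)) i j + (\<Sum>q<s. D i q * A q j) -
        (if r \<le> j then \<Sum>k=s..<n. (A i k + (\<Sum>q<s. start i q * A q k)) * D k j else 0)"
    have "residual A (\<lambda>k j. Y (Suc m) k j + D k j) i j - ?X \<in> pow (Suc (Suc m))"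
      by (rule residual_add) (use inv start_in_J D i j in auto)
    then have "residual A Z i j - ?X \<in> pow (Suc (Suc m))" by (simp add: D_def del: ideal_power.simps)
    then have "residual A Z i j - ?X \<in> pow m" by (rule pow_mono) simp
    moreover have "?X \<in> pow (Suc m)"
      using inv[of "Suc m"] i j pow_mono[of _ "Suc (Suc m)" "Suc m"]
      by (intro ideal_power_diff ideal_power_add ideal_power_sum ideal_power_rmult D)
        (auto simp del: ideal_power.simps intro!: ideal_power_sum ideal_power_lmult D)
    then have "?X \<in> pow m" by (rule pow_mono) simp
    ultimately show "residual A Z i j - 0 \<in> pow m" using ideal_power_add by fastforce
  qed
  then show thesis by (rule that)
qed

end

section \<open>From a solution to a block triangular conjugate\<close>

context adic_split
begin

definition row_op :: "'r inf_mat \<Rightarrow> 'r inf_mat \<Rightarrow> 'r inf_mat" where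
  "row_op Z B i j = B i j + (\<Sum>q<s. Z i q * B q j)"

lemma inf_mat_prod_row_op:
  assumes "\<And>i j. s \<le> j \<Longrightarrow> Z i j = 0"
  shows "inf_mat_prod J (\<lambda>i j. inf_mat_one i j + Z i j) B (row_op Z B)"
  unfolding inf_mat_prod_def
proof (intro allI)
  fix i j
  have "(\<Sum>k<max (Suc i) s. (inf_mat_one i k + Z i k) * B k j)
      = (\<Sum>k<max (Suc i) s. if i = k then B k j else 0) + (\<Sum>k<max (Suc i) s. Z i k * B k j)"
    by (simp add: distrib_right sum.distrib inf_mat_one_def if_distrib[of "\<lambda>x. x * _"] cong: if_cong)
  also have "(\<Sum>k<max (Suc i) s. Z i k * B k j) = (\<Sum>k<s. Z i k * B k j)"
    by (rule sum.mono_neutral_right) (auto simp: assms)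
  also have "(\<Sum>k<max (Suc i) s. if i = k then B k j else 0) = B i j"
    by (simp add: less_max_iff_disj)
  finally have "(\<Sum>k<max (Suc i) s. (inf_mat_one i k + Z i k) * B k j) = row_op Z B i j"
    by (simp add: row_op_def)
  moreover have "adic_sums J (\<lambda>k. (inf_mat_one i k + Z i k) * B k j)
      (\<Sum>k<max (Suc i) s. (inf_mat_one i k + Z i k) * B k j)"
    by (rule adic_sums_finite) (simp add: assms inf_mat_one_def)
  ultimately show "adic_sums J (\<lambda>k. (inf_mat_one i k + Z i k) * B k j) (row_op Z B i j)"
    by simp
qed

lemma row_op_unipotent:
  assumes "\<And>i j. \<not> (s \<le> i \<and> j < s) \<Longrightarrow> Z i j = 0"
  shows "row_op Z (\<lambda>i j. inf_mat_one i j + - Z i j) = inf_mat_one"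
proof (intro ext)
  fix i j
  have "(\<Sum>q<s. Z i q * (inf_mat_one q j + - Z q j)) = (\<Sum>q<s. if q = j then Z i q else 0)"
    by (rule sum.cong) (auto simp: assms inf_mat_one_def)
  also have "\<dots> = Z i j" using assms[of i j] by auto
  finally show "row_op Z (\<lambda>i j. inf_mat_one i j + - Z i j) i j = inf_mat_one i j"
    by (simp add: row_op_def)
qed

definition col_op :: "'r inf_mat \<Rightarrow> 'r inf_mat \<Rightarrow> 'r inf_mat" where
  "col_op Y B i j = (if j < s then corner B Y i j else B i j)"

lemma inf_mat_prod_col_op:
  "inf_mat_prod J B (\<lambda>i j. inf_mat_one i j + - (if s \<le> i \<and> j < s then twist Y i j else 0)) (col_op Y B)"
  unfolding inf_mat_prod_def
proof (intro allI)
  fix i j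
  have "adic_sums J (\<lambda>k. B i k * inf_mat_one k j) (\<Sum>k<Suc j. B i k * inf_mat_one k j)"
    by (rule adic_sums_finite) (simp add: inf_mat_one_def)
  moreover have "(\<Sum>k<Suc j. B i k * inf_mat_one k j) = (\<Sum>k<Suc j. if k = j then B i k else 0)"
    by (intro sum.cong) (auto simp: inf_mat_one_def)
  ultimately have one: "adic_sums J (\<lambda>k. B i k * inf_mat_one k j) (B i j)" by simp
  show "adic_sums J (\<lambda>k. B i k * (inf_mat_one k j + - (if s \<le> k \<and> j < s then twist Y k j else 0)))
    (col_op Y B i j)"
  proof (cases "j < s")
    case True
    have "(\<lambda>k. B i k * (inf_mat_one k j + - (if s \<le> k \<and> j < s then twist Y k j else 0)))
      = (\<lambda>k. B i k * inf_mat_one k j - (if s \<le> k then B i k * twist Y k j else 0))"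
      using True by (auto simp: algebra_simps)
    then show ?thesis
      using adic_sums_diff[OF one tail_prod_sums[of B i Y j]] True by (simp add: col_op_def corner_def)
  next
    case False
    then show ?thesis using one by (simp add: col_op_def)
  qed
qed

text \<open>This is \<open>(Q M) Q' = Q (M Q')\<close>, which is not automatic for infinite
  matrices. The row operation is a finite sum and therefore passes through the convergent
  series.\<close>

lemma col_op_row_op: "col_op Y (row_op Z B) = row_op Z (col_op Y B)"
proof (intro ext)
  fix i j
  have "tail_prod (row_op Z B) Y i j = tail_prod B Y i j + (\<Sum>q<s. Z i q * tail_prod B Y q j)"
  proof (rule tail_prod_eqI)
    have "(\<lambda>k. if s \<le> k then row_op Z B i k * twist Y k j else 0)
      = (\<lambda>k. (if s \<le> k then B i k * twist Y k j else 0) +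
          (\<Sum>q<s. Z i q * (if s \<le> k then B q k * twist Y k j else 0)))"
      by (auto simp: row_op_def distrib_right sum_distrib_right mult.assoc)
    moreover have "adic_sums J (\<lambda>k. (if s \<le> k then B i k * twist Y k j else 0) +
          (\<Sum>q<s. Z i q * (if s \<le> k then B q k * twist Y k j else 0)))
        (tail_prod B Y i j + (\<Sum>q<s. Z i q * tail_prod B Y q j))"
      by (intro adic_sums_add adic_sums_sum adic_sums_lmult tail_prod_sums)
    ultimately show "adic_sums J (\<lambda>k. if s \<le> k then row_op Z B i k * twist Y k j else 0)
        (tail_prod B Y i j + (\<Sum>q<s. Z i q * tail_prod B Y q j))" by simp
  qed
  then show "col_op Y (row_op Z B) i j = row_op Z (col_op Y B) i j"
    by (simp add: col_op_def row_op_def corner_def right_diff_distrib sum_subtractf algebra_simps)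
qed

lemma col_op_hodge_mat: "col_op Y (hodge_mat B) = hodge_mat (col_op Y B)"
proof (intro ext)
  fix i j
  have "tail_prod (hodge_mat B) Y i j = t ^ l i * tail_prod B Y i j"
  proof (rule tail_prod_eqI)
    have "(\<lambda>k. if s \<le> k then hodge_mat B i k * twist Y k j else 0)
      = (\<lambda>k. t ^ l i * (if s \<le> k then B i k * twist Y k j else 0))"
      by (auto simp: hodge_mat_def mult.assoc)
    then show "adic_sums J (\<lambda>k. if s \<le> k then hodge_mat B i k * twist Y k j else 0)
        (t ^ l i * tail_prod B Y i j)"
      by (simp add: adic_sums_lmult tail_prod_sums)
  qed
  then show "col_op Y (hodge_mat B) i j = hodge_mat (col_op Y B) i j"
    by (simp add: col_op_def corner_def hodge_mat_def right_diff_distrib)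
qed

text \<open>The identity \<open>(1 + X) D = D (1 + X')\<close>, with \<open>X'\<close> the untwisted
  block, is what makes \<open>Q\<close> stable. Centrality of \<open>t\<close> moves its powers past
  \<open>Y\<close>.\<close>

lemma row_op_hodge_mat:
  "row_op (\<lambda>i j. if s \<le> i \<and> j < s then twist Y i j else 0) (hodge_mat B)
    = hodge_mat (row_op (\<lambda>i j. if s \<le> i \<and> j < s then Y i j else 0) B)"
proof (intro ext)
  fix i j
  have "twist Y i q * (t ^ l q * B q j) = t ^ l i * (Y i q * B q j)" if "s \<le> i" "q < s" for q
  proof -
    have "t ^ (l i - l q) * Y i q * (t ^ l q * B q j) = t ^ (l i - l q) * (Y i q * t ^ l q) * B q j"
      by (simp add: mult.assoc)
    also have "\<dots> = t ^ (l i - l q) * t ^ l q * (Y i q * B q j)"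
      by (simp only: t_pow_central[of "l q" "Y i q", symmetric] mult.assoc)
    also have "t ^ (l i - l q) * t ^ l q = t ^ l i"
      using l_mono[of q i] that by (simp flip: power_add)
    finally show ?thesis by (simp add: twist_def)
  qed
  then have "(\<Sum>q<s. (if s \<le> i \<and> q < s then twist Y i q else 0) * (t ^ l q * B q j))
      = (\<Sum>q<s. t ^ l i * ((if s \<le> i \<and> q < s then Y i q else 0) * B q j))"
    by (intro sum.cong) auto
  then show "row_op (\<lambda>i j. if s \<le> i \<and> j < s then twist Y i j else 0) (hodge_mat B) i j
    = hodge_mat (row_op (\<lambda>i j. if s \<le> i \<and> j < s then Y i j else 0) B) i j"
    by (simp add: row_op_def hodge_mat_def sum_distrib_left distrib_left)
qed

lemma reducible_split: "reducible s A"
proof -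
  obtain Y where Y: "\<And>i j. s \<le> i \<Longrightarrow> j < s \<Longrightarrow> residual A Y i j = 0"
    using residual_solution by blast
  define X where "X i j = (if s \<le> i \<and> j < s then twist Y i j else 0)" for i j
  define X' where "X' i j = (if s \<le> i \<and> j < s then Y i j else 0)" for i j
  define Q where "Q i j = inf_mat_one i j + X i j" for i j
  define Q' where "Q' i j = inf_mat_one i j + - X i j" for i j
  let ?M = "hodge_mat A"
  define C where "C = row_op X (col_op Y ?M)"
  have X0: "X i j = 0" if "\<not> (s \<le> i \<and> j < s)" for i j using that by (auto simp: X_def)
  have Q: "inf_mat_prod J Q B (row_op X B)" for B
    unfolding Q_def by (rule inf_mat_prod_row_op) (simp add: X0)
  have Q': "inf_mat_prod J Q' B (row_op (\<lambda>i j. - X i j) B)" for B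
    unfolding Q'_def by (rule inf_mat_prod_row_op) (simp add: X0)
  have MQ': "inf_mat_prod J B Q' (col_op Y B)" for B
    unfolding Q'_def X_def by (rule inf_mat_prod_col_op)
  have hodge: "row_op X (hodge_mat B) = hodge_mat (row_op X' B)" for B
    unfolding X_def X'_def by (rule row_op_hodge_mat)
  have "inf_mat_inverse J Q Q'"
    using Q[of Q'] Q'[of Q] row_op_unipotent[of X] row_op_unipotent[of "\<lambda>i j. - X i j"] X0
    unfolding inf_mat_inverse_def Q_def Q'_def by simp
  moreover have "hodge_stable J t l Q"
    unfolding hodge_stable_def hodge_bounded_iff using Q hodge by metis
  moreover have "inf_mat_prod3 J Q ?M Q' C"
    unfolding inf_mat_prod3_def C_def
    using Q MQ'[of "row_op X ?M"] MQ'[of ?M] by (auto simp: col_op_row_op)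
  moreover have CW: "C = hodge_mat (row_op X' (col_op Y A))"
    by (simp add: C_def col_op_hodge_mat hodge)
  moreover have "C i j = 0" if "s \<le> i" "j < s" for i j
  proof -
    have "row_op X' (col_op Y A) i j = residual A Y i j"
      using that by (simp add: row_op_def col_op_def residual_def X'_def)
    then show ?thesis using Y[OF that] by (simp add: CW hodge_mat_def)
  qed
  ultimately show ?thesis unfolding reducible_def hodge_bounded_iff by blast
qed

end

section \<open>Conjugation by finite matrices\<close>

text \<open>The \<open>n\<close> by \<open>n\<close> matrix is extended by the identity. Written as
  a finite sum, it composes with infinite products without convergence conditions.\<close>

definition fin_left :: "nat \<Rightarrow> 'a::ring_1 inf_mat \<Rightarrow> 'a inf_mat \<Rightarrow> 'a inf_mat" where
  "fin_left n e A i j = (if i < n then \<Sum>k<n. e i k * A k j else A i j)"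

definition fin_right :: "nat \<Rightarrow> 'a::ring_1 inf_mat \<Rightarrow> 'a inf_mat \<Rightarrow> 'a inf_mat" where
  "fin_right n A e i j = (if j < n then \<Sum>k<n. A i k * e k j else A i j)"

definition fin_inverse :: "nat \<Rightarrow> 'a::ring_1 inf_mat \<Rightarrow> 'a inf_mat \<Rightarrow> bool" where
  "fin_inverse n e e' \<longleftrightarrow> (\<forall>i<n. \<forall>j<n. (\<Sum>k<n. e i k * e' k j) = inf_mat_one i j)"

lemma fin_left_right: "fin_left n e (fin_right n A e') = fin_right n (fin_left n e A) e'"
proof (intro ext)
  fix i j
  have "(\<Sum>k<n. e i k * (\<Sum>m<n. A k m * e' m j)) = (\<Sum>m<n. (\<Sum>k<n. e i k * A k m) * e' m j)"
    unfolding sum_distrib_left sum_distrib_right by (subst sum.swap) (simp add: mult.assoc)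
  then show "fin_left n e (fin_right n A e') i j = fin_right n (fin_left n e A) e' i j"
    by (simp add: fin_left_def fin_right_def)
qed

lemma fin_left_cancel:
  assumes "fin_inverse n e e'"
  shows "fin_left n e (fin_left n e' A) = A"
proof (intro ext)
  fix i j
  have "(\<Sum>k<n. e i k * (\<Sum>m<n. e' k m * A m j)) = A i j" if i: "i < n"
  proof -
    have "(\<Sum>k<n. e i k * (\<Sum>m<n. e' k m * A m j)) = (\<Sum>m<n. (\<Sum>k<n. e i k * e' k m) * A m j)"
      unfolding sum_distrib_left sum_distrib_right by (subst sum.swap) (simp add: mult.assoc)
    also have "\<dots> = (\<Sum>m<n. if i = m then A m j else 0)"
      using assms i by (intro sum.cong) (auto simp: fin_inverse_def inf_mat_one_def)
    finally show ?thesis using i by simp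
  qed
  then show "fin_left n e (fin_left n e' A) i j = A i j" by (simp add: fin_left_def)
qed

lemma fin_right_cancel:
  assumes "fin_inverse n e e'"
  shows "fin_right n (fin_right n A e) e' = A"
proof (intro ext)
  fix i j
  have "(\<Sum>k<n. (\<Sum>m<n. A i m * e m k) * e' k j) = A i j" if j: "j < n"
  proof -
    have "(\<Sum>k<n. (\<Sum>m<n. A i m * e m k) * e' k j) = (\<Sum>m<n. A i m * (\<Sum>k<n. e m k * e' k j))"
      unfolding sum_distrib_left sum_distrib_right by (subst sum.swap) (simp add: mult.assoc)
    also have "\<dots> = (\<Sum>m<n. if m = j then A i m else 0)"
      using assms j by (intro sum.cong) (auto simp: fin_inverse_def inf_mat_one_def)
    finally show ?thesis using j by simp
  qed
  then show "fin_right n (fin_right n A e) e' i j = A i j" by (simp add: fin_right_def)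
qed

lemma fin_right_one: "fin_right n inf_mat_one e = fin_left n e inf_mat_one"
proof (intro ext)
  fix i j
  have "(\<Sum>k<n. inf_mat_one i k * e k j) = (\<Sum>k<n. if i = k then e k j else 0)"
    "(\<Sum>k<n. e i k * inf_mat_one k j) = (\<Sum>k<n. if k = j then e i k else 0)"
    unfolding inf_mat_one_def by (intro sum.cong; simp)+
  then show "fin_right n inf_mat_one e i j = fin_left n e inf_mat_one i j"
    by (auto simp: fin_left_def fin_right_def inf_mat_one_def)
qed

lemma sum_fin_right:
  assumes "n \<le> K"
  shows "(\<Sum>k<K. fin_right n A e i k * B k j) = (\<Sum>k<K. A i k * fin_left n e B k j)"
proof -
  have split: "sum f {..<K} = sum f {..<n} + sum f {n..<K}" for f :: "nat \<Rightarrow> 'a"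
    using sum.atLeastLessThan_concat[of 0 n K f] assms by (simp add: atLeast0LessThan)
  have "(\<Sum>k<n. (\<Sum>m<n. A i m * e m k) * B k j) = (\<Sum>m<n. A i m * (\<Sum>k<n. e m k * B k j))"
    unfolding sum_distrib_left sum_distrib_right by (subst sum.swap) (simp add: mult.assoc)
  then show ?thesis unfolding split by (simp add: fin_left_def fin_right_def)
qed

text \<open>The two series have equal partial sums from \<open>n\<close> on, so either product
  exists exactly when the other does.\<close>

lemma inf_mat_prod_fin_right:
  "inf_mat_prod J (fin_right n A e) B P \<longleftrightarrow> inf_mat_prod J A (fin_left n e B) P"
  unfolding inf_mat_prod_def
  by (intro iff_allI adic_sums_cong_eventually eventually_mono[OF eventually_ge_at_top[of n]]
      sum_fin_right)

lemma inf_mat_prod_fin_left: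
  assumes "inf_mat_prod J A B P"
  shows "inf_mat_prod J (fin_left n e A) B (fin_left n e P)"
  unfolding inf_mat_prod_def
proof (intro allI)
  fix i j
  show "adic_sums J (\<lambda>k. fin_left n e A i k * B k j) (fin_left n e P i j)"
  proof (cases "i < n")
    case True
    have "adic_sums J (\<lambda>k. \<Sum>m<n. e i m * (A m k * B k j)) (\<Sum>m<n. e i m * P m j)"
      using assms by (intro adic_sums_sum adic_sums_lmult) (simp add: inf_mat_prod_def)
    then show ?thesis using True by (simp add: fin_left_def sum_distrib_right mult.assoc)
  next
    case False
    then show ?thesis using assms by (simp add: fin_left_def inf_mat_prod_def)
  qed
qed

lemma inf_mat_prod_fin_right_right:
  assumes "inf_mat_prod J A B P"
  shows "inf_mat_prod J A (fin_right n B e) (fin_right n P e)"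
  unfolding inf_mat_prod_def
proof (intro allI)
  fix i j
  show "adic_sums J (\<lambda>k. A i k * fin_right n B e k j) (fin_right n P e i j)"
  proof (cases "j < n")
    case True
    have "adic_sums J (\<lambda>k. \<Sum>m<n. (A i k * B k m) * e m j) (\<Sum>m<n. P i m * e m j)"
      using assms by (intro adic_sums_sum adic_sums_rmult) (simp add: inf_mat_prod_def)
    then show ?thesis using True by (simp add: fin_right_def sum_distrib_left mult.assoc)
  next
    case False
    then show ?thesis using assms by (simp add: fin_right_def inf_mat_prod_def)
  qed
qed

context adic_lift
begin

lemma fin_right_hodge_mat: "fin_right n (hodge_mat A) e = hodge_mat (fin_right n A e)"
  by (intro ext) (simp add: fin_right_def hodge_mat_def sum_distrib_left mult.assoc)

lemma fin_left_hodge_mat: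
  assumes "\<And>i k. i < n \<Longrightarrow> k < n \<Longrightarrow> e i k * t ^ l k = t ^ l i * G i k"
  shows "fin_left n e (hodge_mat A) = hodge_mat (fin_left n G A)"
proof (intro ext)
  fix i j
  have "e i k * (t ^ l k * A k j) = t ^ l i * (G i k * A k j)" if "i < n" "k < n" for k
    using assms[OF that] by (metis mult.assoc)
  then show "fin_left n e (hodge_mat A) i j = hodge_mat (fin_left n G A) i j"
    by (simp add: fin_left_def hodge_mat_def sum_distrib_left)
qed

text \<open>Since \<open>e D = D G\<close>, conjugating \<open>D A\<close> by \<open>e\<close> gives
  \<open>D (G A e')\<close>. The factor \<open>G\<close> has entries in the ring, so
  \<open>e\<close> also preserves Hodge boundedness and the composite \<open>Q1 e\<close> remains
  stable.\<close>

lemma reducible_conjugate: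
  assumes e: "fin_inverse n e e'" "fin_inverse n e' e"
    and G: "\<And>i k. i < n \<Longrightarrow> k < n \<Longrightarrow> e i k * t ^ l k = t ^ l i * G i k"
    and red: "reducible s (fin_right n (fin_left n G A) e')"
  shows "reducible s A"
proof -
  let ?M = "hodge_mat A"
  define M1 where "M1 = fin_right n (fin_left n e ?M) e'"
  have M1: "M1 = hodge_mat (fin_right n (fin_left n G A) e')"
    by (simp add: M1_def fin_left_hodge_mat[OF G] fin_right_hodge_mat)
  obtain Q1 Q1' C P1 P2 where inv: "inf_mat_prod J Q1 Q1' inf_mat_one" "inf_mat_prod J Q1' Q1 inf_mat_one"
    and stable: "hodge_stable J t l Q1"
    and P1: "inf_mat_prod J Q1 M1 P1" "inf_mat_prod J P1 Q1' C"
    and P2: "inf_mat_prod J M1 Q1' P2" "inf_mat_prod J Q1 P2 C"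
    and C: "hodge_bounded J t l C" "\<And>i j. s \<le> i \<Longrightarrow> j < s \<Longrightarrow> C i j = 0"
    using red unfolding reducible_def inf_mat_inverse_def inf_mat_prod3_def M1 by blast
  define Q where "Q = fin_right n Q1 e"
  define Q' where "Q' = fin_left n e' Q1'"
  have eM: "fin_left n e ?M = fin_right n M1 e" and Me': "fin_right n ?M e' = fin_left n e' M1"
    unfolding M1_def using e by (simp_all add: fin_right_cancel fin_left_cancel fin_left_right)
  have "inf_mat_prod J Q' Q (fin_right n (fin_left n e' inf_mat_one) e)"
    unfolding Q_def Q'_def
    by (intro inf_mat_prod_fin_right_right inf_mat_prod_fin_left inv)
  moreover have "fin_right n (fin_left n e' inf_mat_one) e = inf_mat_one"
    using e by (simp add: fin_left_cancel fin_right_one flip: fin_left_right)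
  moreover have "inf_mat_prod J Q Q' inf_mat_one"
    unfolding Q_def Q'_def inf_mat_prod_fin_right using inv e by (simp add: fin_left_cancel)
  ultimately have "inf_mat_inverse J Q Q'" by (simp add: inf_mat_inverse_def)
  moreover have "hodge_stable J t l Q"
    unfolding hodge_stable_def
  proof (intro allI impI)
    fix B assume "hodge_bounded J t l B"
    then have "hodge_bounded J t l (fin_left n e B)"
      unfolding hodge_bounded_iff using fin_left_hodge_mat[OF G] by metis
    then show "\<exists>C. inf_mat_prod J Q B C \<and> hodge_bounded J t l C"
      using stable unfolding hodge_stable_def Q_def inf_mat_prod_fin_right by blast
  qed
  moreover have "inf_mat_prod3 J Q ?M Q' C"
    unfolding inf_mat_prod3_def
  proof (intro conjI exI)
    show "inf_mat_prod J Q ?M (fin_right n P1 e)"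
      unfolding Q_def inf_mat_prod_fin_right eM by (rule inf_mat_prod_fin_right_right[OF P1(1)])
    show "inf_mat_prod J (fin_right n P1 e) Q' C"
      unfolding Q'_def inf_mat_prod_fin_right using P1 e by (simp add: fin_left_cancel)
    show "inf_mat_prod J ?M Q' (fin_left n e' P2)"
      unfolding Q'_def inf_mat_prod_fin_right[symmetric] Me' by (rule inf_mat_prod_fin_left[OF P2(1)])
    show "inf_mat_prod J Q (fin_left n e' P2) C"
      unfolding Q_def inf_mat_prod_fin_right using P2 e by (simp add: fin_left_cancel)
  qed
  ultimately show ?thesis using C unfolding reducible_def by blast
qed

end

section \<open>Determinants\<close>

text \<open>The Leibniz formula on the index set itself: principal minors over varying sets and
  their complements can be summed without renumbering.\<close>

definition perm_det :: "nat set \<Rightarrow> (nat \<Rightarrow> nat \<Rightarrow> 'a::comm_ring_1) \<Rightarrow> 'a" where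
  "perm_det I A = (\<Sum>p | p permutes I. signof p * (\<Prod>i\<in>I. A i (p i)))"

lemma det_mat_eq_perm_det:
  "Determinant.det (Matrix.mat n n (\<lambda>(i, j). A i j)) = perm_det {..<n} A"
proof -
  have "p i < n" if "p permutes {..<n}" "i < n" for p i
    using permutes_in_image[OF that(1), of i] that(2) by simp
  then show ?thesis
    by (subst det_def'[of _ n]) (auto simp: perm_det_def lessThan_atLeast0 intro!: sum.cong prod.cong)
qed

lemma perm_det_reindex:
  assumes f: "bij_betw f S I" and S: "finite S"
  shows "perm_det I A = (\<Sum>p | p permutes S. signof p * (\<Prod>i\<in>S. A (f i) (f (p i))))"
proof -
  have inj: "inj_on f S" and I: "f ` S = I" using f by (auto simp: bij_betw_def)
  note inv = bij_betw_inv_into[OF f]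
  have finI: "finite I" using S I by blast
  have "perm_det I A = (\<Sum>p | p permutes S. signof (map_permutation S f p) *
      (\<Prod>i\<in>I. A i (map_permutation S f p i)))"
    unfolding perm_det_def
  proof (rule sum.reindex_bij_witness[of _ "map_permutation S f" "map_permutation I (inv_into S f)"])
    fix p assume "p \<in> {p. p permutes I}"
    then have p: "p permutes I" by simp
    show *: "map_permutation S f (map_permutation I (inv_into S f) p) = p"
      by (rule map_permutation_compose_inv[OF inv p]) (use I in \<open>auto simp: f_inv_into_f\<close>)
    show "signof (map_permutation S f (map_permutation I (inv_into S f) p)) *
        (\<Prod>i\<in>I. A i (map_permutation S f (map_permutation I (inv_into S f) p) i)) =
      signof p * (\<Prod>i\<in>I. A i (p i))"
      unfolding * ..
    show "map_permutation I (inv_into S f) p \<in> {p. p permutes S}"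
      using map_permutation_permutes[OF inv p] by simp
  next
    fix p assume "p \<in> {p. p permutes S}"
    then have p: "p permutes S" by simp
    show "map_permutation I (inv_into S f) (map_permutation S f p) = p"
      by (rule map_permutation_compose_inv[OF f p]) (simp add: inv_into_f_f[OF inj])
    show "map_permutation S f p \<in> {p. p permutes I}"
      using map_permutation_permutes[OF f p] by simp
  qed
  also have "\<dots> = (\<Sum>p | p permutes S. signof p * (\<Prod>i\<in>S. A (f i) (f (p i))))"
  proof (rule sum.cong[OF refl])
    fix p assume "p \<in> {p. p permutes S}"
    then have p: "p permutes S" by simp
    have "(\<Prod>i\<in>I. A i (map_permutation S f p i)) = (\<Prod>i\<in>S. A (f i) (map_permutation S f p (f i)))"
      using prod.reindex_bij_betw[OF f, of "\<lambda>i. A i (map_permutation S f p i)"] by simp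
    also have "\<dots> = (\<Prod>i\<in>S. A (f i) (f (p i)))"
      using inj by (intro prod.cong) (simp_all add: map_permutation_apply)
    finally show "signof (map_permutation S f p) * (\<Prod>i\<in>I. A i (map_permutation S f p i)) =
        signof p * (\<Prod>i\<in>S. A (f i) (f (p i)))"
      using sign_map_permutation[OF inj p S] by simp
  qed
  finally show ?thesis .
qed

lemma minor_eq_perm_det:
  assumes "finite I"
  shows "minor A I I = perm_det I A"
proof -
  have "bij_betw ((!) (sorted_list_of_set I)) {..<card I} I"
    by (rule bij_betw_nth) (use assms in auto)
  from perm_det_reindex[OF this, of A] show ?thesis
    unfolding minor_def det_mat_eq_perm_det by (simp add: perm_det_def)
qed

text \<open>The sets \<open>K\<close> collect the rows in which the diagonal term is chosen.\<close>

lemma perm_det_diagonal_plus: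
  fixes b :: "nat \<Rightarrow> nat \<Rightarrow> 'a::comm_ring_1"
  shows "perm_det {..<n} (\<lambda>i j. (if i = j \<and> r \<le> i then \<alpha> else 0) + \<beta> * b i j) =
    (\<Sum>K\<in>Pow {r..<n}. \<alpha> ^ card K * \<beta> ^ (n - card K) * perm_det ({..<n} - K) b)"
proof -
  let ?D = "\<lambda>p i. if i = p i \<and> r \<le> i then \<alpha> else 0"
  let ?f = "\<lambda>K p. signof p * ((\<Prod>i\<in>K. ?D p i) * (\<Prod>i\<in>{..<n} - K. \<beta> * b i (p i)))"
  have "perm_det {..<n} (\<lambda>i j. (if i = j \<and> r \<le> i then \<alpha> else 0) + \<beta> * b i j) =
    (\<Sum>p | p permutes {..<n}. \<Sum>K\<in>Pow {..<n}. ?f K p)"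
    unfolding perm_det_def by (simp add: prod_add sum_distrib_left)
  also have "\<dots> = (\<Sum>K\<in>Pow {..<n}. \<Sum>p | p permutes {..<n}. ?f K p)"
    by (rule sum.swap)
  also have "\<dots> = (\<Sum>K\<in>Pow {r..<n}. \<Sum>p | p permutes {..<n}. ?f K p)"
  proof (rule sum.mono_neutral_right)
    show "\<forall>K\<in>Pow {..<n} - Pow {r..<n}. (\<Sum>p | p permutes {..<n}. ?f K p) = 0"
    proof (intro ballI sum.neutral)
      fix K p assume K: "K \<in> Pow {..<n} - Pow {r..<n}"
      then obtain i where "i \<in> K" "i < r" by force
      then have "(\<Prod>i\<in>K. ?D p i) = 0"
        using K by (intro prod_zero) (auto intro: finite_subset)
      then show "?f K p = 0" by simp
    qed
  qed auto
  also have "\<dots> = (\<Sum>K\<in>Pow {r..<n}. \<alpha> ^ card K * \<beta> ^ (n - card K) * perm_det ({..<n} - K) b)"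
  proof (rule sum.cong[OF refl])
    fix K assume K: "K \<in> Pow {r..<n}"
    then have finK: "finite K" and Kn: "K \<subseteq> {..<n}" by (auto intro: finite_subset)
    \<comment> \<open>Choosing the diagonal entry in the rows of \<open>K\<close> forces
      \<open>p\<close> to fix \<open>K\<close> pointwise.\<close>
    have "(\<Sum>p | p permutes {..<n}. ?f K p) = (\<Sum>p | p permutes {..<n} - K. ?f K p)"
    proof (rule sum.mono_neutral_right)
      show "{p. p permutes {..<n} - K} \<subseteq> {p. p permutes {..<n}}"
        by (auto intro: permutes_subset)
      show "\<forall>p\<in>{p. p permutes {..<n}} - {p. p permutes {..<n} - K}. ?f K p = 0"
      proof
        fix p assume p: "p \<in> {p. p permutes {..<n}} - {p. p permutes {..<n} - K}"
        then have "\<exists>i\<in>K. p i \<noteq> i"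
          using permutes_superset[of p "{..<n}" "{..<n} - K"] by auto
        then have "(\<Prod>i\<in>K. ?D p i) = 0" using finK by (intro prod_zero) metis+
        then show "?f K p = 0" by simp
      qed
    qed (simp add: finite_permutations)
    also have "\<dots> = (\<Sum>p | p permutes {..<n} - K. \<alpha> ^ card K * \<beta> ^ (n - card K) *
        (signof p * (\<Prod>i\<in>{..<n} - K. b i (p i))))"
    proof (rule sum.cong[OF refl])
      fix p assume "p \<in> {p. p permutes {..<n} - K}"
      then have "p i = i" if "i \<in> K" for i using that permutes_not_in[of p "{..<n} - K" i] by simp
      then have "(\<Prod>i\<in>K. ?D p i) = (\<Prod>i\<in>K. \<alpha>)" using K by (intro prod.cong) auto
      moreover have "card ({..<n} - K) = n - card K"
        using finK Kn by (simp add: card_Diff_subset)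
      ultimately show "?f K p = \<alpha> ^ card K * \<beta> ^ (n - card K) *
        (signof p * (\<Prod>i\<in>{..<n} - K. b i (p i)))"
        by (simp add: prod.distrib mult.left_commute mult.assoc)
    qed
    finally show "(\<Sum>p | p permutes {..<n}. ?f K p) =
      \<alpha> ^ card K * \<beta> ^ (n - card K) * perm_det ({..<n} - K) b"
      by (simp add: perm_det_def sum_distrib_left)
  qed
  finally show ?thesis .
qed

lemma det_mat_0_iff:
  fixes f :: "nat \<Rightarrow> nat \<Rightarrow> 'a::idom"
  shows "Determinant.det (Matrix.mat k k (\<lambda>(i, j). f i j)) = 0 \<longleftrightarrow>
    (\<exists>v. (\<exists>i<k. v i \<noteq> 0) \<and> (\<forall>i<k. (\<Sum>j<k. f i j * v j) = 0))" (is "?L \<longleftrightarrow> ?R")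
proof -
  let ?A = "Matrix.mat k k (\<lambda>(i, j). f i j)"
  have mv: "vec_index (?A *\<^sub>v v) i = (\<Sum>j<k. f i j * vec_index v j)" if "v \<in> carrier_vec k" "i < k" for v i
    using that by (auto simp: scalar_prod_def lessThan_atLeast0 intro!: sum.cong)
  have L: "?L \<longleftrightarrow> (\<exists>v. v \<in> carrier_vec k \<and> v \<noteq> 0\<^sub>v k \<and> ?A *\<^sub>v v = 0\<^sub>v k)"
    by (rule det_0_iff_vec_prod_zero) simp
  show ?thesis
  proof
    assume ?L
    then obtain v where v: "v \<in> carrier_vec k" "v \<noteq> 0\<^sub>v k" "?A *\<^sub>v v = 0\<^sub>v k" using L by blast
    have "\<exists>i<k. vec_index v i \<noteq> 0"
    proof (rule ccontr)
      assume "\<not> ?thesis"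
      then have "v = 0\<^sub>v k" using v(1) by (intro eq_vecI) auto
      then show False using v(2) by simp
    qed
    moreover have "\<forall>i<k. (\<Sum>j<k. f i j * vec_index v j) = 0"
      using v(3) mv[OF v(1)] by (metis index_zero_vec(1))
    ultimately show ?R by blast
  next
    assume ?R
    then obtain v where v: "\<exists>i<k. v i \<noteq> 0" "\<forall>i<k. (\<Sum>j<k. f i j * v j) = 0" by blast
    let ?v = "Matrix.vec k v"
    have "?v \<noteq> 0\<^sub>v k" using v(1) by (metis index_vec index_zero_vec(1))
    moreover have "?A *\<^sub>v ?v = 0\<^sub>v k"
    proof (rule eq_vecI)
      fix i assume "i < dim_vec (0\<^sub>v k :: 'a Matrix.vec)"
      then show "vec_index (?A *\<^sub>v ?v) i = vec_index (0\<^sub>v k) i"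
        using v(2) mv[of ?v i] by simp
    qed simp
    ultimately show ?L using L by (metis vec_carrier)
  qed
qed

lemma det_mat_0_iff_left:
  fixes f :: "nat \<Rightarrow> nat \<Rightarrow> 'a::idom"
  shows "Determinant.det (Matrix.mat k k (\<lambda>(i, j). f i j)) = 0 \<longleftrightarrow>
    (\<exists>v. (\<exists>i<k. v i \<noteq> 0) \<and> (\<forall>j<k. (\<Sum>i<k. v i * f i j) = 0))"
proof -
  have "Determinant.det (Matrix.mat k k (\<lambda>(i, j). f i j)) =
    Determinant.det (transpose_mat (Matrix.mat k k (\<lambda>(i, j). f i j)))"
    by (rule det_transpose[symmetric, of _ k]) simp
  also have "transpose_mat (Matrix.mat k k (\<lambda>(i, j). f i j)) = Matrix.mat k k (\<lambda>(i, j). f j i)"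
    by (rule eq_matI) auto
  finally show ?thesis
    using det_mat_0_iff[of k "\<lambda>i j. f j i"] by (simp add: mult.commute)
qed

lemma mat_mult_eq:
  "Matrix.mat n n (\<lambda>(i, j). f i j) * Matrix.mat n n (\<lambda>(i, j). g i j) =
    Matrix.mat n n (\<lambda>(i, j). \<Sum>k<n. f i k * g k j)"
  by (rule eq_matI) (auto simp: scalar_prod_def lessThan_atLeast0 intro!: sum.cong)

lemma det_mat_mult:
  fixes f :: "nat \<Rightarrow> nat \<Rightarrow> 'a::comm_ring_1"
  shows "Determinant.det (Matrix.mat n n (\<lambda>(i, j). f i j)) * Determinant.det (Matrix.mat n n (\<lambda>(i, j). g i j))
    = Determinant.det (Matrix.mat n n (\<lambda>(i, j). \<Sum>k<n. f i k * g k j))"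
  using det_mult[of "Matrix.mat n n (\<lambda>(i, j). f i j)" n "Matrix.mat n n (\<lambda>(i, j). g i j)"]
  by (simp add: mat_mult_eq)

lemma fin_inverse_exists:
  fixes f :: "nat \<Rightarrow> nat \<Rightarrow> 'a::field"
  assumes "Determinant.det (Matrix.mat k k (\<lambda>(i, j). f i j)) \<noteq> 0"
  obtains c where "fin_inverse k c f" "fin_inverse k f c"
proof -
  let ?A = "Matrix.mat k k (\<lambda>(i, j). f i j)"
  have "?A \<in> Units (ring_mat TYPE('a) k b)" for b
    by (rule det_non_zero_imp_unit) (use assms in auto)
  then obtain B where B: "B \<in> carrier_mat k k" "?A * B = 1\<^sub>m k" "B * ?A = 1\<^sub>m k"
    by (auto simp: Units_def ring_mat_def)
  have BB: "B = Matrix.mat k k (\<lambda>(i, j). B $$ (i, j))" using B(1) by auto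
  have *: "(\<Sum>q<k. f i q * B $$ (q, j)) = inf_mat_one i j"
    "(\<Sum>q<k. B $$ (i, q) * f q j) = inf_mat_one i j" if "i < k" "j < k" for i j
  proof -
    have "(?A * B) $$ (i, j) = (1\<^sub>m k :: 'a Matrix.mat) $$ (i, j)"
      "(B * ?A) $$ (i, j) = (1\<^sub>m k :: 'a Matrix.mat) $$ (i, j)"
      using B by simp_all
    then show "(\<Sum>q<k. f i q * B $$ (q, j)) = inf_mat_one i j"
      "(\<Sum>q<k. B $$ (i, q) * f q j) = inf_mat_one i j"
      using that B(1) by (simp_all add: scalar_prod_def lessThan_atLeast0 inf_mat_one_def)
  qed
  show thesis by (rule that[of "\<lambda>i j. B $$ (i, j)"]) (auto simp: fin_inverse_def *)
qed

section \<open>The pencil of a level\<close>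

text \<open>With \<open>E\<close> the projection to the indices in \<open>{r..<n}\<close>, the pencil is \<open>\<alpha> E + \<beta> b\<close>.\<close>

definition pencil :: "nat \<Rightarrow> nat \<Rightarrow> 'k::field poly \<Rightarrow> 'k poly \<Rightarrow> (nat \<Rightarrow> nat \<Rightarrow> 'k) \<Rightarrow> nat \<Rightarrow> nat \<Rightarrow> 'k poly" where
  "pencil r n \<alpha> \<beta> b i j = (if i = j \<and> r \<le> i then \<alpha> else 0) + \<beta> * [:b i j:]"

definition pencil_det :: "nat \<Rightarrow> nat \<Rightarrow> 'k::field poly \<Rightarrow> 'k poly \<Rightarrow> (nat \<Rightarrow> nat \<Rightarrow> 'k) \<Rightarrow> 'k poly" where
  "pencil_det r n \<alpha> \<beta> b = Determinant.det (Matrix.mat n n (\<lambda>(i, j). pencil r n \<alpha> \<beta> b i j))"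

lemma sum_const_poly: "(\<Sum>i\<in>A. [:f i:]) = [:\<Sum>i\<in>A. f i:]"
  by (induction A rule: infinite_finite_induct) auto

lemma const_poly_mult: "[:x:] * [:y:] = [:x * y :: 'a::comm_semiring_0:]"
  by (simp add: mult.commute)

text \<open>The entrywise hypothesis says \<open>G E = E e\<close>, so the new pencil is
  \<open>G (\<alpha> E + \<beta> b) e'\<close>. The factor \<open>det G * det e'\<close> is a unit
  of the polynomial ring, hence a nonzero constant, and it depends on neither
  \<open>\<alpha>\<close> nor \<open>\<beta>\<close>.\<close>

lemma pencil_det_conjugate:
  fixes b :: "nat \<Rightarrow> nat \<Rightarrow> 'k::field"
  assumes e: "fin_inverse n e e'" and G: "fin_inverse n G G'"
    and E: "\<And>i j. i < n \<Longrightarrow> j < n \<Longrightarrow> (if r \<le> j then G i j else 0) = (if r \<le> i then e i j else 0)"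
  obtains u where "u \<noteq> 0"
    "\<And>\<alpha> \<beta>. pencil_det r n \<alpha> \<beta> (fin_right n (fin_left n G b) e') = [:u:] * pencil_det r n \<alpha> \<beta> b"
proof -
  let ?d = "\<lambda>g. Determinant.det (Matrix.mat n n (\<lambda>(i, j). [:g i j:] :: 'k poly))"
  have unit: "?d g * ?d g' = 1" if "fin_inverse n g g'" for g g'
  proof -
    have "?d g * ?d g' = Determinant.det (Matrix.mat n n (\<lambda>(i, j). \<Sum>k<n. [:g i k:] * [:g' k j:]))"
      by (rule det_mat_mult)
    also have "Matrix.mat n n (\<lambda>(i, j). \<Sum>k<n. [:g i k:] * [:g' k j:]) = (1\<^sub>m n :: 'k poly Matrix.mat)"
    proof (intro eq_matI)
      fix i j assume "i < dim_row (1\<^sub>m n :: 'k poly Matrix.mat)" "j < dim_col (1\<^sub>m n :: 'k poly Matrix.mat)"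
      then have ij: "i < n" "j < n" by simp_all
      have "(\<Sum>k<n. [:g i k:] * [:g' k j:]) = [:\<Sum>k<n. g i k * g' k j:]"
        by (simp add: const_poly_mult sum_const_poly del: mult_pCons_left mult_pCons_right)
      then show "Matrix.mat n n (\<lambda>(i, j). \<Sum>k<n. [:g i k:] * [:g' k j:]) $$ (i, j) = 1\<^sub>m n $$ (i, j)"
        using that ij by (simp add: fin_inverse_def inf_mat_one_def one_pCons del: mult_pCons_left)
    qed simp_all
    finally show ?thesis by simp
  qed
  have "?d G * ?d e' dvd 1"
    using unit[OF G] unit[OF e] by (metis dvd_triv_left dvd_triv_right is_unit_mult_iff)
  then obtain u where u: "?d G * ?d e' = [:u:]" "u \<noteq> 0"
    unfolding is_unit_poly_iff by (metis pCons_0_0 is_unit_pCons_iff dvd_0_left_iff zero_neq_one)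
  have "pencil_det r n \<alpha> \<beta> (fin_right n (fin_left n G b) e') = [:u:] * pencil_det r n \<alpha> \<beta> b" for \<alpha> \<beta>
  proof -
    have eq: "(\<Sum>k<n. (\<Sum>m<n. [:G i m:] * pencil r n \<alpha> \<beta> b m k) * [:e' k j:])
       = pencil r n \<alpha> \<beta> (fin_right n (fin_left n G b) e') i j" if ij: "i < n" "j < n" for i j
    proof -
      have 1: "(\<Sum>m<n. [:G i m:] * pencil r n \<alpha> \<beta> b m k) =
        (if r \<le> i then [:e i k:] * \<alpha> else 0) + \<beta> * [:\<Sum>m<n. G i m * b m k:]" if k: "k < n" for k
      proof -
        have "(\<Sum>m<n. [:G i m:] * pencil r n \<alpha> \<beta> b m k) =
          (\<Sum>m<n. if m = k then (if r \<le> k then [:G i k:] * \<alpha> else 0) else 0) +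
          (\<Sum>m<n. \<beta> * ([:G i m:] * [:b m k:]))"
          unfolding sum.distrib[symmetric]
          by (rule sum.cong) (auto simp: pencil_def algebra_simps)
        also have "(\<Sum>m<n. \<beta> * ([:G i m:] * [:b m k:])) = \<beta> * [:\<Sum>m<n. G i m * b m k:]"
          by (simp only: sum_distrib_left[symmetric] const_poly_mult sum_const_poly)
        also have "(\<Sum>m<n. if m = k then (if r \<le> k then [:G i k:] * \<alpha> else 0) else 0) =
          (if r \<le> i then [:e i k:] * \<alpha> else 0)"
          using E[OF ij(1) k] k by (auto split: if_splits)
        finally show ?thesis .
      qed
      have "(\<Sum>k<n. (\<Sum>m<n. [:G i m:] * pencil r n \<alpha> \<beta> b m k) * [:e' k j:]) =
        (\<Sum>k<n. (if r \<le> i then \<alpha> else 0) * ([:e i k:] * [:e' k j:])) +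
        (\<Sum>k<n. \<beta> * ([:\<Sum>m<n. G i m * b m k:] * [:e' k j:]))"
        unfolding sum.distrib[symmetric]
      proof (rule sum.cong[OF refl])
        fix k assume "k \<in> {..<n}"
        then have k: "k < n" by simp
        show "(\<Sum>m<n. [:G i m:] * pencil r n \<alpha> \<beta> b m k) * [:e' k j:] =
          (if r \<le> i then \<alpha> else 0) * ([:e i k:] * [:e' k j:]) +
          \<beta> * ([:\<Sum>m<n. G i m * b m k:] * [:e' k j:])"
          unfolding 1[OF k] by (cases "r \<le> i") (simp_all only: if_True if_False algebra_simps mult_zero_left)
      qed
      also have "(\<Sum>k<n. (if r \<le> i then \<alpha> else 0) * ([:e i k:] * [:e' k j:])) =
          (if i = j \<and> r \<le> i then \<alpha> else 0)"
      proof -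
        have "(\<Sum>k<n. e i k * e' k j) = inf_mat_one i j"
          using e ij by (simp add: fin_inverse_def)
        then show ?thesis
          unfolding sum_distrib_left[symmetric] const_poly_mult sum_const_poly
          by (simp add: inf_mat_one_def)
      qed
      also have "(\<Sum>k<n. \<beta> * ([:\<Sum>m<n. G i m * b m k:] * [:e' k j:])) =
          \<beta> * [:fin_right n (fin_left n G b) e' i j:]"
        using ij unfolding sum_distrib_left[symmetric] const_poly_mult sum_const_poly
        by (simp add: fin_right_def fin_left_def)
      finally show ?thesis by (simp add: pencil_def)
    qed
    have "?d G * pencil_det r n \<alpha> \<beta> b * ?d e' =
      Determinant.det (Matrix.mat n n (\<lambda>(i, j). \<Sum>k<n. (\<Sum>m<n. [:G i m:] * pencil r n \<alpha> \<beta> b m k) * [:e' k j:]))"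
      unfolding pencil_det_def det_mat_mult ..
    also have "\<dots> = pencil_det r n \<alpha> \<beta> (fin_right n (fin_left n G b) e')"
      unfolding pencil_det_def
      by (intro arg_cong[of _ _ Determinant.det] cong_mat) (auto simp: eq simp del: mult_pCons_left mult_pCons_right)
    finally have "pencil_det r n \<alpha> \<beta> (fin_right n (fin_left n G b) e') = [:u:] * pencil_det r n \<alpha> \<beta> b"
      unfolding u(1)[symmetric] by (simp add: ac_simps)
    then show ?thesis .
  qed
  then show thesis using u(2) that by blast
qed

lemma poly_det_0:
  fixes f :: "nat \<Rightarrow> nat \<Rightarrow> 'a::comm_ring_1 poly"
  shows "poly (Determinant.det (Matrix.mat n n (\<lambda>(i, j). f i j))) 0 =
    Determinant.det (Matrix.mat n n (\<lambda>(i, j). poly (f i j) 0))"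
proof -
  have "map_mat (\<lambda>p. poly p 0) (Matrix.mat n n (\<lambda>(i, j). f i j)) =
      Matrix.mat n n (\<lambda>(i, j). poly (f i j) 0)"
    by (rule eq_matI) auto
  then show ?thesis using comm_ring_hom.hom_det[OF poly_hom.comm_ring_hom_axioms, of 0 "Matrix.mat n n (\<lambda>(i, j). f i j)"] by simp
qed

section \<open>The roots 0 and infinity of the pencil\<close>

abbreviation pX :: "'k::field poly" where "pX \<equiv> Polynomial.monom 1 1"

text \<open>The rows from \<open>k\<close> on make the pencil block upper triangular, with a
  triangular last block whose diagonal entries are all \<open>pX\<close>.\<close>

lemma pencil_det_triangular:
  fixes b :: "nat \<Rightarrow> nat \<Rightarrow> 'k::field"
  assumes k: "r \<le> k" "k \<le> n" and b: "\<And>i j. k \<le> i \<Longrightarrow> i < n \<Longrightarrow> j \<le> i \<Longrightarrow> b i j = 0"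
  shows "pencil_det r n pX 1 b =
    Polynomial.monom 1 (n - k) * Determinant.det (Matrix.mat k k (\<lambda>(i, j). pencil r n pX 1 b i j))"
proof -
  let ?f = "\<lambda>(i, j). pencil r n pX 1 b i j"
  let ?D = "Matrix.mat (n - k) (n - k) (\<lambda>(i, j). ?f (i + k, j + k))"
  have "Matrix.mat n n ?f = four_block_mat (Matrix.mat k k ?f)
      (Matrix.mat k (n - k) (\<lambda>(i, j). ?f (i, j + k))) (0\<^sub>m (n - k) k) ?D"
    by (rule eq_matI) (use k in \<open>auto simp: pencil_def b\<close>)
  then have "pencil_det r n pX 1 b = Determinant.det (Matrix.mat k k ?f) * Determinant.det ?D"
    unfolding pencil_det_def
    using det_four_block_mat_lower_left_zero[of "Matrix.mat k k ?f" k _ "n - k" _ ?D] by simp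
  moreover have "Determinant.det ?D = prod_list (diag_mat ?D)"
    by (rule det_upper_triangular[of _ "n - k"]) (auto simp: upper_triangular_def pencil_def b)
  moreover have "\<dots> = (\<Prod>i=0..<n - k. pX)"
    unfolding prod_list_diag_prod by (rule prod.cong) (use k in \<open>auto simp: pencil_def b\<close>)
  ultimately show ?thesis by (simp add: monom_power mult.commute)
qed

lemma coeff_monom_mult_0: "Polynomial.coeff (Polynomial.monom 1 m * p :: 'a::comm_ring_1 poly) m = poly p 0"
  by (simp add: coeff_monom_mult poly_0_coeff_0)

lemma pencil_det_triangular_coeff:
  fixes b :: "nat \<Rightarrow> nat \<Rightarrow> 'k::field"
  assumes "r \<le> k" "k \<le> n" and "\<And>i j. k \<le> i \<Longrightarrow> i < n \<Longrightarrow> j \<le> i \<Longrightarrow> b i j = 0"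
  shows "Polynomial.coeff (pencil_det r n pX 1 b) (n - k) = Determinant.det (Matrix.mat k k (\<lambda>(i, j). b i j))"
proof -
  have "Polynomial.coeff (pencil_det r n pX 1 b) (n - k) =
    Determinant.det (Matrix.mat k k (\<lambda>(i, j). poly (pencil r n pX 1 b i j) 0))"
    using pencil_det_triangular[of r k n b] assms coeff_monom_mult_0 poly_det_0 by metis
  moreover have "poly (pencil r n pX 1 b i j) 0 = b i j" for i j
    by (simp add: pencil_def poly_monom)
  ultimately show ?thesis by simp
qed

text \<open>The leading block of \<open>b\<close> has a left null vector. If it were supported
  before \<open>r\<close>, where \<open>E\<close> is zero, it would annihilate the leading block of
  the pencil as well. A nonzero entry at a level index is needed because swaps act only within the
  level.\<close>

lemma pencil_det_triangular_kernel:
  fixes b :: "nat \<Rightarrow> nat \<Rightarrow> 'k::field"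
  assumes k: "r \<le> k" "k \<le> n" and b: "\<And>i j. k \<le> i \<Longrightarrow> i < n \<Longrightarrow> j \<le> i \<Longrightarrow> b i j = 0"
    and zero: "Polynomial.coeff (pencil_det r n pX 1 b) (n - k) = 0" and nonzero: "pencil_det r n pX 1 b \<noteq> 0"
  obtains c j where "r \<le> j" "j < k" "c j \<noteq> 0" "\<And>j. j < k \<Longrightarrow> (\<Sum>i<k. c i * b i j) = 0"
proof -
  have "Determinant.det (Matrix.mat k k (\<lambda>(i, j). b i j)) = 0"
    using zero pencil_det_triangular_coeff[OF k b] by simp
  then obtain c i where c: "i < k" "c i \<noteq> 0" "\<And>j. j < k \<Longrightarrow> (\<Sum>i<k. c i * b i j) = 0"
    unfolding det_mat_0_iff_left by blast
  have "\<exists>j. r \<le> j \<and> j < k \<and> c j \<noteq> 0"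
  proof (rule ccontr)
    assume "\<not> ?thesis"
    then have c0: "c j = 0" if "r \<le> j" "j < k" for j using that by blast
    have "(\<Sum>i<k. [:c i:] * pencil r n pX 1 b i j) = 0" if "j < k" for j
    proof -
      have "(\<Sum>i<k. [:c i:] * pencil r n pX 1 b i j) = (\<Sum>i<k. [:c i * b i j:])"
        by (rule sum.cong) (auto simp: pencil_def c0)
      then show ?thesis using c(3)[OF that] by (simp add: sum_const_poly)
    qed
    then have "Determinant.det (Matrix.mat k k (\<lambda>(i, j). pencil r n pX 1 b i j)) = 0"
      unfolding det_mat_0_iff_left using c(1,2) by (intro exI[of _ "\<lambda>i. [:c i:]"]) auto
    then show False using nonzero pencil_det_triangular[OF k b] by simp
  qed
  then show thesis using that c(3) by blast
qed

text \<open>For \<open>r \<le> j < k\<close> the unit vector in column \<open>j\<close> of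
  \<open>E + pX b\<close> is itself a combination of columns of \<open>b\<close> before
  \<open>j\<close>, with coefficients \<open>v j\<close>. So the pencil factors as the displayed
  matrix times an upper triangular \<open>T\<close> with \<open>k\<close> diagonal entries
  \<open>pX\<close> and the others 1.\<close>

lemma pencil_det_chain:
  fixes b :: "nat \<Rightarrow> nat \<Rightarrow> 'k::field"
  assumes k: "r \<le> k" "k \<le> n" and v0: "\<And>i q. r \<le> i \<Longrightarrow> i < k \<Longrightarrow> i \<le> q \<Longrightarrow> v i q = 0"
    and v: "\<And>i j. r \<le> i \<Longrightarrow> i < k \<Longrightarrow> j < n \<Longrightarrow> (\<Sum>q<n. b j q * v i q) = inf_mat_one j i"
  shows "pencil_det r n 1 pX b = Polynomial.monom 1 k * Determinant.det
    (Matrix.mat n n (\<lambda>(i, j). if j < k then [:b i j:] else pencil r n 1 pX b i j))"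
proof -
  define M where "M i j = (if j < k then [:b i j:] else pencil r n 1 pX b i j)" for i j
  define T where "T q j = (if q = j then (if j < k then pX else 1) else 0) +
    (if r \<le> j \<and> j < k then [:v j q:] else 0)" for q j
  have "(\<Sum>q<n. M i q * T q j) = pencil r n 1 pX b i j" if ij: "i < n" "j < n" for i j
  proof -
    have 1: "(\<Sum>q<n. M i q * (if q = j then (if j < k then pX else 1) else 0)) =
        (if j < k then pX * [:b i j:] else pencil r n 1 pX b i j)"
    proof -
      have "(\<Sum>q<n. M i q * (if q = j then (if j < k then pX else 1) else 0)) =
        (\<Sum>q<n. if q = j then M i j * (if j < k then pX else 1) else 0)"
        by (rule sum.cong) auto
      then show ?thesis using ij by (simp add: M_def)
    qed
    have "(\<Sum>q<n. M i q * (if r \<le> j \<and> j < k then [:v j q:] else 0)) =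
        (if r \<le> j \<and> j < k then [:\<Sum>q<n. b i q * v j q:] else 0)"
    proof (cases "r \<le> j \<and> j < k")
      case True
      then have "M i q * [:v j q:] = [:b i q * v j q:]" for q
        using v0[of j q] by (cases "q < k") (auto simp: M_def const_poly_mult)
      then show ?thesis using True by (simp add: sum_const_poly)
    next
      case False
      then show ?thesis by (simp only: if_False mult_zero_right sum.neutral_const)
    qed
    then have 2: "(\<Sum>q<n. M i q * (if r \<le> j \<and> j < k then [:v j q:] else 0)) =
        (if r \<le> j \<and> j < k then if i = j then 1 else 0 else 0)"
      using v[of j i] ij by (auto simp: inf_mat_one_def)
    show ?thesis
      unfolding T_def distrib_left sum.distrib 1 2 by (auto simp: pencil_def)
  qed
  then have "Determinant.det (Matrix.mat n n (\<lambda>(i, j). M i j)) * Determinant.det (Matrix.mat n n (\<lambda>(i, j). T i j))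
      = pencil_det r n 1 pX b"
    unfolding det_mat_mult pencil_det_def
    by (intro arg_cong[of _ _ Determinant.det] cong_mat) auto
  moreover have "Determinant.det (Matrix.mat n n (\<lambda>(i, j). T i j)) =
      prod_list (diag_mat (Matrix.mat n n (\<lambda>(i, j). T i j)))"
    by (rule det_upper_triangular[of _ n]) (auto simp: upper_triangular_def T_def v0)
  moreover have "\<dots> = (\<Prod>i=0..<n. if i < k then pX else 1)"
    unfolding prod_list_diag_prod by (rule prod.cong) (auto simp: T_def v0)
  moreover have "(\<Prod>i=0..<n. if i < k then pX else 1 :: 'k poly) = (\<Prod>i=0..<k. pX)"
    using k by (intro prod.mono_neutral_cong_right) auto
  ultimately show ?thesis by (simp add: M_def monom_power mult.commute)
qed

lemma pencil_det_chain_coeff: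
  fixes b :: "nat \<Rightarrow> nat \<Rightarrow> 'k::field"
  assumes k: "r \<le> k" "k \<le> n" and v0: "\<And>i q. r \<le> i \<Longrightarrow> i < k \<Longrightarrow> i \<le> q \<Longrightarrow> v i q = 0"
    and v: "\<And>i j. r \<le> i \<Longrightarrow> i < k \<Longrightarrow> j < n \<Longrightarrow> (\<Sum>q<n. b j q * v i q) = inf_mat_one j i"
  shows "Polynomial.coeff (pencil_det r n 1 pX b) k =
    Determinant.det (Matrix.mat n n (\<lambda>(i, j). if j < k then b i j else inf_mat_one i j))"
proof -
  have "Polynomial.coeff (pencil_det r n 1 pX b) k = Determinant.det
      (Matrix.mat n n (\<lambda>(i, j). poly (if j < k then [:b i j:] else pencil r n 1 pX b i j) 0))"
    using pencil_det_chain[of r k n v b] k v0 v by (simp only: coeff_monom_mult_0 poly_det_0)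
  also have "Matrix.mat n n (\<lambda>(i, j). poly (if j < k then [:b i j:] else pencil r n 1 pX b i j) 0) =
      Matrix.mat n n (\<lambda>(i, j). if j < k then b i j else inf_mat_one i j)"
    using k by (intro cong_mat) (auto simp: pencil_def inf_mat_one_def poly_monom)
  finally show ?thesis .
qed

text \<open>A null vector \<open>c\<close> of the matrix made of \<open>k\<close> columns of
  \<open>b\<close> and unit columns says that the first \<open>k\<close> columns of \<open>b\<close>
  combine to 0 in rows before \<open>k\<close> and to \<open>- c j\<close> in rows
  \<open>j \<ge> k\<close>. If these \<open>c j\<close> all vanished, \<open>c\<close> would also
  annihilate the polynomial matrix.\<close>

lemma pencil_det_chain_kernel:
  fixes b :: "nat \<Rightarrow> nat \<Rightarrow> 'k::field"
  assumes k: "r \<le> k" "k \<le> n" and v0: "\<And>i q. r \<le> i \<Longrightarrow> i < k \<Longrightarrow> i \<le> q \<Longrightarrow> v i q = 0"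
    and v: "\<And>i j. r \<le> i \<Longrightarrow> i < k \<Longrightarrow> j < n \<Longrightarrow> (\<Sum>q<n. b j q * v i q) = inf_mat_one j i"
    and zero: "Polynomial.coeff (pencil_det r n 1 pX b) k = 0" and nonzero: "pencil_det r n 1 pX b \<noteq> 0"
  obtains c j where "k \<le> j" "j < n" "(\<Sum>q<k. b j q * c q) \<noteq> 0"
    "\<And>i. i < k \<Longrightarrow> (\<Sum>q<k. b i q * c q) = 0"
proof -
  have "Determinant.det (Matrix.mat n n (\<lambda>(i, j). if j < k then b i j else inf_mat_one i j)) = 0"
    using zero pencil_det_chain_coeff[OF k v0 v] by simp
  then obtain c m where c: "m < n" "c m \<noteq> 0"
    "\<And>i. i < n \<Longrightarrow> (\<Sum>j<n. (if j < k then b i j else inf_mat_one i j) * c j) = 0"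
    unfolding det_mat_0_iff by blast
  have split: "(\<Sum>q<k. b i q * c q) + (if k \<le> i then c i else 0) = 0" if "i < n" for i
  proof -
    have "(\<Sum>j<n. (if j < k then b i j else inf_mat_one i j) * c j) =
      (\<Sum>j<n. if j < k then b i j * c j else 0) + (\<Sum>j<n. if i = j then if k \<le> j then c j else 0 else 0)"
      unfolding sum.distrib[symmetric] by (rule sum.cong) (auto simp: inf_mat_one_def)
    also have "(\<Sum>j<n. if j < k then b i j * c j else 0) = (\<Sum>j<k. b i j * c j)"
      using k by (intro sum.mono_neutral_cong_right) auto
    finally show ?thesis using c(3)[OF that] that by simp
  qed
  have "\<exists>j. k \<le> j \<and> j < n \<and> c j \<noteq> 0"
  proof (rule ccontr)
    assume "\<not> ?thesis"
    then have c0: "c j = 0" if "k \<le> j" "j < n" for j using that by blast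
    have "(\<Sum>j<n. (if j < k then [:b i j:] else pencil r n 1 pX b i j) * [:c j:]) = 0" if "i < n" for i
    proof -
      have "(\<Sum>j<n. (if j < k then [:b i j:] else pencil r n 1 pX b i j) * [:c j:]) =
        (\<Sum>j<k. [:b i j * c j:])"
        using k by (intro sum.mono_neutral_cong_right) (auto simp: c0 const_poly_mult)
      then show ?thesis using split[OF that] c0[OF _ that] by (auto simp: sum_const_poly split: if_splits)
    qed
    then have "Determinant.det
        (Matrix.mat n n (\<lambda>(i, j). if j < k then [:b i j:] else pencil r n 1 pX b i j)) = 0"
      unfolding det_mat_0_iff using c(1,2) by (intro exI[of _ "\<lambda>i. [:c i:]"]) auto
    then show False using nonzero pencil_det_chain[OF k v0 v] by simp
  qed
  then obtain j where j: "k \<le> j" "j < n" "c j \<noteq> 0" by blast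
  have "(\<Sum>q<k. b i q * c q) = 0" if "i < k" for i
    using split[of i] that k by simp
  moreover have "(\<Sum>q<k. b j q * c q) \<noteq> 0" using split[of j] j by auto
  ultimately show thesis using that j by blast
qed

section \<open>Elementary conjugations\<close>

lemma fin_inverse_unipotent:
  fixes u :: "nat \<Rightarrow> nat \<Rightarrow> 'a::ring_1"
  assumes "\<And>i k j. u i k * u k j = 0"
  shows "fin_inverse n (\<lambda>i j. inf_mat_one i j + u i j) (\<lambda>i j. inf_mat_one i j - u i j)"
proof -
  have "(\<Sum>k<n. (inf_mat_one i k + u i k) * (inf_mat_one k j - u k j)) = inf_mat_one i j"
    if "i < n" "j < n" for i j
  proof -
    have "(\<Sum>k<n. (inf_mat_one i k + u i k) * (inf_mat_one k j - u k j)) =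
      (\<Sum>k<n. if i = k then inf_mat_one k j - u k j else 0) + (\<Sum>k<n. if k = j then u i k else 0)"
      unfolding sum.distrib[symmetric]
      by (rule sum.cong) (auto simp: inf_mat_one_def algebra_simps assms)
    then show ?thesis using that by simp
  qed
  then show ?thesis by (simp add: fin_inverse_def)
qed

text \<open>This is \<open>(1 + h) b (1 - h E)\<close>. The right factor is the reduction of the
  inverse conjugating matrix, where the columns before \<open>r\<close> carry a positive power of
  \<open>t\<close>.\<close>

definition transvect :: "nat \<Rightarrow> nat \<Rightarrow> (nat \<Rightarrow> nat \<Rightarrow> 'k::field) \<Rightarrow> (nat \<Rightarrow> nat \<Rightarrow> 'k) \<Rightarrow> nat \<Rightarrow> nat \<Rightarrow> 'k" where
  "transvect r n h b i j = (b i j + (\<Sum>k<n. h i k * b k j)) -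
     (if r \<le> j then \<Sum>m<n. (b i m + (\<Sum>k<n. h i k * b k m)) * h m j else 0)"

section \<open>Moves over the residue field and their lifts\<close>

context adic_level
begin

abbreviation reduct :: "'a inf_mat \<Rightarrow> nat \<Rightarrow> nat \<Rightarrow> 'b" where
  "reduct A i j \<equiv> \<rho> (A i j)"

text \<open>Quantifying over all lifts allows the moves to be chosen over the field: whatever lift
  of a move is taken, the result is again a lift of the new matrix.\<close>

definition lifts_reducible :: "(nat \<Rightarrow> nat \<Rightarrow> 'b) \<Rightarrow> bool" where
  "lifts_reducible b \<longleftrightarrow> (\<forall>A. reduct A = b \<longrightarrow> reducible s A)"

lemma fin_inverse_reduct: "fin_inverse n e e' \<Longrightarrow> fin_inverse n (reduct e) (reduct e')"
  unfolding fin_inverse_def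
proof (intro allI impI)
  fix i j assume "\<forall>i<n. \<forall>j<n. (\<Sum>k<n. e i k * e' k j) = inf_mat_one i j" "i < n" "j < n"
  then have "\<rho> (\<Sum>k<n. e i k * e' k j) = \<rho> (inf_mat_one i j)" by simp
  then show "(\<Sum>k<n. \<rho> (e i k) * \<rho> (e' k j)) = inf_mat_one i j"
    by (simp add: hom_sum hom_mult inf_mat_one_def if_distrib[of \<rho>] cong: if_cong)
qed

lemma reduct_conjugate:
  "reduct (fin_right n (fin_left n G A) e') =
    fin_right n (fin_left n (reduct G) (reduct A)) (reduct e')"
  by (intro ext) (simp add: fin_right_def fin_left_def hom_sum hom_mult)

text \<open>Cancelling powers of \<open>t\<close> in \<open>e D = D G\<close> yields
  \<open>G E = E e\<close> modulo \<open>J\<close>: the two matrices agree on the level,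
  \<open>e\<close> is divisible by \<open>t\<close> for \<open>j < r \<le> i\<close>, and
  \<open>G\<close> is for \<open>i < r \<le> j\<close>.\<close>

lemma pencil_det_reduct_conjugate:
  assumes e: "fin_inverse n e e'" and G: "fin_inverse n G G'"
    and comm: "\<And>i k. i < n \<Longrightarrow> k < n \<Longrightarrow> e i k * t ^ l k = t ^ l i * G i k"
  obtains u where "u \<noteq> 0"
    "\<And>\<alpha> \<beta>. pencil_det r n \<alpha> \<beta> (reduct (fin_right n (fin_left n G A) e')) =
      [:u:] * pencil_det r n \<alpha> \<beta> (reduct A)"
proof -
  have "(if r \<le> j then \<rho> (G i j) else 0) = (if r \<le> i then \<rho> (e i j) else 0)" if ij: "i < n" "j < n" for i j
  proof -
    consider "r \<le> i" "r \<le> j" | "r \<le> i" "j < r" | "i < r" "r \<le> j" | "i < r" "j < r" by linarith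
    then show ?thesis
    proof cases
      case 1
      then have "t ^ a * e i j = t ^ a * G i j"
        using comm[OF ij] l_eq ij t_pow_central[of a "e i j"] by simp
      then have "e i j = G i j" by (rule t_pow_cancel)
      then show ?thesis using 1 by simp
    next
      case 2
      then have less: "l j < l i" using l_eq[of i] l_less[of j] ij by simp
      have "t ^ l j * e i j = t ^ l j * (t ^ (l i - l j) * G i j)"
        using comm[OF ij] less t_pow_central[of "l j" "e i j"] by (simp flip: mult.assoc power_add)
      then have "e i j = t ^ (l i - l j) * G i j" by (rule t_pow_cancel)
      then have "\<rho> (e i j) = 0"
        using t_pow_in_J[of "l i - l j"] less by (simp add: hom_kernel J_rmult)
      then show ?thesis using 2 by simp
    next
      case 3
      then have less: "l i < l j" using l_eq[of j] l_less[of i] ij by simp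
      have "t ^ l i * (t ^ (l j - l i) * e i j) = t ^ l i * G i j"
        using comm[OF ij] less t_pow_central[of "l j" "e i j"] by (simp flip: mult.assoc power_add)
      then have "G i j = t ^ (l j - l i) * e i j" by (metis t_pow_cancel)
      then have "\<rho> (G i j) = 0"
        using t_pow_in_J[of "l j - l i"] less by (simp add: hom_kernel J_rmult)
      then show ?thesis using 3 by simp
    qed simp
  qed
  from pencil_det_conjugate[OF fin_inverse_reduct[OF e] fin_inverse_reduct[OF G] this, where b = "reduct A"]
  show thesis using that unfolding reduct_conjugate by blast
qed

lemma exists_reduct: "\<exists>A. reduct A = b"
proof -
  have "\<forall>i j. \<exists>x. \<rho> x = b i j" using hom_surj by blast
  then obtain A where "\<And>i j. \<rho> (A i j) = b i j" by metis
  then have "reduct A = b" by (intro ext)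
  then show ?thesis by (rule exI[of _ A])
qed

lemma lifts_reducible_conjugate:
  assumes e: "fin_inverse n e e'" "fin_inverse n e' e" and G: "fin_inverse n G G'"
    and comm: "\<And>i k. i < n \<Longrightarrow> k < n \<Longrightarrow> e i k * t ^ l k = t ^ l i * G i k"
    and b': "b' = fin_right n (fin_left n (reduct G) b) (reduct e')"
  shows "lifts_reducible b' \<Longrightarrow> lifts_reducible b"
    and "\<exists>u. u \<noteq> 0 \<and> (\<forall>\<alpha> \<beta>. pencil_det r n \<alpha> \<beta> b' = [:u:] * pencil_det r n \<alpha> \<beta> b)"
proof -
  show "lifts_reducible b" if "lifts_reducible b'"
    unfolding lifts_reducible_def
  proof (intro allI impI)
    fix A assume "reduct A = b"
    then have "reduct (fin_right n (fin_left n G A) e') = b'"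
      by (simp only: b' reduct_conjugate)
    then show "reducible s A"
      using that reducible_conjugate[OF e comm] unfolding lifts_reducible_def by blast
  qed
  obtain A where A: "reduct A = b" using exists_reduct by blast
  show "\<exists>u. u \<noteq> 0 \<and> (\<forall>\<alpha> \<beta>. pencil_det r n \<alpha> \<beta> b' = [:u:] * pencil_det r n \<alpha> \<beta> b)"
  proof (rule pencil_det_reduct_conjugate[OF e(1) G comm, of A])
    fix u
    assume "u \<noteq> 0" and "\<And>\<alpha> \<beta>. pencil_det r n \<alpha> \<beta> (reduct (fin_right n (fin_left n G A) e')) =
        [:u:] * pencil_det r n \<alpha> \<beta> (reduct A)"
    moreover have "reduct (fin_right n (fin_left n G A) e') = b'"
      by (simp only: b' reduct_conjugate A)
    ultimately show ?thesis unfolding A by blast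
  qed
qed

text \<open>\<open>l\<close> is constant on the level, so the permutation matrix commutes with the
  Hodge diagonal and serves as both \<open>e\<close> and \<open>G\<close>.\<close>

lemma lifts_reducible_swap:
  assumes \<tau>: "\<And>i. \<tau> (\<tau> i) = i" and outside: "\<And>i. \<not> (r \<le> i \<and> i < n) \<Longrightarrow> \<tau> i = i"
    and b': "b' = (\<lambda>i j. b (\<tau> i) (\<tau> j))"
  shows "lifts_reducible b' \<Longrightarrow> lifts_reducible b"
    and "\<exists>u. u \<noteq> 0 \<and> (\<forall>\<alpha> \<beta>. pencil_det r n \<alpha> \<beta> b' = [:u:] * pencil_det r n \<alpha> \<beta> b)"
proof -
  define P :: "'a inf_mat" where "P i j = (if \<tau> i = j then 1 else 0)" for i j
  have \<tau>_in: "r \<le> \<tau> i \<and> \<tau> i < n" if "r \<le> i" "i < n" for i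
    using outside[of "\<tau> i"] \<tau>[of i] that by metis
  have \<tau>_less: "\<tau> i < n \<longleftrightarrow> i < n" for i using \<tau>_in[of i] outside[of i] by (metis not_le)
  have \<tau>_iff: "\<tau> i = j \<longleftrightarrow> i = \<tau> j" for i j using \<tau> by metis
  have "l (\<tau> i) = l i" for i
    using l_eq[of i] l_eq[of "\<tau> i"] \<tau>_in[of i] outside[of i] by (cases "r \<le> i \<and> i < n") auto
  then have comm: "P i k * t ^ l k = t ^ l i * P i k" for i k by (auto simp: P_def)
  have "(\<Sum>k<n. P i k * P k j) = inf_mat_one i j" if "i < n" for i j
  proof -
    have "(\<Sum>k<n. P i k * P k j) = (\<Sum>k<n. if \<tau> i = k then inf_mat_one i j else 0)"
      by (rule sum.cong) (auto simp: P_def inf_mat_one_def \<tau>)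
    then show ?thesis using that \<tau>_less by simp
  qed
  then have inv: "fin_inverse n P P" by (simp add: fin_inverse_def)
  have "fin_right n (fin_left n (reduct P) b) (reduct P) = b'"
  proof (intro ext)
    fix i j
    have left: "fin_left n (reduct P) b i j = b (\<tau> i) j" for i j
    proof -
      have "(\<Sum>k<n. \<rho> (P i k) * b k j) = (\<Sum>k<n. if \<tau> i = k then b k j else 0)"
        by (rule sum.cong) (auto simp: P_def)
      then show ?thesis using \<tau>_less[of i] outside[of i] by (auto simp: fin_left_def)
    qed
    have "(\<Sum>k<n. b (\<tau> i) k * \<rho> (P k j)) = (\<Sum>k<n. if k = \<tau> j then b (\<tau> i) k else 0)"
      by (rule sum.cong) (auto simp: P_def \<tau>_iff)
    then show "fin_right n (fin_left n (reduct P) b) (reduct P) i j = b' i j"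
      using \<tau>_less[of j] outside[of j] by (auto simp: fin_right_def left b')
  qed
  note * = lifts_reducible_conjugate[OF inv inv inv comm this[symmetric]]
  show "lifts_reducible b' \<Longrightarrow> lifts_reducible b" by (rule *(1))
  show "\<exists>u. u \<noteq> 0 \<and> (\<forall>\<alpha> \<beta>. pencil_det r n \<alpha> \<beta> b' = [:u:] * pencil_det r n \<alpha> \<beta> b)" by (rule *(2))
qed

text \<open>\<open>j < i\<close> keeps the twisted matrix in the ring. Row indices in
  \<open>S\<close> and column indices outside \<open>S\<close> make it square to zero, so its
  inverse needs no commutativity.\<close>

lemma lifts_reducible_transvect:
  assumes h: "\<And>i j. h i j \<noteq> 0 \<Longrightarrow> i \<in> S \<and> j \<notin> S \<and> j < i" and S: "S \<subseteq> {r..<n}"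
    and b': "b' = transvect r n h b"
  shows "lifts_reducible b' \<Longrightarrow> lifts_reducible b"
    and "\<exists>u. u \<noteq> 0 \<and> (\<forall>\<alpha> \<beta>. pencil_det r n \<alpha> \<beta> b' = [:u:] * pencil_det r n \<alpha> \<beta> b)"
proof -
  \<comment> \<open>The lift vanishes wherever \<open>h\<close> does, so the products below are zero
    in the ring and not only modulo \<open>J\<close>.\<close>
  have "\<forall>i j. \<exists>x. \<rho> x = h i j \<and> (h i j = 0 \<longrightarrow> x = 0)" using hom_surj hom_0 by metis
  then obtain g where g: "\<And>i j. \<rho> (g i j) = h i j" "\<And>i j. h i j = 0 \<Longrightarrow> g i j = 0" by metis
  define u where "u i j = t ^ (l i - l j) * g i j" for i j
  have gh: "g i j \<noteq> 0 \<Longrightarrow> h i j \<noteq> 0" for i j using g(2) by blast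
  have gg: "g i k * g k j = 0" for i k j using h[OF gh] by (metis mult_zero_left mult_zero_right)
  have uu: "u i k * u k j = 0" for i k j
    using h[OF gh] unfolding u_def by (metis mult_zero_left mult_zero_right)
  note inv = fin_inverse_unipotent[of u n, OF uu]
  have inv': "fin_inverse n (\<lambda>i j. inf_mat_one i j - u i j) (\<lambda>i j. inf_mat_one i j + u i j)"
    using fin_inverse_unipotent[of "\<lambda>i j. - u i j" n] uu by simp
  have comm: "(inf_mat_one i k + u i k) * t ^ l k = t ^ l i * (inf_mat_one i k + g i k)" for i k
  proof (cases "g i k = 0")
    case True
    then show ?thesis by (auto simp: u_def inf_mat_one_def)
  next
    case False
    then have "k < i" using h[OF gh] by blast
    then have "t ^ (l i - l k) * t ^ l k = t ^ l i" using l_mono[of k i] by (simp flip: power_add)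
    then have "u i k * t ^ l k = t ^ l i * g i k"
      unfolding u_def using t_pow_central[of "l k" "g i k"] by (metis mult.assoc)
    then show ?thesis using \<open>k < i\<close> by (simp add: inf_mat_one_def distrib_left distrib_right)
  qed
  have ru: "\<rho> (u i j) = (if r \<le> j then h i j else 0)" for i j
  proof (cases "h i j = 0")
    case True
    then show ?thesis using g by (simp add: u_def)
  next
    case False
    then have i: "r \<le> i" "i < n" "j < i" using h S by force+
    show ?thesis
    proof (cases "r \<le> j")
      case True
      then have "l j = l i" using l_eq i by simp
      then show ?thesis using g True by (simp add: u_def)
    next
      case False
      then have "l j < l i" using l_eq[of i] l_less[of j] i by simp
      then show ?thesis using False t_pow_in_J[of "l i - l j"]
        by (simp add: u_def hom_kernel J_rmult)
    qed
  qed
  have "fin_right n (fin_left n (reduct (\<lambda>i k. inf_mat_one i k + g i k)) b)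
      (reduct (\<lambda>i j. inf_mat_one i j - u i j)) = b'"
  proof (intro ext)
    fix i j
    have one: "\<rho> (inf_mat_one i j) = inf_mat_one i j" for i j by (simp add: inf_mat_one_def)
    define L where "L i j = b i j + (\<Sum>k<n. h i k * b k j)" for i j
    have left: "fin_left n (reduct (\<lambda>i k. inf_mat_one i k + g i k)) b i j = L i j" for i j
    proof (cases "i < n")
      case True
      have "(\<Sum>k<n. \<rho> (inf_mat_one i k + g i k) * b k j) =
        (\<Sum>k<n. if i = k then b k j else 0) + (\<Sum>k<n. h i k * b k j)"
        unfolding sum.distrib[symmetric]
        by (rule sum.cong) (auto simp: inf_mat_one_def hom_add g one algebra_simps)
      then show ?thesis using True by (simp add: fin_left_def L_def)
    next
      case False
      then have "h i k = 0" for k using h[of i k] S by force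
      then show ?thesis using False by (simp add: fin_left_def L_def)
    qed
    show "fin_right n (fin_left n (reduct (\<lambda>i k. inf_mat_one i k + g i k)) b)
      (reduct (\<lambda>i j. inf_mat_one i j - u i j)) i j = b' i j"
    proof (cases "j < n")
      case True
      have "(\<Sum>k<n. L i k * \<rho> (inf_mat_one k j - u k j)) =
        (\<Sum>k<n. if k = j then L i k else 0) - (\<Sum>k<n. L i k * (if r \<le> j then h k j else 0))"
        unfolding sum_subtractf[symmetric]
        by (rule sum.cong) (auto simp: inf_mat_one_def hom_diff ru one algebra_simps)
      then show ?thesis using True
        by (simp add: fin_right_def left b' transvect_def L_def)
    next
      case False
      then have "h k j = 0" for k using h[of k j] S by force
      then show ?thesis using False by (simp add: fin_right_def left b' transvect_def L_def)
    qed
  qed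
  note * = lifts_reducible_conjugate[OF inv inv' fin_inverse_unipotent[of g n, OF gg] comm this[symmetric]]
  show "lifts_reducible b' \<Longrightarrow> lifts_reducible b" by (rule *(1))
  show "\<exists>u. u \<noteq> 0 \<and> (\<forall>\<alpha> \<beta>. pencil_det r n \<alpha> \<beta> b' = [:u:] * pencil_det r n \<alpha> \<beta> b)" by (rule *(2))
qed

lemma lifts_reducible_split:
  assumes inv: "fin_inverse s c b"
    and small: "\<And>k j. s \<le> k \<Longrightarrow> k < n \<Longrightarrow> r \<le> j \<Longrightarrow> j < s \<Longrightarrow> (\<Sum>q<s. b k q * c q j) = 0"
    and triangular: "(\<forall>j q. r \<le> j \<longrightarrow> j \<le> q \<longrightarrow> q < s \<longrightarrow> c q j = 0) \<or>
      (\<forall>i k. s \<le> k \<longrightarrow> k \<le> i \<longrightarrow> i < n \<longrightarrow>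
        b i k - (\<Sum>q<s. (\<Sum>u<s. b i u * c u q) * b q k) = 0)"
  shows "lifts_reducible b"
  unfolding lifts_reducible_def
proof (intro allI impI)
  fix A assume "reduct A = b"
  then have A: "\<rho> (A i j) = b i j" for i j by (simp add: fun_eq_iff)
  obtain c' where "reduct c' = c" using exists_reduct by blast
  then have c: "\<rho> (c' i j) = c i j" for i j by (simp add: fun_eq_iff)
  note hom = hom_sum hom_mult hom_diff A c
  interpret adic_split J t l \<rho> r s n a A c'
  proof unfold_locales
    show "(\<Sum>q<s. c' i q * A q j) - (if i = j then 1 else 0) \<in> J" if "i < s" "j < s" for i j
      unfolding hom_kernel[symmetric] hom using inv that by (simp add: fin_inverse_def inf_mat_one_def)
    show "(\<Sum>q<s. A k q * c' q j) \<in> J" if "s \<le> k" "k < n" "r \<le> j" "j < s" for k j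
      unfolding hom_kernel[symmetric] hom using small that by simp
    show "(\<forall>j q. r \<le> j \<longrightarrow> j \<le> q \<longrightarrow> q < s \<longrightarrow> c' q j \<in> J) \<or>
      (\<forall>i k. s \<le> k \<longrightarrow> k \<le> i \<longrightarrow> i < n \<longrightarrow>
        A i k - (\<Sum>q<s. (\<Sum>u<s. A i u * c' u q) * A q k) \<in> J)"
      using triangular by (simp add: hom_kernel[symmetric] hom)
  qed
  show "reducible s A" by (rule reducible_split)
qed

text \<open>The pencil has the root \<open>0\<close> with multiplicity \<open>n - s\<close>: the rows from \<open>s\<close> on are made
  strictly upper triangular, one at a time from below.\<close>

lemma lifts_reducible_of_low_order:
  assumes "s \<le> k" "k \<le> n"
    and "\<And>i j. k \<le> i \<Longrightarrow> i < n \<Longrightarrow> j \<le> i \<Longrightarrow> b i j = 0"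
    and "\<And>m. m < n - s \<Longrightarrow> Polynomial.coeff (pencil_det r n pX 1 b) m = 0"
    and "Polynomial.coeff (pencil_det r n pX 1 b) (n - s) \<noteq> 0"
  shows "lifts_reducible b"
  using assms
proof (induction k arbitrary: b rule: dec_induct)
  case base
  have "Determinant.det (Matrix.mat s s (\<lambda>(i, j). b i j)) \<noteq> 0"
    using base pencil_det_triangular_coeff[of r s n b] r_less s_le by simp
  then obtain c where c: "fin_inverse s c b" using fin_inverse_exists by blast
  show ?case
  proof (rule lifts_reducible_split[OF c])
    show "(\<Sum>q<s. b k q * c q j) = 0" if "s \<le> k" "k < n" for k j
      by (rule sum.neutral) (use base that in auto)
    have "b i k - (\<Sum>q<s. (\<Sum>u<s. b i u * c u q) * b q k) = 0" if "s \<le> k" "k \<le> i" "i < n" for i k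
    proof -
      have "(\<Sum>u<s. b i u * c u q) = 0" for q
        by (rule sum.neutral) (use base that in auto)
      then show ?thesis using base that by simp
    qed
    then show "(\<forall>j q. r \<le> j \<longrightarrow> j \<le> q \<longrightarrow> q < s \<longrightarrow> c q j = 0) \<or>
      (\<forall>i k. s \<le> k \<longrightarrow> k \<le> i \<longrightarrow> i < n \<longrightarrow>
        b i k - (\<Sum>q<s. (\<Sum>u<s. b i u * c u q) * b q k) = 0)" by blast
  qed
next
  case (step k)
  have kn: "Suc k \<le> n" and rows: "\<And>i j. Suc k \<le> i \<Longrightarrow> i < n \<Longrightarrow> j \<le> i \<Longrightarrow> b i j = 0"
    and low: "\<And>m. m < n - s \<Longrightarrow> Polynomial.coeff (pencil_det r n pX 1 b) m = 0"
    and top: "Polynomial.coeff (pencil_det r n pX 1 b) (n - s) \<noteq> 0"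
    using step.prems by blast+
  have rk: "r \<le> Suc k" using r_less step.hyps by simp
  have "n - Suc k < n - s" using step.hyps kn by simp
  then have zero: "Polynomial.coeff (pencil_det r n pX 1 b) (n - Suc k) = 0" by (rule low)
  have nonzero: "pencil_det r n pX 1 b \<noteq> 0" using top by auto
  obtain c p where p: "r \<le> p" "p < Suc k" "c p \<noteq> 0"
    and c: "\<And>j. j < Suc k \<Longrightarrow> (\<Sum>i<Suc k. c i * b i j) = 0"
    by (rule pencil_det_triangular_kernel[OF rk kn rows zero nonzero]) blast+
  \<comment> \<open>Brings a nonzero level entry of the null vector to position
    \<open>k\<close>.\<close>
  define \<tau> where "\<tau> i = (if i = p then k else if i = k then p else i)" for i :: nat
  have \<tau>\<tau>: "\<tau> (\<tau> i) = i" for i by (simp add: \<tau>_def)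
  have \<tau>_outside: "\<tau> i = i" if "\<not> (r \<le> i \<and> i < n)" for i
    using that p kn r_less step.hyps by (auto simp: \<tau>_def)
  have \<tau>_above: "\<tau> i = i" if "Suc k \<le> i" for i using that p by (auto simp: \<tau>_def)
  have \<tau>_less: "\<tau> i < Suc k \<longleftrightarrow> i < Suc k" for i using p by (auto simp: \<tau>_def)
  define b' where "b' i j = b (\<tau> i) (\<tau> j)" for i j
  define c' where "c' i = c (\<tau> i)" for i
  have c'k: "c' k \<noteq> 0" using p by (simp add: c'_def \<tau>_def)
  have rows': "b' i j = 0" if "Suc k \<le> i" "i < n" "j \<le> i" for i j
  proof -
    have "\<tau> j \<le> i" using that \<tau>_less[of j] \<tau>_above[of j] by (cases "j < Suc k") auto
    then show ?thesis using that \<tau>_above[of i] rows by (simp add: b'_def)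
  qed
  have c': "(\<Sum>i<Suc k. c' i * b' i j) = 0" if "j < Suc k" for j
  proof -
    have "(\<Sum>i<Suc k. c' i * b' i j) = (\<Sum>i<Suc k. c i * b i (\<tau> j))"
      unfolding b'_def c'_def
      by (rule sum.reindex_bij_witness[of _ \<tau> \<tau>]) (use \<tau>\<tau> \<tau>_less in \<open>auto simp del: lessThan_Suc\<close>)
    then show ?thesis using c[of "\<tau> j"] \<tau>_less[of j] that by simp
  qed
  \<comment> \<open>Completes row \<open>k\<close> to the null combination, normalized at
    \<open>k\<close>; this clears its entries up to column \<open>k\<close>.\<close>
  define h where "h i j = (if i = k \<and> j < k then c' j / c' k else 0)" for i j
  define b'' where "b'' = transvect r n h b'"
  have swap: "lifts_reducible b' \<Longrightarrow> lifts_reducible b"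
      "\<exists>u. u \<noteq> 0 \<and> (\<forall>\<alpha> \<beta>. pencil_det r n \<alpha> \<beta> b' = [:u:] * pencil_det r n \<alpha> \<beta> b)"
    using lifts_reducible_swap[of \<tau> b' b] \<tau>\<tau> \<tau>_outside by (auto simp: b'_def[abs_def])
  have trans: "lifts_reducible b'' \<Longrightarrow> lifts_reducible b'"
      "\<exists>u. u \<noteq> 0 \<and> (\<forall>\<alpha> \<beta>. pencil_det r n \<alpha> \<beta> b'' = [:u:] * pencil_det r n \<alpha> \<beta> b')"
    by (rule lifts_reducible_transvect[of h "{k}" b'' b'];
        use r_less step.hyps kn in \<open>auto simp: h_def b''_def split: if_splits\<close>)+
  obtain u u' where u: "u \<noteq> 0" "u' \<noteq> 0"
    "\<And>\<alpha> \<beta>. pencil_det r n \<alpha> \<beta> b'' = [:u:] * ([:u':] * pencil_det r n \<alpha> \<beta> b)"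
    using swap(2) trans(2) by metis
  define L where "L i j = b' i j + (\<Sum>q<n. h i q * b' q j)" for i j
  have L: "L i j = 0" if "k \<le> i" "i < n" "j \<le> i" for i j
  proof (cases "i = k")
    case False
    then show ?thesis using that rows' by (simp add: L_def h_def)
  next
    case True
    have "(\<Sum>q<n. h k q * b' q j) = (\<Sum>q<k. c' q / c' k * b' q j)"
      using kn by (intro sum.mono_neutral_cong_right) (auto simp: h_def)
    also have "\<dots> = (\<Sum>q<k. c' q * b' q j) / c' k"
      by (simp add: sum_divide_distrib)
    also have "(\<Sum>q<k. c' q * b' q j) = - (c' k * b' k j)"
      using c'[of j] True that by (simp add: eq_neg_iff_add_eq_0)
    finally show ?thesis using True c'k by (simp add: L_def)
  qed
  have "b'' i j = 0" if "k \<le> i" "i < n" "j \<le> i" for i j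
  proof -
    \<comment> \<open>The right factor contributes only multiples of column \<open>k\<close> of
      \<open>L\<close>, which is already zero in the rows from \<open>k\<close> on.\<close>
    have "(\<Sum>m<n. L i m * h m j) = 0"
      by (rule sum.neutral) (use L that in \<open>auto simp: h_def\<close>)
    then show ?thesis using L[OF that] by (simp add: b''_def transvect_def L_def)
  qed
  moreover have "Polynomial.coeff (pencil_det r n pX 1 b'') m = 0 \<longleftrightarrow>
      Polynomial.coeff (pencil_det r n pX 1 b) m = 0" for m
    using u by simp
  ultimately have "lifts_reducible b''" using step.IH[of b''] kn low top by simp
  then show ?case using swap(1) trans(1) by blast
qed

text \<open>The pencil has the root \<open>\<infinity>\<close> with multiplicity \<open>s\<close>: the unit vectors from \<open>r\<close> to \<open>s\<close> are
  made to be images of vectors supported on strictly smaller indices.\<close>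

lemma lifts_reducible_of_high_order:
  assumes "k \<le> s" "r \<le> k"
    and "\<And>i q. r \<le> i \<Longrightarrow> i < k \<Longrightarrow> i \<le> q \<Longrightarrow> v i q = 0"
    and "\<And>i j. r \<le> i \<Longrightarrow> i < k \<Longrightarrow> j < n \<Longrightarrow> (\<Sum>q<n. b j q * v i q) = inf_mat_one j i"
    and "\<And>m. m < s \<Longrightarrow> Polynomial.coeff (pencil_det r n 1 pX b) m = 0"
    and "Polynomial.coeff (pencil_det r n 1 pX b) s \<noteq> 0"
  shows "lifts_reducible b"
  using assms
proof (induction k arbitrary: b v rule: inc_induct)
  case base
  note v0 = base.prems(2) and v = base.prems(3)
  have nonzero: "Determinant.det (Matrix.mat n n (\<lambda>(i, j). if j < s then b i j else inf_mat_one i j)) \<noteq> 0"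
    using pencil_det_chain_coeff[OF _ s_le v0 v] base r_less by simp
  have "Determinant.det (Matrix.mat s s (\<lambda>(i, j). b i j)) \<noteq> 0"
  proof
    assume "Determinant.det (Matrix.mat s s (\<lambda>(i, j). b i j)) = 0"
    then obtain w p where w: "p < s" "w p \<noteq> 0" "\<And>i. i < s \<Longrightarrow> (\<Sum>j<s. b i j * w j) = 0"
      unfolding det_mat_0_iff by blast
    \<comment> \<open>The unit columns from \<open>s\<close> on absorb the image of \<open>w\<close>
      in the remaining rows.\<close>
    define w' where "w' j = (if j < s then w j else - (\<Sum>q<s. b j q * w q))" for j
    have "(\<Sum>j<n. (if j < s then b i j else inf_mat_one i j) * w' j) = 0" if "i < n" for i
    proof -
      have "(\<Sum>j<n. (if j < s then b i j else inf_mat_one i j) * w' j) =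
        (\<Sum>j<n. if j < s then b i j * w j else 0) + (\<Sum>j<n. if i = j then if s \<le> j then w' j else 0 else 0)"
        unfolding sum.distrib[symmetric] by (rule sum.cong) (auto simp: inf_mat_one_def w'_def)
      also have "(\<Sum>j<n. if j < s then b i j * w j else 0) = (\<Sum>j<s. b i j * w j)"
        using s_le by (intro sum.mono_neutral_cong_right) auto
      finally show ?thesis using w(3)[of i] that by (cases "s \<le> i") (auto simp: w'_def)
    qed
    then show False using nonzero w(1,2) s_le unfolding det_mat_0_iff
      by (metis order_less_le_trans w'_def)
  qed
  then obtain c where c: "fin_inverse s c b" "fin_inverse s b c" using fin_inverse_exists by blast
  \<comment> \<open>The leading block sends \<open>v j\<close> to a unit vector, so
    \<open>v j\<close> is column \<open>j\<close> of its inverse. Its support gives the first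
    alternative of \<open>triangular\<close>.\<close>
  have cv: "c q j = v j q" if "r \<le> j" "j < s" "q < s" for q j
  proof -
    have *: "(\<Sum>q<s. b i q * v j q) = inf_mat_one i j" if "i < s" for i
    proof -
      have "(\<Sum>q<n. b i q * v j q) = (\<Sum>q<s. b i q * v j q)"
        using s_le \<open>r \<le> j\<close> \<open>j < s\<close> v0 by (intro sum.mono_neutral_right) auto
      then show ?thesis using v[of j i] that \<open>r \<le> j\<close> \<open>j < s\<close> s_le by simp
    qed
    have "v j q = (\<Sum>m<s. inf_mat_one q m * v j m)"
      using that by (simp add: inf_mat_one_def if_distrib[of "\<lambda>x. x * _"] cong: if_cong)
    also have "\<dots> = (\<Sum>m<s. (\<Sum>i<s. c q i * b i m) * v j m)"
      using c(1) that by (intro sum.cong) (auto simp: fin_inverse_def)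
    also have "\<dots> = (\<Sum>i<s. c q i * (\<Sum>m<s. b i m * v j m))"
      unfolding sum_distrib_left sum_distrib_right by (subst sum.swap) (simp add: mult.assoc)
    also have "\<dots> = (\<Sum>i<s. if i = j then c q i else 0)"
      by (intro sum.cong) (auto simp: * inf_mat_one_def)
    finally show ?thesis using that by simp
  qed
  show ?case
  proof (rule lifts_reducible_split[OF c(1)])
    show "(\<Sum>q<s. b k q * c q j) = 0" if "s \<le> k" "k < n" "r \<le> j" "j < s" for k j
    proof -
      have "(\<Sum>q<s. b k q * c q j) = (\<Sum>q<n. b k q * v j q)"
        using s_le that v0 by (intro sum.mono_neutral_cong_left) (auto simp: cv)
      then show ?thesis using v[of j k] that by (simp add: inf_mat_one_def)
    qed
    show "(\<forall>j q. r \<le> j \<longrightarrow> j \<le> q \<longrightarrow> q < s \<longrightarrow> c q j = 0) \<or>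
      (\<forall>i k. s \<le> k \<longrightarrow> k \<le> i \<longrightarrow> i < n \<longrightarrow>
        b i k - (\<Sum>q<s. (\<Sum>u<s. b i u * c u q) * b q k) = 0)"
      using cv v0 by (metis le_less_trans)
  qed
next
  case (step k)
  note v0 = step.prems(2) and v = step.prems(3) and low = step.prems(4) and top = step.prems(5)
  have rk: "r \<le> k" by (rule step.prems)
  have kn: "k < n" using step.hyps s_le by simp
  have nonzero: "pencil_det r n 1 pX b \<noteq> 0" using top by auto
  obtain c p where p: "k \<le> p" "p < n" "(\<Sum>q<k. b p q * c q) \<noteq> 0"
    and c: "\<And>i. i < k \<Longrightarrow> (\<Sum>q<k. b i q * c q) = 0"
    by (rule pencil_det_chain_kernel[OF rk less_imp_le[OF kn] v0 v low[OF step.hyps(2)] nonzero]) blast+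
  define \<tau> where "\<tau> i = (if i = p then k else if i = k then p else i)" for i :: nat
  have \<tau>\<tau>: "\<tau> (\<tau> i) = i" for i by (simp add: \<tau>_def)
  have \<tau>_outside: "\<tau> i = i" if "\<not> (r \<le> i \<and> i < n)" for i
    using that p kn rk by (auto simp: \<tau>_def)
  have \<tau>_below: "\<tau> i = i" if "i < k" for i using that p by (auto simp: \<tau>_def)
  have \<tau>_less: "\<tau> i < n" if "i < n" for i using that p kn by (auto simp: \<tau>_def)
  have \<tau>_less_k: "\<tau> i < k \<longleftrightarrow> i < k" for i using p by (auto simp: \<tau>_def)
  define b' where "b' i j = b (\<tau> i) (\<tau> j)" for i j
  have restrict: "(\<Sum>q<n. f q * w q) = (\<Sum>q<k. f q * w q)"
    if "\<And>q. k \<le> q \<Longrightarrow> w q = 0" for f w :: "nat \<Rightarrow> 'b"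
    using that kn by (intro sum.mono_neutral_right) auto
  have b'_sum: "(\<Sum>q<k. b' i q * w q) = (\<Sum>q<k. b (\<tau> i) q * w q)" for i w
    by (rule sum.cong) (auto simp: b'_def \<tau>_below)
  define y where "y i = (\<Sum>q<k. b' i q * c q)" for i
  have y0: "y i = 0" if "i < k" for i using c that by (simp add: y_def b'_sum \<tau>_below)
  have "\<tau> k = p" by (simp add: \<tau>_def)
  then have yk: "y k \<noteq> 0" using p by (simp add: y_def b'_sum)
  \<comment> \<open>Leaves only position \<open>k\<close> of the image \<open>y\<close>. The earlier
    images are unit vectors \<open>i < k\<close> with entry 0 at \<open>k\<close>, so they do not
    change.\<close>
  define h where "h i j = (if j = k \<and> k < i \<and> i < n then - y i / y k else 0)" for i j
  define b'' where "b'' = transvect r n h b'"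
  define v'' where "v'' i q = (if i = k then if q < k then c q / y k else 0 else v i q)" for i q
  have swap: "lifts_reducible b' \<Longrightarrow> lifts_reducible b"
      "\<exists>u. u \<noteq> 0 \<and> (\<forall>\<alpha> \<beta>. pencil_det r n \<alpha> \<beta> b' = [:u:] * pencil_det r n \<alpha> \<beta> b)"
    using lifts_reducible_swap[of \<tau> b' b] \<tau>\<tau> \<tau>_outside by (auto simp: b'_def[abs_def])
  have trans: "lifts_reducible b'' \<Longrightarrow> lifts_reducible b'"
      "\<exists>u. u \<noteq> 0 \<and> (\<forall>\<alpha> \<beta>. pencil_det r n \<alpha> \<beta> b'' = [:u:] * pencil_det r n \<alpha> \<beta> b')"
    by (rule lifts_reducible_transvect[of h "{k<..<n}" b'' b'];
        use rk in \<open>auto simp: h_def b''_def split: if_splits\<close>)+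
  obtain u u' where u: "u \<noteq> 0" "u' \<noteq> 0"
    "\<And>\<alpha> \<beta>. pencil_det r n \<alpha> \<beta> b'' = [:u:] * ([:u':] * pencil_det r n \<alpha> \<beta> b)"
    using swap(2) trans(2) by metis
  \<comment> \<open>The right factor of the transvection touches only column \<open>k\<close>, which
    no vector of the chain up to \<open>k\<close> involves.\<close>
  have b'': "b'' i q = b' i q + h i k * b' k q" if "q < k" for i q
  proof -
    have "(\<Sum>m<n. h i m * b' m q) = (\<Sum>m<n. if m = k then h i k * b' k q else 0)"
      by (rule sum.cong) (auto simp: h_def)
    then show ?thesis using that kn by (simp add: b''_def transvect_def h_def)
  qed
  have b''_sum: "(\<Sum>q<n. b'' i q * w q) = (\<Sum>q<k. b' i q * w q) + h i k * (\<Sum>q<k. b' k q * w q)"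
    if "\<And>q. k \<le> q \<Longrightarrow> w q = 0" for i w
  proof -
    have "(\<Sum>q<n. b'' i q * w q) = (\<Sum>q<k. (b' i q + h i k * b' k q) * w q)"
      using restrict[of w "b'' i"] that by (simp add: b'')
    then show ?thesis by (simp add: distrib_right sum.distrib sum_distrib_left mult.assoc)
  qed
  have "v'' i q = 0" if "r \<le> i" "i < Suc k" "i \<le> q" for i q
    using v0[of i q] that by (auto simp: v''_def)
  moreover have "(\<Sum>q<n. b'' j q * v'' i q) = inf_mat_one j i" if "r \<le> i" "i < Suc k" "j < n" for i j
  proof (cases "i = k")
    case True
    have "(\<Sum>q<k. b' m q * v'' k q) = y m / y k" for m
      by (simp add: v''_def y_def sum_divide_distrib)
    then have "(\<Sum>q<n. b'' j q * v'' i q) = y j / y k + h j k"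
      using b''_sum[of "v'' k" j] True yk by (simp add: v''_def)
    then show ?thesis using True y0[of j] yk that by (auto simp: h_def inf_mat_one_def)
  next
    case False
    then have i: "i < k" "v'' i = v i" using that by (auto simp: v''_def fun_eq_iff)
    have zero: "v i q = 0" if "k \<le> q" for q using v0[of i q] that i \<open>r \<le> i\<close> by simp
    have *: "(\<Sum>q<k. b' m q * v i q) = inf_mat_one m i" if "m < n" for m
    proof -
      have "(\<Sum>q<k. b' m q * v i q) = (\<Sum>q<n. b (\<tau> m) q * v i q)"
        by (simp add: b'_sum restrict[OF zero])
      also have "\<dots> = inf_mat_one (\<tau> m) i" using v[of i "\<tau> m"] i that \<open>r \<le> i\<close> \<tau>_less by simp
      also have "\<dots> = inf_mat_one m i"
        using \<tau>_below[of m] \<tau>_less_k[of m] i by (cases "m < k") (auto simp: inf_mat_one_def)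
      finally show ?thesis .
    qed
    show ?thesis
      using b''_sum[of "v i" j, OF zero] *[OF that(3)] *[OF kn] i by (simp add: inf_mat_one_def)
  qed
  moreover have "Polynomial.coeff (pencil_det r n 1 pX b'') m = 0 \<longleftrightarrow>
      Polynomial.coeff (pencil_det r n 1 pX b) m = 0" for m
    using u by simp
  ultimately have "lifts_reducible b''" using step.IH[of v'' b''] rk low top by simp
  then show ?case using swap(1) trans(1) by blast
qed

end

section \<open>The Newton function\<close>

lemma perm_det_const_poly: "perm_det I (\<lambda>i j. [:b i j:]) = [:perm_det I b:]"
proof -
  have prod: "(\<Prod>i\<in>I. [:f i:]) = [:\<Prod>i\<in>I. f i:]" for f :: "nat \<Rightarrow> 'a"
    by (induction I rule: infinite_finite_induct) (auto simp: one_pCons const_poly_mult mult.commute)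
  have "signof p * [:x:] = [:signof p * x:]" for p :: "nat \<Rightarrow> nat" and x :: 'a
    by (cases p rule: sign_cases) simp_all
  then show ?thesis by (simp add: perm_det_def prod sum_const_poly)
qed

lemma perm_det_nth_0: "fps_nth (perm_det I B) 0 = perm_det I (\<lambda>i j. fps_nth (B i j) 0)"
proof -
  have prod: "fps_nth (\<Prod>i\<in>I. f i) 0 = (\<Prod>i\<in>I. fps_nth (f i) 0)" for f :: "nat \<Rightarrow> 'a fps"
    by (induction I rule: infinite_finite_induct) auto
  have "fps_nth (signof p * f) 0 = signof p * fps_nth f 0" for p :: "nat \<Rightarrow> nat" and f :: "'a fps"
    by (cases p rule: sign_cases) simp_all
  then show ?thesis by (simp add: perm_det_def prod fps_sum_nth)
qed

lemma perm_det_row_scale: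
  "perm_det I (\<lambda>i j. x ^ l i * B i j) = x ^ (\<Sum>i\<in>I. l i) * perm_det I B"
  unfolding perm_det_def sum_distrib_left
  by (rule sum.cong) (simp_all add: prod.distrib power_sum mult.left_commute)

lemma pencil_det_expand:
  "pencil_det r n \<alpha> \<beta> b =
    (\<Sum>K\<in>Pow {r..<n}. \<alpha> ^ card K * \<beta> ^ (n - card K) * [:perm_det ({..<n} - K) b:])"
  unfolding pencil_det_def pencil_def det_mat_eq_perm_det perm_det_diagonal_plus perm_det_const_poly ..

lemma coeff_pX_power_mult_const: "Polynomial.coeff (pX ^ c * [:x:]) m = (if c = m then x else 0)"
proof -
  have "pX ^ c * [:x:] = Polynomial.smult x (Polynomial.monom 1 c)"
    by (simp add: monom_power)
  then show ?thesis by simp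
qed

context adic_level
begin

text \<open>The sum of the principal minors of size \<open>k\<close> with the least possible \<open>l\<close>-weight.\<close>

definition level_sum :: "(nat \<Rightarrow> nat \<Rightarrow> 'b) \<Rightarrow> nat \<Rightarrow> 'b" where
  "level_sum b k = (\<Sum>K | K \<subseteq> {r..<n} \<and> n - card K = k. perm_det ({..<n} - K) b)"

lemma card_level_subset: "K \<subseteq> {r..<n} \<Longrightarrow> card K \<le> n - r"
  using card_mono[of "{r..<n}" K] by simp

lemma r_le_n: "r \<le> n"
  using r_less s_le by simp

text \<open>A term with \<open>m\<close> rows taken from \<open>E\<close> leaves a principal minor
  of size \<open>n - m\<close>, so the low coefficients are here the sums of large minors.\<close>

lemma coeff_pencil_det_low:
  "Polynomial.coeff (pencil_det r n pX 1 b) m = (if m \<le> n then level_sum b (n - m) else 0)"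
proof -
  have "Polynomial.coeff (pencil_det r n pX 1 b) m =
    (\<Sum>K\<in>Pow {r..<n}. if card K = m then perm_det ({..<n} - K) b else 0)"
    unfolding pencil_det_expand coeff_sum
    by (rule sum.cong) (simp_all only: power_one mult_1_left mult_1_right coeff_pX_power_mult_const)
  also have "\<dots> = (\<Sum>K | K \<subseteq> {r..<n} \<and> card K = m. perm_det ({..<n} - K) b)"
    by (intro sum.mono_neutral_cong_right) auto
  also have "\<dots> = (if m \<le> n then level_sum b (n - m) else 0)"
  proof (cases "m \<le> n")
    case True
    have "card K = m \<longleftrightarrow> n - card K = n - m" if "K \<subseteq> {r..<n}" for K
      using card_level_subset[OF that] True r_le_n by auto
    then have "{K. K \<subseteq> {r..<n} \<and> card K = m} = {K. K \<subseteq> {r..<n} \<and> n - card K = n - m}" by blast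
    then show ?thesis using True by (simp add: level_sum_def)
  next
    case False
    moreover have "card K \<le> n" if "K \<subseteq> {r..<n}" for K
      using card_level_subset[OF that] by linarith
    ultimately have "{K. K \<subseteq> {r..<n} \<and> card K = m} = {}" by force
    then show ?thesis using False by (simp only: sum.empty if_False)
  qed
  finally show ?thesis .
qed

lemma coeff_pencil_det_high: "Polynomial.coeff (pencil_det r n 1 pX b) m = level_sum b m"
proof -
  have "Polynomial.coeff (pencil_det r n 1 pX b) m =
    (\<Sum>K\<in>Pow {r..<n}. if n - card K = m then perm_det ({..<n} - K) b else 0)"
    unfolding pencil_det_expand coeff_sum
    by (rule sum.cong) (simp_all only: power_one mult_1_left mult_1_right coeff_pX_power_mult_const)
  also have "\<dots> = level_sum b m"
    unfolding level_sum_def by (intro sum.mono_neutral_cong_right) auto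
  finally show ?thesis .
qed

lemma level_sum_below:
  assumes "k < r" shows "level_sum b k = 0"
proof -
  have "n - card K \<noteq> k" if "K \<subseteq> {r..<n}" for K
    using card_level_subset[OF that] r_le_n assms by linarith
  then have "{K. K \<subseteq> {r..<n} \<and> n - card K = k} = {}" by blast
  then show ?thesis unfolding level_sum_def by (simp only: sum.empty)
qed

text \<open>Subtracting \<open>a\<close> from every weight does not affect the comparison, as the
  cardinalities agree. The shifted weight is negative before \<open>r\<close>, zero on the level and
  positive from \<open>n\<close> on, so minimal sets contain all of the first range and none of the
  last.\<close>

lemma weight_ge:
  assumes I: "finite I" and k: "card I = k" "r \<le> k" "k \<le> n"
  shows "(\<Sum>i<k. l i) \<le> (\<Sum>i\<in>I. l i)"
    and "(\<Sum>i\<in>I. l i) = (\<Sum>i<k. l i) \<longleftrightarrow> {..<r} \<subseteq> I \<and> I \<subseteq> {..<n}"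
proof -
  define w where "w i = int (l i) - int a" for i
  have neg: "w i < 0" if "i < r" for i using l_less[OF that] by (simp add: w_def)
  have zero: "w i = 0" if "r \<le> i" "i < n" for i using l_eq[OF that] by (simp add: w_def)
  have pos: "w i > 0" if "n \<le> i" for i using l_greater[OF that] by (simp add: w_def)
  have sum_w: "(\<Sum>i\<in>A. w i) = int (\<Sum>i\<in>A. l i) - int (card A) * int a" for A
    by (simp add: w_def sum_subtractf)
  have "(\<Sum>i<k. w i) = (\<Sum>i<r. w i)"
    using k zero by (intro sum.mono_neutral_right) auto
  also have "\<dots> = (\<Sum>i\<in>{..<r} \<inter> I. w i) + (\<Sum>i\<in>{..<r} - I. w i)"
    by (rule sum.Int_Diff) simp
  finally have 1: "(\<Sum>i<k. w i) = (\<Sum>i\<in>{..<r} \<inter> I. w i) + (\<Sum>i\<in>{..<r} - I. w i)" .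
  have "(\<Sum>i\<in>I. w i) = (\<Sum>i\<in>I \<inter> {..<n}. w i) + (\<Sum>i\<in>I - {..<n}. w i)"
    by (rule sum.Int_Diff) (rule I)
  also have "(\<Sum>i\<in>I \<inter> {..<n}. w i) = (\<Sum>i\<in>{..<r} \<inter> I. w i)"
    using I r_le_n zero by (intro sum.mono_neutral_right) (auto, metis not_less)
  finally have 2: "(\<Sum>i\<in>I. w i) = (\<Sum>i\<in>{..<r} \<inter> I. w i) + (\<Sum>i\<in>I - {..<n}. w i)" .
  have le1: "(\<Sum>i\<in>{..<r} - I. w i) \<le> 0" using neg by (intro sum_nonpos) (auto intro: less_imp_le)
  have le2: "0 \<le> (\<Sum>i\<in>I - {..<n}. w i)" using pos by (intro sum_nonneg) (auto intro: less_imp_le)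
  have diff: "int (\<Sum>i\<in>I. l i) - int (\<Sum>i<k. l i) =
      (\<Sum>i\<in>I - {..<n}. w i) - (\<Sum>i\<in>{..<r} - I. w i)"
    using sum_w[of I] sum_w[of "{..<k}"] 1 2 k by simp
  then show "(\<Sum>i<k. l i) \<le> (\<Sum>i\<in>I. l i)" using le1 le2 by linarith
  have eq1: "(\<Sum>i\<in>{..<r} - I. w i) = 0 \<longleftrightarrow> {..<r} \<subseteq> I"
  proof
    assume 0: "(\<Sum>i\<in>{..<r} - I. w i) = 0"
    have "w i = 0" if "i \<in> {..<r} - I" for i
    proof -
      have "(\<Sum>i\<in>{..<r} - I. - w i) = 0" using 0 by (simp add: sum_negf)
      then have "- w i = 0"
        by (subst (asm) sum_nonneg_eq_0_iff) (use that neg in \<open>auto intro: less_imp_le\<close>)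
      then show ?thesis by simp
    qed
    then show "{..<r} \<subseteq> I" using neg by force
  qed (simp add: Diff_eq_empty_iff[THEN iffD2])
  have eq2: "(\<Sum>i\<in>I - {..<n}. w i) = 0 \<longleftrightarrow> I \<subseteq> {..<n}"
  proof
    assume 0: "(\<Sum>i\<in>I - {..<n}. w i) = 0"
    have "w i = 0" if "i \<in> I - {..<n}" for i
      using 0 that pos I by (subst (asm) sum_nonneg_eq_0_iff) (auto intro: less_imp_le)
    then show "I \<subseteq> {..<n}" using pos by (metis DiffI less_irrefl not_less lessThan_iff subsetI)
  qed (simp add: Diff_eq_empty_iff[THEN iffD2])
  show "(\<Sum>i\<in>I. l i) = (\<Sum>i<k. l i) \<longleftrightarrow> {..<r} \<subseteq> I \<and> I \<subseteq> {..<n}"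
    using diff le1 le2 eq1 eq2 by linarith
qed

lemma finite_bounded_weight: "finite {I \<in> index_sets k. (\<Sum>i\<in>I. l i) \<le> N}"
proof -
  obtain K where K: "\<And>i. K \<le> i \<Longrightarrow> N < l i"
    using l_at_top unfolding filterlim_at_top eventually_sequentially by (metis Suc_le_eq)
  have "I \<subseteq> {..<K}" if I: "finite I" "(\<Sum>i\<in>I. l i) \<le> N" for I
  proof
    fix i assume "i \<in> I"
    then have "l i \<le> N" using member_le_sum[of i I l] I by simp
    then show "i \<in> {..<K}" using K[of i] by (cases "K \<le> i") auto
  qed
  then have "{I \<in> index_sets k. (\<Sum>i\<in>I. l i) \<le> N} \<subseteq> Pow {..<K}"
    by (auto simp: index_sets_def)
  then show ?thesis by (rule finite_subset) simp
qed

text \<open>Scaling the rows gives each principal minor its weight as a power of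
  \<open>fps_X\<close>. At the least weight only the sets between \<open>{..<r}\<close> and
  \<open>{..<n}\<close> contribute, each by the minor of the constant terms; their complements in
  \<open>{..<n}\<close> are the sets \<open>K\<close> of \<open>level_sum\<close>.\<close>

lemma newton_fun_level:
  fixes B :: "nat \<Rightarrow> nat \<Rightarrow> 'b fps"
  assumes M: "\<And>i j. M i j = fps_X ^ l i * B i j" and k: "r \<le> k" "k \<le> n"
  shows "newton_fun M k = enat (\<Sum>i<k. l i) \<longleftrightarrow> level_sum (\<lambda>i j. fps_nth (B i j) 0) k \<noteq> 0"
proof -
  let ?b = "\<lambda>i j. fps_nth (B i j) 0" and ?w = "\<lambda>I. \<Sum>i\<in>I. l i"
  let ?A = "\<lambda>m. {I \<in> index_sets k. ?w I \<le> m}"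
  have minor: "minor M I I = fps_X ^ ?w I * perm_det I B" if "I \<in> index_sets k" for I
  proof -
    have "M = (\<lambda>i j. fps_X ^ l i * B i j)" using M by (intro ext)
    then show ?thesis using that perm_det_row_scale[of I fps_X l B]
      by (simp add: index_sets_def minor_eq_perm_det)
  qed
  \<comment> \<open>Coefficient \<open>m\<close> involves only the finitely many sets of weight at
    most \<open>m\<close>; this yields both convergence and the value of the infinite sum.\<close>
  define S where "S = Abs_fps (\<lambda>m. \<Sum>I\<in>?A m. fps_nth (minor M I I) m)"
  have "((\<lambda>I. minor M I I) has_sum S) (index_sets k)"
    unfolding has_sum_def
  proof (rule tendsto_fpsI)
    fix m
    have "fps_nth (\<Sum>I\<in>Y. minor M I I) m = fps_nth S m"
      if "finite Y" "?A m \<subseteq> Y" "Y \<subseteq> index_sets k" for Y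
    proof -
      have "(\<Sum>I\<in>Y. fps_nth (minor M I I) m) = (\<Sum>I\<in>?A m. fps_nth (minor M I I) m)"
      proof (rule sum.mono_neutral_right)
        show "\<forall>I\<in>Y - ?A m. fps_nth (minor M I I) m = 0"
        proof
          fix I assume "I \<in> Y - ?A m"
          then have "I \<in> index_sets k" "m < ?w I" using that(3) by auto
          then show "fps_nth (minor M I I) m = 0"
            using minor[of I] by (simp add: fps_X_power_mult_nth)
        qed
      qed (use that in auto)
      then show ?thesis by (simp add: S_def fps_sum_nth)
    qed
    then show "\<forall>\<^sub>F Y in finite_subsets_at_top (index_sets k).
        fps_nth (\<Sum>I\<in>Y. minor M I I) m = fps_nth S m"
      unfolding eventually_finite_subsets_at_top
      using finite_bounded_weight by (intro exI[of _ "?A m"]) auto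
  qed
  then have newton: "newton_fun M k = fps_val S"
    unfolding newton_fun_def by (simp add: infsumI)
  define W where "W = (\<Sum>i<k. l i)"
  have w: "W \<le> ?w I" "?w I = W \<longleftrightarrow> {..<r} \<subseteq> I \<and> I \<subseteq> {..<n}" if "I \<in> index_sets k" for I
    using weight_ge[of I k] that k by (auto simp: index_sets_def W_def)
  have below: "fps_nth S m = 0" if "m < W" for m
  proof -
    have "?A m = {}" using w that by fastforce
    then show ?thesis by (simp only: S_def fps_nth_Abs_fps sum.empty)
  qed
  have "fps_nth S W = (\<Sum>I\<in>?A W. perm_det I ?b)"
    unfolding S_def fps_nth_Abs_fps
  proof (rule sum.cong[OF refl])
    fix I assume I: "I \<in> ?A W"
    then have "?w I = W" using w by fastforce
    then show "fps_nth (minor M I I) W = perm_det I ?b"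
      using I minor[of I] by (simp add: fps_X_power_mult_nth perm_det_nth_0)
  qed
  also have "?A W = {I. {..<r} \<subseteq> I \<and> I \<subseteq> {..<n} \<and> card I = k}"
  proof (intro equalityI subsetI)
    fix I assume "I \<in> ?A W"
    then have I: "I \<in> index_sets k" "?w I = W" using w(1)[of I] by auto
    then show "I \<in> {I. {..<r} \<subseteq> I \<and> I \<subseteq> {..<n} \<and> card I = k}"
      using w(2)[OF I(1)] by (simp add: index_sets_def)
  next
    fix I assume "I \<in> {I. {..<r} \<subseteq> I \<and> I \<subseteq> {..<n} \<and> card I = k}"
    then have I: "{..<r} \<subseteq> I" "I \<subseteq> {..<n}" "card I = k" by auto
    then have "I \<in> index_sets k" using finite_subset[OF I(2)] by (simp add: index_sets_def)
    then show "I \<in> ?A W" using w(2)[of I] I by simp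
  qed
  also have "(\<Sum>I | {..<r} \<subseteq> I \<and> I \<subseteq> {..<n} \<and> card I = k. perm_det I ?b) = level_sum ?b k"
    unfolding level_sum_def
  proof (rule sum.reindex_bij_witness[of _ "\<lambda>K. {..<n} - K" "\<lambda>I. {..<n} - I"])
    fix I assume "I \<in> {I. {..<r} \<subseteq> I \<and> I \<subseteq> {..<n} \<and> card I = k}"
    then have I: "{..<r} \<subseteq> I" "I \<subseteq> {..<n}" "card I = k" by auto
    show "{..<n} - ({..<n} - I) = I" using I by auto
    then show "perm_det ({..<n} - ({..<n} - I)) ?b = perm_det I ?b" by simp
    have "card ({..<n} - I) = n - k"
      using I finite_subset[OF I(2)] by (simp add: card_Diff_subset)
    moreover have "{..<n} - I \<subseteq> {r..<n}" using I(1) by (auto simp: not_less[symmetric])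
    ultimately show "{..<n} - I \<in> {K. K \<subseteq> {r..<n} \<and> n - card K = k}" using k by simp
  next
    fix K assume "K \<in> {K. K \<subseteq> {r..<n} \<and> n - card K = k}"
    then have K: "K \<subseteq> {r..<n}" "n - card K = k" by auto
    have Kn: "K \<subseteq> {..<n}" using K by auto
    then show "{..<n} - ({..<n} - K) = K" by auto
    show "{..<n} - K \<in> {I. {..<r} \<subseteq> I \<and> I \<subseteq> {..<n} \<and> card I = k}"
      using K r_le_n finite_subset[OF Kn] by (auto simp: card_Diff_subset Kn)
  qed
  finally have at: "fps_nth S W = level_sum ?b k" .
  have "fps_val S = enat W \<longleftrightarrow> fps_nth S W \<noteq> 0"
  proof
    assume "fps_val S = enat W"
    then have "S \<noteq> 0" "subdegree S = W" by (auto simp: fps_val_def split: if_splits)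
    then show "fps_nth S W \<noteq> 0" using nth_subdegree_nonzero by blast
  next
    assume nz: "fps_nth S W \<noteq> 0"
    then have "S \<noteq> 0" by auto
    moreover have "subdegree S = W" by (rule subdegreeI) (use nz below in auto)
    ultimately show "fps_val S = enat W" by (simp add: fps_val_def)
  qed
  then show ?thesis by (simp add: newton at[unfolded W_def] W_def)
qed

lemma weight_level: "r \<le> k \<Longrightarrow> k \<le> n \<Longrightarrow> (\<Sum>i<k. l i) = (\<Sum>i<r. l i) + (k - r) * a"
proof -
  assume k: "r \<le> k" "k \<le> n"
  have "(\<Sum>i<k. l i) = (\<Sum>i<r. l i) + (\<Sum>i=r..<k. l i)"
    using sum.atLeastLessThan_concat[of 0 r k l] k by (simp add: atLeast0LessThan)
  also have "(\<Sum>i=r..<k. l i) = (\<Sum>i=r..<k. a)" using k l_eq by (intro sum.cong) auto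
  finally show ?thesis by simp
qed

lemma reducible_of_vertex:
  fixes B :: "nat \<Rightarrow> nat \<Rightarrow> 'b fps"
  assumes M: "\<And>i j. M i j = fps_X ^ l i * B i j" and A: "\<And>i j. \<rho> (A i j) = fps_nth (B i j) 0"
    and newton: "newton_fun M s = enat (\<Sum>i<s. l i)"
    and extreme: "(real s, real (\<Sum>i<s. l i)) extreme_point_of newton_region M"
  shows "reducible s A"
proof -
  define b where "b i j = fps_nth (B i j) 0" for i j
  have level: "newton_fun M k = enat (\<Sum>i<k. l i) \<longleftrightarrow> level_sum b k \<noteq> 0" if "r \<le> k" "k \<le> n" for k
    unfolding b_def using newton_fun_level[OF M that] .
  have s: "level_sum b s \<noteq> 0" using level[of s] newton r_less s_le by simp
  have "(\<forall>k. r \<le> k \<longrightarrow> k < s \<longrightarrow> level_sum b k = 0) \<or> (\<forall>k. s < k \<longrightarrow> k \<le> n \<longrightarrow> level_sum b k = 0)"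
  proof (rule ccontr)
    assume "\<not> ?thesis"
    then obtain k k' where k: "r \<le> k" "k < s" "level_sum b k \<noteq> 0"
      and k': "s < k'" "k' \<le> n" "level_sum b k' \<noteq> 0" by blast
    define pt where "pt k = (real k, real (\<Sum>i<k. l i))" for k
    have pt_in: "pt k \<in> newton_region M" if "r \<le> k" "k \<le> n" "level_sum b k \<noteq> 0" for k
      unfolding newton_region_def pt_def
      by (rule hull_inc) (use level[OF that(1,2)] that(3) in auto)
    \<comment> \<open>The barycentric coordinate of \<open>s\<close> between \<open>k\<close> and
      \<open>k'\<close>. The ordinates match too, because the partial sums of \<open>l\<close> are
      affine from \<open>r\<close> to \<open>n\<close>.\<close>
    define u where "u = (real s - real k) / (real k' - real k)"
    have u: "0 < u" "u < 1" "u * (real k' - real k) = real s - real k"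
      using k k' by (simp_all add: u_def)
    have us: "real s = (1 - u) * real k + u * real k'"
      using u(3) by (simp add: algebra_simps)
    have pt_eq: "pt q = (real q, real (\<Sum>i<r. l i) + (real q - real r) * real a)"
      if "r \<le> q" "q \<le> n" for q
      using weight_level[OF that] that by (simp add: pt_def of_nat_diff)
    have "pt s = (1 - u) *\<^sub>R pt k + u *\<^sub>R pt k'"
      using pt_eq[of s] pt_eq[of k] pt_eq[of k'] k k' r_less s_le
      by (simp add: us algebra_simps)
    moreover have "pt k \<noteq> pt k'" using k k' by (simp add: pt_def)
    ultimately have "pt s \<in> open_segment (pt k) (pt k')"
      using u unfolding in_segment by blast
    moreover have "pt k \<in> newton_region M" "pt k' \<in> newton_region M"
      using pt_in k k' r_less s_le by simp_all
    ultimately show False using extreme unfolding extreme_point_of_def pt_def by blast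
  qed
  then have "lifts_reducible b"
  proof
    assume low: "\<forall>k. r \<le> k \<longrightarrow> k < s \<longrightarrow> level_sum b k = 0"
    show ?thesis
    \<comment> \<open>Starting at \<open>k = r\<close> the conditions on the chain \<open>v\<close>
      are vacuous.\<close>
    proof (rule lifts_reducible_of_high_order[of r _ b])
      show "Polynomial.coeff (pencil_det r n 1 pX b) m = 0" if "m < s" for m
        unfolding coeff_pencil_det_high using low level_sum_below[of m b] that by (cases "m < r") auto
      show "Polynomial.coeff (pencil_det r n 1 pX b) s \<noteq> 0"
        unfolding coeff_pencil_det_high by (rule s)
    qed (use r_less in auto)
  next
    assume high: "\<forall>k. s < k \<longrightarrow> k \<le> n \<longrightarrow> level_sum b k = 0"
    show ?thesis
    \<comment> \<open>Starting at \<open>k = n\<close> no row is constrained.\<close>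
    proof (rule lifts_reducible_of_low_order[of n b])
      show "Polynomial.coeff (pencil_det r n pX 1 b) m = 0" if "m < n - s" for m
        unfolding coeff_pencil_det_low using high that by auto
      show "Polynomial.coeff (pencil_det r n pX 1 b) (n - s) \<noteq> 0"
        unfolding coeff_pencil_det_low using s s_le by simp
    qed (use s_le in auto)
  qed
  then show ?thesis unfolding lifts_reducible_def using A by (simp add: b_def fun_eq_iff)
qed

end

section \<open>Splitting at a touching vertex\<close>

context adic_lift
begin

lemma inf_mat_prod_one: "inf_mat_prod J inf_mat_one B B" "inf_mat_prod J B inf_mat_one B"
  unfolding inf_mat_prod_def
proof (safe)
  fix i j
  have "adic_sums J (\<lambda>k. inf_mat_one i k * B k j) (\<Sum>k<Suc i. inf_mat_one i k * B k j)"
    by (rule adic_sums_finite) (simp add: inf_mat_one_def)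
  moreover have "(\<Sum>k<Suc i. inf_mat_one i k * B k j) = (\<Sum>k<Suc i. if i = k then B k j else 0)"
    by (rule sum.cong) (auto simp: inf_mat_one_def)
  ultimately show "adic_sums J (\<lambda>k. inf_mat_one i k * B k j) (B i j)" by simp
  have "adic_sums J (\<lambda>k. B i k * inf_mat_one k j) (\<Sum>k<Suc j. B i k * inf_mat_one k j)"
    by (rule adic_sums_finite) (simp add: inf_mat_one_def)
  moreover have "(\<Sum>k<Suc j. B i k * inf_mat_one k j) = (\<Sum>k<Suc j. if k = j then B i k else 0)"
    by (rule sum.cong) (auto simp: inf_mat_one_def)
  ultimately show "adic_sums J (\<lambda>k. B i k * inf_mat_one k j) (B i j)" by simp
qed

text \<open>There is no index \<open>s - 1\<close> to define a level; the block is empty and the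
  identity conjugates.\<close>

lemma reducible_0: "reducible 0 A"
proof -
  have "inf_mat_prod3 J inf_mat_one (hodge_mat A) inf_mat_one (hodge_mat A)"
    unfolding inf_mat_prod3_def using inf_mat_prod_one by blast
  then show ?thesis
    unfolding reducible_def inf_mat_inverse_def hodge_stable_def hodge_bounded_iff
    using inf_mat_prod_one by blast
qed

text \<open>The level is the maximal interval on which \<open>l\<close> has the value
  \<open>l (s - 1)\<close>; it ends because \<open>l\<close> tends to infinity.\<close>

lemma adic_level_exists:
  assumes "0 < s"
  obtains r n a where "adic_level J t l \<rho> r s n a"
proof -
  define a where "a = l (s - 1)"
  define r where "r = (LEAST i. a \<le> l i)"
  define n where "n = (LEAST i. a < l i)"
  obtain K where "a < l K"
    using l_at_top unfolding filterlim_at_top eventually_sequentially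
    by (metis Suc_le_eq order_refl)
  then have n: "a < l n" "\<And>i. i < n \<Longrightarrow> l i \<le> a"
    unfolding n_def by (metis LeastI, metis not_less_Least not_less)
  have r: "a \<le> l r" "\<And>i. i < r \<Longrightarrow> l i < a"
    unfolding r_def by (metis LeastI a_def order_refl, metis not_less_Least not_less)
  have "adic_level J t l \<rho> r s n a"
  proof
    show "r < s"
    proof (rule ccontr)
      assume "\<not> r < s"
      then have "s - 1 < r" using assms by simp
      then show False using r(2) by (force simp: a_def)
    qed
    show "s \<le> n"
    proof (rule ccontr)
      assume "\<not> s \<le> n"
      then have "n \<le> s - 1" by simp
      then show False using n(1) l_mono by (force simp: a_def dest: leD)
    qed
    show "l i < a" if "i < r" for i using r(2) that .
    show "l i = a" if "r \<le> i" "i < n" for i using n(2)[OF that(2)] r(1) l_mono[OF that(1)] by simp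
    show "a < l i" if "n \<le> i" for i using n(1) l_mono[OF that] by simp
  qed
  then show thesis by (rule that)
qed

end

theorem theorem2p3p13:
  fixes \<mm> :: "'r::ring_1 set" and t :: 'r
    and \<pi> :: "'r \<Rightarrow> 'p::prime_card mod_ring fps"
    and l :: "nat \<Rightarrow> nat"
    and M :: "'r inf_mat"
    and \<Omega> :: "nat set"
  defines "J \<equiv> two_sided_ideal hull (insert t \<mm>)"
  defines "Mbar \<equiv> \<lambda>i j. \<pi> (M i j)"
  assumes ideal: "two_sided_ideal \<mm>"
    and central: "\<And>x. t * x = x * t"
    and non_zero_divisor: "\<And>x. t * x = 0 \<Longrightarrow> x = 0"
    and complete: "adic_complete J"
    and hom: "Ring_Hom.ring_hom \<pi>" and surj: "surj \<pi>"
    and kernel: "{x. \<pi> x = 0} = \<mm>" and pi_t: "\<pi> t = fps_X"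
    and lift: "\<And>y. \<exists>x. \<pi> x = y \<and> elt_val t x = fps_val y"
    and mono: "mono l" and unbounded: "filterlim l at_top sequentially"
    and bounded: "hodge_bounded J t l M"
    and infinite: "infinite \<Omega>"
    and touching: "\<And>s. s \<in> \<Omega> \<Longrightarrow> touching_vertex Mbar s"
    and newton_eq: "\<And>s. s \<in> \<Omega> \<Longrightarrow> newton_fun Mbar s = enat (\<Sum>i<s. l i)"
  shows "\<exists>Q Q' C. inf_mat_inverse J Q Q' \<and> hodge_stable J t l Q \<and>
           inf_mat_prod3 J Q M Q' C \<and> hodge_bounded J t l C \<and>
           (\<forall>i j. (LEAST s. s \<in> \<Omega>) \<le> i \<and> j < (LEAST s. s \<in> \<Omega>) \<longrightarrow> C i j = 0)"
proof -
  interpret \<pi>: Ring_Hom.ring_hom \<pi> by (rule hom)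
  define \<rho> where "\<rho> x = fps_nth (\<pi> x) 0" for x
  have ideal_J: "two_sided_ideal J" unfolding J_def by (rule two_sided_ideal_hull)
  have sub: "insert t \<mm> \<subseteq> J" unfolding J_def by (rule hull_subset)
  have kernel_\<rho>: "\<rho> x = 0 \<longleftrightarrow> x \<in> J" for x
  proof
    assume "\<rho> x = 0"
    \<comment> \<open>A zero constant term allows division by \<open>fps_X\<close>; lifting the
      quotient to \<open>y\<close> leaves \<open>x - t * y\<close> in the kernel of
      \<open>\<pi>\<close>.\<close>
    then have "\<pi> x = fps_X * fps_shift 1 (\<pi> x)"
      by (intro fps_ext) (simp add: \<rho>_def)
    moreover obtain y where "\<pi> y = fps_shift 1 (\<pi> x)" using surj by (metis surjD)
    ultimately have "\<pi> (x - t * y) = 0" by (simp add: \<pi>.hom_minus \<pi>.hom_mult pi_t)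
    then have "x - t * y \<in> J" using kernel sub by blast
    moreover have "t * y \<in> J" using sub ideal_J by (auto simp: two_sided_ideal_def)
    ultimately have "(x - t * y) + t * y \<in> J" using ideal_J unfolding two_sided_ideal_def by blast
    then show "x \<in> J" by simp
  next
    assume "x \<in> J"
    moreover have "J \<subseteq> {x. \<rho> x = 0}"
      unfolding J_def
    proof (rule hull_minimal)
      show "insert t \<mm> \<subseteq> {x. \<rho> x = 0}" using kernel by (auto simp: \<rho>_def pi_t)
      show "two_sided_ideal {x. \<rho> x = 0}"
        by (simp add: two_sided_ideal_def \<rho>_def \<pi>.hom_add \<pi>.hom_mult)
    qed
    ultimately show "\<rho> x = 0" by blast
  qed
  have surj_\<rho>: "\<exists>x. \<rho> x = y" for y
  proof -
    obtain x where "\<pi> x = fps_const y" using surj by (metis surjD)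
    then show ?thesis by (intro exI[of _ x]) (simp add: \<rho>_def)
  qed
  interpret adic_lift J t l \<rho>
    by unfold_locales
      (use ideal_J complete sub central non_zero_divisor surj_\<rho> kernel_\<rho> mono unbounded in
        \<open>auto simp: \<rho>_def \<pi>.hom_add \<pi>.hom_mult\<close>)
  define s where "s = (LEAST s. s \<in> \<Omega>)"
  obtain s' where "s' \<in> \<Omega>" using infinite by fastforce
  then have s: "s \<in> \<Omega>" unfolding s_def by (rule LeastI)
  obtain A where A: "M = hodge_mat A" using bounded hodge_bounded_iff by blast
  have "reducible s A"
  proof (cases "s = 0")
    case True
    then show ?thesis using reducible_0 by simp
  next
    case False
    then obtain r n a where "adic_level J t l \<rho> r s n a" using adic_level_exists by blast
    then interpret adic_level J t l \<rho> r s n a .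
    have "Mbar i j = fps_X ^ l i * \<pi> (A i j)" for i j
      by (simp add: Mbar_def A hodge_mat_def \<pi>.hom_mult \<pi>.hom_power pi_t)
    moreover have "(real s, real (\<Sum>i<s. l i)) extreme_point_of newton_region Mbar"
      using touching[OF s] newton_eq[OF s] by (auto simp: touching_vertex_def)
    ultimately show ?thesis
      using reducible_of_vertex[of Mbar "\<lambda>i j. \<pi> (A i j)" A] newton_eq[OF s] by (simp add: \<rho>_def)
  qed
  then show ?thesis unfolding reducible_def A s_def .
qed

end
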